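(* Let $E_1,\dots,E_7$ be the following graphs, each on the vertex set $\{0,1,\dots,7\}$: $E_1$ has edge set $\{01,12,13,14,15,24,35,45,46,57\}$; $E_2$ has edge set $\{01,02,04,06,13,16,17,23,25,27,34,45,46\}$; $E_3$ is $E_2$ with the edge $12$ added; $E_4$ is $E_2$ with the edge $14$ added; $E_5$ is $E_2$ with the edges $12$ and $24$ added; $E_6$ is $E_2$ with the edges $12$ and $14$ added; $E_7$ is $E_2$ with the edges $12$, $14$ and $24$ added. Then a connected graph $G$ on $8$ vertices satisfies $M(G) < Z(G)$ if and only if $G$ is isomorphic to one of $E_1,\dots,E_7$.
   Context: All graphs are simple and undirected. For a graph $G$ on $n$ vertices, $S(G)$ is the set of real symmetric $n\times n$ matrices $A$ such that for $i\neq j$, $a_{ij}\neq 0$ if and only if $ij$ is an edge of $G$ (diagonal entries are unrestricted). The maximum nullity is $M(G)=\max\{\operatorname{nullity} A : A\in S(G)\}$. Zero forcing: each vertex is colored blue or white; the color change rule says that if a blue vertex $b$ has exactly one white neighbor $w$, then $w$ is recolored blue. A set $Z\subseteq V(G)$ is a zero forcing set if, coloring exactly the vertices of $Z$ blue initially, repeated application of the rule turns all vertices blue. The zero forcing number $Z(G)$ is the minimum size of a zero forcing set. *)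

theory Defs
  imports "HOL-Analysis.Analysis" "Graph_Theory.Graph_Theory"
begin

text \<open>
  A simple undirected graph is a \<open>pair_graph\<close>: a finite, loop-free graph whose
  arc relation is symmetric, so that an edge \<open>ij\<close> is the pair of arcs
  \<open>(i, j)\<close> and \<open>(j, i)\<close>.
\<close>

subsection \<open>Maximum nullity\<close>

text \<open>
  The rows and columns of a matrix are indexed by the elements of the type \<open>'v\<close>, so
  this is meant for graphs with \<open>pverts G = UNIV\<close>.
\<close>

definition sym_matrices :: "'v::finite pair_pre_digraph \<Rightarrow> (real^'v^'v) set" where
  "sym_matrices G =
    {A. transpose A = A \<and> (\<forall>i j. i \<noteq> j \<longrightarrow> (A $ i $ j \<noteq> 0 \<longleftrightarrow> (i, j) \<in> parcs G))}"

definition nullity :: "real^'n^'m \<Rightarrow> nat" where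
  "nullity A = dim {x. A *v x = 0}"

text \<open>The maximum is over a nonempty set of numbers bounded by \<open>CARD('v)\<close>.\<close>

definition max_nullity :: "'v::finite pair_pre_digraph \<Rightarrow> nat" where
  "max_nullity G = Max (nullity ` sym_matrices G)"

subsection \<open>Zero forcing\<close>

text \<open>\<open>color_change G B B'\<close>: one application of the color change rule turns the set
  \<open>B\<close> of blue vertices into \<open>B'\<close>.\<close>

definition color_change :: "'a pair_pre_digraph \<Rightarrow> 'a set \<Rightarrow> 'a set \<Rightarrow> bool" where
  "color_change G B B' \<longleftrightarrow>
    (\<exists>b\<in>B. \<exists>w. {v. (b, v) \<in> parcs G \<and> v \<notin> B} = {w} \<and> B' = insert w B)"

definition zero_forcing_set :: "'a pair_pre_digraph \<Rightarrow> 'a set \<Rightarrow> bool" where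
  "zero_forcing_set G Z \<longleftrightarrow> Z \<subseteq> pverts G \<and> (color_change G)\<^sup>*\<^sup>* Z (pverts G)"

definition zero_forcing_number :: "'a pair_pre_digraph \<Rightarrow> nat" where
  "zero_forcing_number G = Min (card ` {Z. zero_forcing_set G Z})"

subsection \<open>The exceptional graphs\<close>

definition graph_of :: "nat rel \<Rightarrow> nat pair_pre_digraph" where
  "graph_of es = \<lparr> pverts = {0..7}, parcs = es \<union> es\<inverse> \<rparr>"

definition edges1 :: "nat rel" where
  "edges1 = {(0,1), (1,2), (1,3), (1,4), (1,5), (2,4), (3,5), (4,5), (4,6), (5,7)}"

definition edges2 :: "nat rel" where
  "edges2 = {(0,1), (0,2), (0,4), (0,6), (1,3), (1,6), (1,7), (2,3), (2,5), (2,7), (3,4),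
     (4,5), (4,6)}"

definition "E1 = graph_of edges1"
definition "E2 = graph_of edges2"
definition "E3 = graph_of (edges2 \<union> {(1,2)})"
definition "E4 = graph_of (edges2 \<union> {(1,4)})"
definition "E5 = graph_of (edges2 \<union> {(1,2), (2,4)})"
definition "E6 = graph_of (edges2 \<union> {(1,2), (1,4)})"
definition "E7 = graph_of (edges2 \<union> {(1,2), (1,4), (2,4)})"

end

theory Submission
  imports Defs
begin

text \<open>
  If integer vectors \<open>f x\<close> in dimension \<open>r\<close> and a diagonal form are such that distinct vertices \<open>x\<close>, \<open>y\<close>
  are adjacent iff \<open>f x\<close> and \<open>f y\<close> are not orthogonal, then the Gram matrix of the vectors has
  rank at most \<open>r\<close>. Apart from the seven exceptions, every graph on 8 vertices has such vectors, with
  entries in \<open>-3, \<dots>, 3\<close>, for \<open>r = 8 - k\<close> and a zero forcing set of size \<open>k\<close>. All graphs arise by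
  repeatedly adding a vertex of maximal degree (ties are broken by the degrees of the neighbours),
  so it suffices to list, for each graph \<open>H\<close> on 7 vertices up to isomorphism, some vectors for \<open>H\<close>:
  each further vector then settles the extension of \<open>H\<close> by a vertex that is adjacent to the
  non-orthogonal ones.

  For the exceptional graphs, zero forcing is strengthened: when it is known which diagonal entries
  of the matrix vanish, any row whose only unknown coordinate has a nonzero coefficient forces this
  coordinate of a kernel vector to vanish. Whatever the zero pattern of the diagonal, a set with fewer
  vertices than the zero forcing number then forces everything.
\<close>

section \<open>Nullity and zero forcing\<close>

text \<open>The form of nearly all definitions is dictated by evaluation inside the logic: the tests
  are run by \<open>code_simp\<close>, that is, by rewriting with code equations. Hence integers are
  unary, recursion is structural, lengths are measured by walking along another list, and a guard or
  an intermediate result that is used more than once becomes an argument of an auxiliary function,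
  so that it is rewritten once and before a branch is chosen. No data are trusted. A wrong vector,
  permutation or forcing set can only make a test fail, so decoding needs no correctness proof; only
  the final comparisons do. Isomorphism does not enter the enumeration. A graph is a relation on a
  finite vertex set, and a catalogue entry matches it if some enumeration of the vertices has the
  listed code; canonical forms and counts of graphs are avoided. The forms are mostly indefinite
  because matrices in S(G) may have eigenvalues of both signs, and isotropic vectors give zero
  diagonal entries.\<close>

text \<open>An integer is written as a list of signs; the lists that occur are unary, i.e. contain one
  sign only.\<close>

definition tally :: "bool list \<Rightarrow> int" where
  "tally a = (\<Sum>b\<leftarrow>a. if b then 1 else -1)"

text \<open>Missing entries count as 0, so every list serves as a vector of every dimension and no
  lengths have to be checked.\<close>

definition coordinate :: "bool list list \<Rightarrow> nat \<Rightarrow> int" where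
  "coordinate v k = (if k < length v then tally (v ! k) else 0)"

definition form :: "bool list list \<Rightarrow> bool list list \<Rightarrow> bool list list \<Rightarrow> int" where
  "form D u w = (\<Sum>k<length D. coordinate D k * coordinate u k * coordinate w k)"

definition represents ::
    "bool list list \<Rightarrow> ('a \<Rightarrow> bool list list) \<Rightarrow> ('a \<Rightarrow> 'a \<Rightarrow> bool) \<Rightarrow> 'a set \<Rightarrow> bool" where
  "represents D f R V \<longleftrightarrow>
     (\<forall>x\<in>V. \<forall>y\<in>V. x \<noteq> y \<longrightarrow> (R x y \<longleftrightarrow> form D (f x) (f y) \<noteq> 0))"

definition force :: "('a \<Rightarrow> 'a \<Rightarrow> bool) \<Rightarrow> 'a set \<Rightarrow> 'a set \<Rightarrow> 'a set \<Rightarrow> bool" where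
  "force R V B B' \<longleftrightarrow> (\<exists>b\<in>B. \<exists>w. {u \<in> V. R b u \<and> u \<notin> B} = {w} \<and> B' = insert w B)"

lemma form_commute: "form D u w = form D w u"
  by (simp add: form_def mult.commute mult.left_commute)

text \<open>The Gram matrix factors as the transpose of Q times the diagonal form times Q, where Q
  has the rows \<open>q k\<close>. Its kernel therefore contains the orthogonal complement of
  \<open>length D\<close> vectors. The diagonal entries \<open>form D (f i) (f i)\<close> may be
  anything, as S(G) leaves them free.\<close>

lemma represents_nullity:
  fixes G :: "'v::finite pair_pre_digraph"
  assumes "represents D f (\<lambda>u v. (u, v) \<in> parcs G) UNIV"
  shows "\<exists>A\<in>sym_matrices G. CARD('v) \<le> nullity A + length D"
proof -
  define A :: "real^'v^'v" where "A = (\<chi> i j. of_int (form D (f i) (f j)))"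
  define q :: "nat \<Rightarrow> real^'v" where "q k = (\<chi> j. of_int (coordinate (f j) k))" for k
  have "A \<in> sym_matrices G"
    using assms
    by (auto simp: sym_matrices_def A_def transpose_def vec_eq_iff represents_def form_commute)
  moreover have "CARD('v) \<le> nullity A + length D"
  proof -
    let ?W = "span (q ` {..<length D})"
    have "{x. \<forall>y\<in>?W. orthogonal y x} \<subseteq> {x. A *v x = 0}"
    proof safe
      fix x assume x: "\<forall>y\<in>?W. orthogonal y x"
      have q0: "(\<Sum>j\<in>UNIV. of_int (coordinate (f j) k) * x $ j) = 0" if "k < length D" for k
      proof -
        have "q k \<in> ?W" using that by (auto intro: span_base)
        then have "q k \<bullet> x = 0" using x by (auto simp: orthogonal_def)
        then show ?thesis by (simp add: inner_vec_def q_def)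
      qed
      have "(A *v x) $ i = 0" for i
      proof -
        have "(A *v x) $ i = (\<Sum>j\<in>UNIV. \<Sum>k<length D.
            of_int (coordinate D k * coordinate (f i) k) * (of_int (coordinate (f j) k) * x $ j))"
          by (simp add: matrix_vector_mult_def A_def form_def sum_distrib_right mult.assoc)
        also have "\<dots> = (\<Sum>k<length D. of_int (coordinate D k * coordinate (f i) k) *
            (\<Sum>j\<in>UNIV. of_int (coordinate (f j) k) * x $ j))"
          by (subst sum.swap) (simp add: sum_distrib_left)
        also have "\<dots> = 0" by (simp add: q0)
        finally show ?thesis .
      qed
      then show "A *v x = 0" by (simp add: vec_eq_iff)
    qed
    then have "dim {x. \<forall>y\<in>?W. orthogonal y x} \<le> nullity A"
      unfolding nullity_def by (rule dim_subset)
    moreover have "dim {x. \<forall>y\<in>?W. orthogonal y x} + dim ?W = CARD('v)"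
      using dim_subspace_orthogonal_to_vectors[of ?W "UNIV :: (real^'v) set"] by simp
    moreover have "dim ?W \<le> length D"
      by (metis card_image_le card_lessThan dim_le_card dim_span finite_imageI finite_lessThan
          order_trans span_superset)
    ultimately show ?thesis by linarith
  qed
  ultimately show ?thesis by blast
qed

lemma nullity_le_CARD: "nullity (A :: real^'n^'m) \<le> CARD('n)"
  unfolding nullity_def by (rule order_trans[OF dim_subset_UNIV]) simp

lemma finite_nullities: "finite (nullity ` sym_matrices (G :: 'v::finite pair_pre_digraph))"
  by (rule finite_subset[of _ "{..CARD('v)}"]) (auto simp: nullity_le_CARD)

lemma color_change_eq_force: "color_change G = force (\<lambda>u v. (u, v) \<in> parcs G) UNIV"
  by (auto simp: color_change_def force_def fun_eq_iff)

lemma zero_forcing_number_le: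
  assumes "pverts G = (UNIV :: 'v::finite set)"
    and "(force (\<lambda>u v. (u, v) \<in> parcs G) UNIV)\<^sup>*\<^sup>* B UNIV"
  shows "zero_forcing_number G \<le> card B"
  unfolding zero_forcing_number_def
  by (rule Min_le) (use assms in \<open>auto simp: zero_forcing_set_def color_change_eq_force\<close>)

lemma zero_forcing_number_le_max_nullity:
  fixes G :: "'v::finite pair_pre_digraph"
  assumes "pverts G = UNIV"
    and "represents D f (\<lambda>u v. (u, v) \<in> parcs G) UNIV"
    and "(force (\<lambda>u v. (u, v) \<in> parcs G) UNIV)\<^sup>*\<^sup>* B UNIV"
    and "card B + length D \<le> CARD('v)"
  shows "zero_forcing_number G \<le> max_nullity G"
proof -
  obtain A where A: "A \<in> sym_matrices G" "CARD('v) \<le> nullity A + length D"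
    using represents_nullity assms(2) by blast
  have "nullity A \<le> max_nullity G"
    unfolding max_nullity_def using A(1) finite_nullities by (intro Max_ge) auto
  with A(2) assms(4) zero_forcing_number_le[OF assms(1,3)] show ?thesis by linarith
qed

text \<open>The added vertex is blue from the start, so it is never a white neighbour and every old
  force remains a force.\<close>

lemma force_insert:
  assumes "force R V B B'" "v \<notin> V"
  shows "force R (insert v V) (insert v B) (insert v B')"
proof -
  obtain b w where b: "b \<in> B" "{u \<in> V. R b u \<and> u \<notin> B} = {w}" "B' = insert w B"
    using assms(1) by (auto simp: force_def)
  have "{u \<in> insert v V. R b u \<and> u \<notin> insert v B} = {u \<in> V. R b u \<and> u \<notin> B}"
    using assms(2) by auto
  then show ?thesis
    unfolding force_def using b by (intro bexI[of _ b] exI[of _ w]) auto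
qed

lemma force_insert_closure:
  assumes "(force R V)\<^sup>*\<^sup>* B B'" "v \<notin> V"
  shows "(force R (insert v V))\<^sup>*\<^sup>* (insert v B) (insert v B')"
  using assms(1)
proof (induction rule: rtranclp_induct)
  case (step y z)
  then show ?case using force_insert[OF step.hyps(2) assms(2)] by (metis rtranclp.rtrancl_into_rtrancl)
qed simp

text \<open>The enlargement of the blue set \<open>B\<close> caused by \<open>b\<close>, which need not be blue itself.\<close>

definition forced :: "('a \<Rightarrow> 'a \<Rightarrow> bool) \<Rightarrow> 'a set \<Rightarrow> 'a set \<Rightarrow> 'a \<Rightarrow> 'a set" where
  "forced R V B b =
     (let W = {u \<in> V. R b u \<and> u \<notin> B} in if is_singleton W then B \<union> W else B)"

lemma forced_superset: "B \<subseteq> forced R V B b"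
  by (auto simp: forced_def Let_def)

lemma forced_subset: "B \<subseteq> V \<Longrightarrow> forced R V B b \<subseteq> V"
  by (auto simp: forced_def Let_def)

lemma force_forced: "b \<in> B \<Longrightarrow> (force R V)\<^sup>*\<^sup>* B (forced R V B b)"
proof (cases "is_singleton {u \<in> V. R b u \<and> u \<notin> B}")
  case True
  then obtain w where w: "{u \<in> V. R b u \<and> u \<notin> B} = {w}"
    by (rule is_singletonE)
  assume "b \<in> B"
  then have "force R V B (insert w B)"
    unfolding force_def using w by blast
  then show ?thesis
    by (simp add: forced_def w)
qed (simp add: forced_def)

text \<open>If the unique white neighbour of \<open>b\<close> relative to \<open>Z\<close> were
  still white in the larger set \<open>B\<close>, it would be the unique one relative to
  \<open>B\<close> too, and \<open>B\<close> would not be stuck.\<close>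

lemma forced_of_force:
  assumes "force R V Z Z'" "Z \<subseteq> B" "\<forall>b\<in>B. forced R V B b = B"
  shows "Z' \<subseteq> B"
proof -
  obtain b w where b: "b \<in> Z" "{u \<in> V. R b u \<and> u \<notin> Z} = {w}" "Z' = insert w Z"
    using assms(1) by (auto simp: force_def)
  have "w \<in> B"
  proof (rule ccontr)
    assume "w \<notin> B"
    then have "{u \<in> V. R b u \<and> u \<notin> B} = {w}" using b(2) assms(2) by blast
    then have "w \<in> forced R V B b" by (simp add: forced_def is_singleton_def)
    with b(1) assms(2,3) \<open>w \<notin> B\<close> show False by auto
  qed
  with b assms(2) show ?thesis by auto
qed

lemma stuck_superset:
  assumes "(force R V)\<^sup>*\<^sup>* Z Z'" "Z \<subseteq> B" "\<forall>b\<in>B. forced R V B b = B"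
  shows "Z' \<subseteq> B"
  using assms(1)
proof (induction rule: rtranclp_induct)
  case (step y z)
  then show ?case using forced_of_force[OF _ _ assms(3)] by blast
qed (rule assms(2))

text \<open>The relation is the support of \<open>A\<close> including the diagonal. So an index
  \<open>b\<close> outside \<open>B\<close> can force another one if \<open>A $ b $ b = 0\<close>,
  and can force itself if \<open>A $ b $ b\<close> is the only nonzero coefficient left in its
  row.\<close>

lemma vanishes_forced:
  fixes A :: "real^'v^'v"
  assumes "A *v x = 0" "\<forall>i\<in>B. x $ i = 0"
  shows "\<forall>i\<in>forced (\<lambda>u v. A $ u $ v \<noteq> 0) UNIV B b. x $ i = 0"
proof -
  let ?W = "{u. A $ b $ u \<noteq> 0 \<and> u \<notin> B}"
  have "x $ w = 0" if "?W = {w}" for w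
  proof -
    have "0 = (A *v x) $ b" using assms(1) by simp
    also have "\<dots> = (\<Sum>j\<in>UNIV. if j = w then A $ b $ w * x $ w else 0)"
      unfolding matrix_vector_mult_def vec_lambda_beta
      by (rule sum.cong) (use that assms(2) in auto)
    finally show ?thesis using that by auto
  qed
  moreover have "w \<in> ?W \<Longrightarrow> is_singleton ?W \<Longrightarrow> ?W = {w}" for w
    by (metis is_singletonE singletonD)
  ultimately show ?thesis
    using assms(2) by (auto simp: forced_def Let_def)
qed

text \<open>Vanishing on \<open>B\<close> imposes at most \<open>card B\<close> linear conditions,
  too few to annihilate a larger kernel. Together with propagation of zeros this bounds the nullity
  by the size of any set from which the zeros spread everywhere.\<close>

lemma kernel_vector_vanishing:
  fixes A :: "real^'v^'v"
  assumes "card B < nullity A"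
  obtains x where "A *v x = 0" "x \<noteq> 0" "\<forall>i\<in>B. x $ i = 0"
proof -
  define K T where "K = {x. A *v x = 0}"
    and "T = {x. \<forall>y\<in>span ((\<lambda>i. axis i 1 :: real^'v) ` B). orthogonal y x}"
  have K: "subspace K"
    by (auto simp: subspace_def matrix_vector_right_distrib matrix_vector_mult_scaleR K_def)
  have T: "subspace T"
    by (auto simp: subspace_def orthogonal_clauses T_def)
  have "dim (span ((\<lambda>i. axis i 1 :: real^'v) ` B)) \<le> card B"
    by (metis card_image_le dim_le_card dim_span finite finite_imageI order_trans span_superset)
  moreover have "dim T + dim (span ((\<lambda>i. axis i 1 :: real^'v) ` B)) = CARD('v)"
    using dim_subspace_orthogonal_to_vectors
        [of "span ((\<lambda>i. axis i 1 :: real^'v) ` B)" "UNIV :: (real^'v) set"]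
    by (simp add: T_def)
  moreover have "dim {x + y |x y. x \<in> K \<and> y \<in> T} + dim (K \<inter> T) = dim K + dim T"
    by (rule dim_sums_Int[OF K T])
  moreover have "dim {x + y |x y. x \<in> K \<and> y \<in> T} \<le> CARD('v)"
    by (rule order_trans[OF dim_subset_UNIV]) simp
  moreover have "card B < dim K"
    using assms by (simp add: nullity_def K_def)
  ultimately have "dim (K \<inter> T) \<noteq> 0"
    by linarith
  then have "\<not> K \<inter> T \<subseteq> {0}"
    by (simp only: dim_eq_0 not_False_eq_True)
  then obtain x where x: "x \<in> K" "x \<in> T" "x \<noteq> 0"
    by blast
  have "x $ i = 0" if "i \<in> B" for i
  proof -
    have "orthogonal (axis i 1) x" using that x(2) by (auto simp: T_def intro: span_base)
    then show ?thesis by (simp add: inner_axis' orthogonal_def)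
  qed
  with x show ?thesis by (intro that) (auto simp: K_def)
qed

section \<open>Evaluable tests\<close>

subsection \<open>Unary arithmetic\<close>

text \<open>Opposite signs cancel at the head, so a unary accumulator stays unary. Zero then has the
  empty list as its only code, and \<open>nonempty\<close> decides whether a sum vanishes.\<close>

fun push :: "bool \<Rightarrow> bool list \<Rightarrow> bool list" where
  "push b [] = [b]"
| "push True (True # a) = True # True # a"
| "push True (False # a) = a"
| "push False (True # a) = a"
| "push False (False # a) = False # False # a"

fun add_signs :: "bool list \<Rightarrow> bool list \<Rightarrow> bool list" where
  "add_signs [] a = a"
| "add_signs (b # y) a = add_signs y (push b a)"

fun sub_signs :: "bool list \<Rightarrow> bool list \<Rightarrow> bool list" where
  "sub_signs [] a = a"
| "sub_signs (True # y) a = sub_signs y (push False a)"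
| "sub_signs (False # y) a = sub_signs y (push True a)"

fun add_product :: "bool list \<Rightarrow> bool list \<Rightarrow> bool list \<Rightarrow> bool list" where
  "add_product [] y a = a"
| "add_product (True # x) y a = add_product x y (add_signs y a)"
| "add_product (False # x) y a = add_product x y (sub_signs y a)"

fun dot :: "bool list list \<Rightarrow> bool list list \<Rightarrow> bool list \<Rightarrow> bool list" where
  "dot [] ys a = a"
| "dot (x # xs) [] a = a"
| "dot (x # xs) (y # ys) a = dot xs ys (add_product x y a)"

fun scale :: "bool list list \<Rightarrow> bool list list \<Rightarrow> bool list list" where
  "scale [] xs = []"
| "scale (d # ds) [] = []"
| "scale (d # ds) (x # xs) = add_product d x [] # scale ds xs"

fun nonempty :: "'a list \<Rightarrow> bool" where
  "nonempty [] = False"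
| "nonempty (x # xs) = True"

fun incidences :: "bool list list list \<Rightarrow> bool list list \<Rightarrow> bool list" where
  "incidences [] w = []"
| "incidences (v # vs) w = nonempty (dot w v []) # incidences vs w"

definition unary :: "bool list \<Rightarrow> bool" where
  "unary a \<longleftrightarrow> (\<exists>c. set a \<subseteq> {c})"

lemma tally_simps [simp]:
  "tally [] = 0" "tally (True # a) = 1 + tally a" "tally (False # a) = tally a - 1"
  by (simp_all add: tally_def)

lemma tally_unary: "set a \<subseteq> {b} \<Longrightarrow> tally a = (if b then int (length a) else - int (length a))"
  by (induction a) (auto simp: tally_def)

lemma tally_eq_0_iff: "unary a \<Longrightarrow> tally a = 0 \<longleftrightarrow> a = []"
  unfolding unary_def by (auto simp: tally_unary split: if_splits)

lemma push: "unary a \<Longrightarrow> unary (push b a)" "tally (push b a) = tally [b] + tally a"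
  by (induction b a rule: push.induct) (auto simp: unary_def)

lemma add_signs:
  "unary a \<Longrightarrow> unary (add_signs y a)" "tally (add_signs y a) = tally y + tally a"
  by (induction y a rule: add_signs.induct) (auto simp: push, auto simp: tally_def)

lemma sub_signs:
  "unary a \<Longrightarrow> unary (sub_signs y a)" "tally (sub_signs y a) = tally a - tally y"
  by (induction y a rule: sub_signs.induct) (auto simp: push)

lemma add_product:
  "unary a \<Longrightarrow> unary (add_product x y a)" "tally (add_product x y a) = tally x * tally y + tally a"
  by (induction x y a rule: add_product.induct)
    (auto simp: add_signs sub_signs algebra_simps)

lemma coordinate_Nil [simp]: "coordinate [] k = 0"
  by (simp add: coordinate_def)

lemma coordinate_Cons [simp]:
  "coordinate (x # xs) 0 = tally x" "coordinate (x # xs) (Suc k) = coordinate xs k"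
  by (simp_all add: coordinate_def)

lemma dot:
  "unary a \<Longrightarrow> unary (dot xs ys a)"
  "tally (dot xs ys a) = tally a + (\<Sum>k<length xs. coordinate xs k * coordinate ys k)"
  by (induction xs ys a rule: dot.induct)
    (simp_all add: add_product sum.lessThan_Suc_shift del: sum.lessThan_Suc)

lemma coordinate_scale: "coordinate (scale D v) k = coordinate D k * coordinate v k"
proof (induction D v arbitrary: k rule: scale.induct)
  case (3 d ds x xs)
  then show ?case by (cases k) (simp_all add: add_product)
qed simp_all

lemma length_scale: "length (scale D v) \<le> length D"
  by (induction D v rule: scale.induct) auto

lemma nonempty_iff [simp]: "nonempty xs \<longleftrightarrow> xs \<noteq> []"
  by (cases xs) auto

lemma coordinate_beyond: "length v \<le> k \<Longrightarrow> coordinate v k = 0"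
  by (simp add: coordinate_def)

text \<open>The form is folded into one argument by \<open>scale\<close>. Both orders occur:
  \<open>embeds\<close> scales the vector of the row under test, whereas for new vertices the old
  vectors are scaled once and reused for every new vector.\<close>

lemma nonempty_dot_scale:
  "nonempty (dot (scale D u) w []) \<longleftrightarrow> form D u w \<noteq> 0"
  "nonempty (dot w (scale D u) []) \<longleftrightarrow> form D u w \<noteq> 0"
proof -
  have "(\<Sum>k<length (scale D u). coordinate (scale D u) k * coordinate w k) = form D u w"
  proof -
    have "form D u w = (\<Sum>k<length D. coordinate (scale D u) k * coordinate w k)"
      by (simp add: form_def coordinate_scale)
    also have "\<dots> = (\<Sum>k<length (scale D u). coordinate (scale D u) k * coordinate w k)"
      by (rule sum.mono_neutral_right) (use length_scale[of D u] in \<open>auto simp: coordinate_beyond\<close>)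
    finally show ?thesis by simp
  qed
  moreover have "(\<Sum>k<length w. coordinate w k * coordinate (scale D u) k) = form D u w"
  proof -
    let ?g = "\<lambda>k. coordinate w k * coordinate (scale D u) k"
    have "sum ?g {..<length w} = sum ?g {..<max (length w) (length D)}"
      by (rule sum.mono_neutral_left) (auto simp: coordinate_beyond)
    also have "\<dots> = sum ?g {..<length D}"
      by (rule sum.mono_neutral_right) (auto simp: coordinate_beyond coordinate_scale)
    also have "\<dots> = form D u w"
      by (simp add: form_def coordinate_scale mult.commute mult.left_commute)
    finally show ?thesis .
  qed
  moreover have "nonempty (dot xs ys []) \<longleftrightarrow>
      (\<Sum>k<length xs. coordinate xs k * coordinate ys k) \<noteq> 0" for xs ys
    using tally_eq_0_iff[OF dot(1), of "[]" xs ys] by (simp add: dot(2) unary_def)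
  ultimately show "nonempty (dot (scale D u) w []) \<longleftrightarrow> form D u w \<noteq> 0"
    "nonempty (dot w (scale D u) []) \<longleftrightarrow> form D u w \<noteq> 0"
    by simp_all
qed

lemma incidences_eq_map: "incidences vs w = map (\<lambda>v. nonempty (dot w v [])) vs"
  by (induction vs) auto

subsection \<open>Graphs as bit lists\<close>

text \<open>A graph with vertices \<open>xs\<close> is stored as the part of its adjacency matrix above the
  diagonal. A new vertex comes first.\<close>

fun rows :: "('a \<Rightarrow> 'a \<Rightarrow> bool) \<Rightarrow> 'a list \<Rightarrow> bool list list" where
  "rows R [] = []"
| "rows R (x # xs) = map (R x) xs # rows R xs"

definition adjacency :: "('a \<Rightarrow> 'a \<Rightarrow> bool) \<Rightarrow> 'a list \<Rightarrow> 'a list \<Rightarrow> bool list list" where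
  "adjacency R xs ys = map (\<lambda>x. map (R x) ys) xs"

fun add_column :: "bool list \<Rightarrow> bool list list \<Rightarrow> bool list list" where
  "add_column [] F = []"
| "add_column (b # S) [] = []"
| "add_column (b # S) (r # F) = (b # r) # add_column S F"

definition extend :: "bool list \<Rightarrow> bool list list \<Rightarrow> bool list list" where
  "extend S F = (False # S) # add_column S F"

fun complete_matrix :: "bool list list \<Rightarrow> bool list list" where
  "complete_matrix [] = []"
| "complete_matrix (S # G) = extend S (complete_matrix G)"

fun prefix :: "nat \<Rightarrow> 'a list \<Rightarrow> 'a list" where
  "prefix 0 bs = []"
| "prefix (Suc n) [] = []"
| "prefix (Suc n) (b # bs) = b # prefix n bs"

fun suffix :: "nat \<Rightarrow> 'a list \<Rightarrow> 'a list" where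
  "suffix 0 bs = bs"
| "suffix (Suc n) [] = []"
| "suffix (Suc n) (b # bs) = suffix n bs"

fun split_rows :: "nat \<Rightarrow> bool list \<Rightarrow> bool list list" where
  "split_rows 0 bs = []"
| "split_rows (Suc n) bs = prefix n bs # split_rows n (suffix n bs)"

lemma add_column_adjacency:
  "(\<And>u w. R u w \<longleftrightarrow> R w u) \<Longrightarrow>
     add_column (map (R v) xs) (adjacency R xs ys) = map (\<lambda>x. R x v # map (R x) ys) xs"
  by (induction xs) (auto simp: adjacency_def)

lemma prefix_append: "prefix (length xs) (xs @ ys) = xs"
  by (induction xs) auto

lemma suffix_append: "suffix (length xs) (xs @ ys) = ys"
  by (induction xs) auto

text \<open>The number of vertices determines where the concatenated rows are to be cut, so the flat
  code together with this number determines the graph.\<close>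

lemma split_rows: "split_rows (length xs) (concat (rows R xs)) = rows R xs"
proof (induction xs)
  case (Cons x xs)
  then show ?case
    using prefix_append[of "map (R x) xs"] suffix_append[of "map (R x) xs"] by simp
qed simp

fun popcount :: "bool list \<Rightarrow> nat" where
  "popcount [] = 0"
| "popcount (True # b) = Suc (popcount b)"
| "popcount (False # b) = popcount b"

lemma popcount_map: "distinct xs \<Longrightarrow> popcount (map P xs) = card {x \<in> set xs. P x}"
proof (induction xs)
  case (Cons x xs)
  show ?case
  proof (cases "P x")
    case True
    then have "{y \<in> set (x # xs). P y} = insert x {y \<in> set xs. P y}" by auto
    with Cons True show ?thesis by simp
  next
    case False
    then have "{y \<in> set (x # xs). P y} = {y \<in> set xs. P y}" by auto
    with Cons False show ?thesis by simp
  qed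
qed simp

text \<open>Any bit list of the right length is the characteristic list of a set, so a forcing set
  read from a certificate needs no check apart from its length.\<close>

lemma ex_subset_of_bits:
  assumes "distinct xs" "length bl = length xs"
  obtains B where "B \<subseteq> set xs" "bl = map (\<lambda>x. x \<in> B) xs" "popcount bl = card B"
proof -
  define B where "B = {xs ! i |i. i < length xs \<and> bl ! i}"
  have "bl = map (\<lambda>x. x \<in> B) xs"
    using assms by (auto simp: B_def list_eq_iff_nth_eq nth_eq_iff_index_eq)
  moreover have "B \<subseteq> set xs" by (auto simp: B_def)
  moreover have "{x \<in> set xs. x \<in> B} = B" using \<open>B \<subseteq> set xs\<close> by auto
  ultimately show ?thesis
    using popcount_map[OF assms(1), of "\<lambda>x. x \<in> B"] by (intro that[of B]) auto
qed

fun leq :: "nat \<Rightarrow> nat \<Rightarrow> bool" where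
  "leq 0 n = True"
| "leq (Suc m) 0 = False"
| "leq (Suc m) (Suc n) = leq m n"

lemma leq_iff [simp]: "leq m n \<longleftrightarrow> m \<le> n"
  by (induction m n rule: leq.induct) auto

fun bits_equal :: "bool list \<Rightarrow> bool list \<Rightarrow> bool" where
  "bits_equal [] [] = True"
| "bits_equal (True # x) (True # y) = bits_equal x y"
| "bits_equal (False # x) (False # y) = bits_equal x y"
| "bits_equal _ _ = False"

lemma bits_equal_iff [simp]: "bits_equal x y \<longleftrightarrow> x = y"
  by (induction x y rule: bits_equal.induct) auto

subsection \<open>Embeddings\<close>

text \<open>Each vector is compared only with the later ones: the diagonal is free and the form is
  symmetric.\<close>

fun embeds :: "bool list list \<Rightarrow> bool list list \<Rightarrow> bool list list list \<Rightarrow> bool" where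
  "embeds D [] [] = True"
| "embeds D (S # H) (v # vs) = (bits_equal S (incidences vs (scale D v)) \<and> embeds D H vs)"
| "embeds D _ _ = False"

subsection \<open>Zero forcing\<close>

fun all_blue :: "bool list \<Rightarrow> bool list \<Rightarrow> bool" where
  "all_blue [] bl = True"
| "all_blue (r # rs) [] = True"
| "all_blue (False # r) (b # bl) = all_blue r bl"
| "all_blue (True # r) (True # bl) = all_blue r bl"
| "all_blue (True # r) (False # bl) = False"

text \<open>At the first white neighbour the decision falls: it becomes blue exactly if no white
  neighbour follows it. No counting is involved.\<close>

fun recolour :: "bool list \<Rightarrow> bool list \<Rightarrow> bool list" where
  "recolour [] bl = bl"
| "recolour (r # rs) [] = []"
| "recolour (False # r) (b # bl) = b # recolour r bl"
| "recolour (True # r) (True # bl) = True # recolour r bl"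
| "recolour (True # r) (False # bl) = all_blue r bl # bl"

text \<open>The list \<open>c\<close> selects the rows that may act. For zero forcing it is the
  colouring at the start of the sweep, so that only blue vertices force; for kernel vectors it is
  constantly true.\<close>

fun sweep :: "bool list list \<Rightarrow> bool list \<Rightarrow> bool list \<Rightarrow> bool list" where
  "sweep [] c bl = bl"
| "sweep (r # F) [] bl = bl"
| "sweep (r # F) (True # c) bl = sweep F c (recolour r bl)"
| "sweep (r # F) (False # c) bl = sweep F c bl"

fun all_true :: "bool list \<Rightarrow> bool" where
  "all_true [] = True"
| "all_true (True # b) = all_true b"
| "all_true (False # b) = False"

text \<open>The first list of \<open>saturates\<close> only bounds the number of sweeps.\<close>

fun saturates :: "bool \<Rightarrow> 'a list \<Rightarrow> bool list list \<Rightarrow> bool list \<Rightarrow> bool"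
  and saturates' :: "bool list \<Rightarrow> 'a list \<Rightarrow> bool list list \<Rightarrow> bool" where
  "saturates True fuel F bl = True"
| "saturates False [] F bl = False"
| "saturates False (x # fuel) F bl = saturates' (sweep F bl bl) fuel F"
| "saturates' bl fuel F = saturates (all_true bl) fuel F bl"

lemma all_blue_iff:
  "all_blue (map (R b) xs) (map (\<lambda>x. x \<in> B) xs) \<longleftrightarrow> (\<forall>x\<in>set xs. R b x \<longrightarrow> x \<in> B)"
proof (induction xs)
  case (Cons x xs)
  then show ?case by (cases "R b x"; cases "x \<in> B") auto
qed simp

lemma recolour_eq:
  assumes "distinct xs"
  shows "recolour (map (R b) xs) (map (\<lambda>x. x \<in> B) xs) =
    map (\<lambda>x. x \<in> forced R (set xs) B b) xs"
  using assms
proof (induction xs)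
  case (Cons x xs)
  let ?W = "\<lambda>V. {u \<in> V. R b u \<and> u \<notin> B}"
  show ?case
  proof (cases "R b x \<and> x \<notin> B")
    case True
    then have W: "?W (set (x # xs)) = insert x (?W (set xs))" by auto
    have x: "x \<notin> ?W (set xs)" using Cons.prems by auto
    have "is_singleton (?W (set (x # xs))) \<longleftrightarrow> ?W (set xs) = {}"
      unfolding W using x by (auto simp: is_singleton_def)
    also have "\<dots> \<longleftrightarrow> all_blue (map (R b) xs) (map (\<lambda>x. x \<in> B) xs)"
      by (auto simp: all_blue_iff)
    finally have s: "is_singleton (?W (set (x # xs))) \<longleftrightarrow>
      all_blue (map (R b) xs) (map (\<lambda>x. x \<in> B) xs)" .
    have e: "forced R (set (x # xs)) B b =
      (if all_blue (map (R b) xs) (map (\<lambda>x. x \<in> B) xs) then insert x B else B)"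
      unfolding forced_def Let_def s using True by (auto simp: all_blue_iff)
    have "map (\<lambda>y. y \<in> forced R (set (x # xs)) B b) xs = map (\<lambda>y. y \<in> B) xs"
      unfolding e using Cons.prems by auto
    moreover have "x \<in> forced R (set (x # xs)) B b \<longleftrightarrow>
        all_blue (map (R b) xs) (map (\<lambda>x. x \<in> B) xs)"
      unfolding e using True by auto
    ultimately show ?thesis using True by simp
  next
    case False
    then have "?W (set (x # xs)) = ?W (set xs)" by auto
    then have e: "forced R (set (x # xs)) B b = forced R (set xs) B b"
      by (simp add: forced_def)
    have "x \<in> forced R (set xs) B b \<longleftrightarrow> x \<in> B"
      using Cons.prems by (auto simp: forced_def Let_def)
    then show ?thesis
      using Cons False unfolding e by (cases "R b x"; cases "x \<in> B") auto
  qed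
qed simp

lemma sweep_eq:
  assumes "distinct xs"
  shows "sweep (adjacency R ys xs) (map P ys) (map (\<lambda>x. x \<in> B) xs) =
    map (\<lambda>x. x \<in> foldl (forced R (set xs)) B (filter P ys)) xs"
proof (induction ys arbitrary: B)
  case (Cons y ys)
  then show ?case
    by (cases "P y") (auto simp: adjacency_def recolour_eq[OF assms])
qed (simp add: adjacency_def)

lemma forces_foldl:
  "set ys \<subseteq> B \<Longrightarrow> (force R V)\<^sup>*\<^sup>* B (foldl (forced R V) B ys)"
proof (induction ys arbitrary: B)
  case (Cons y ys)
  have "(force R V)\<^sup>*\<^sup>* B (forced R V B y)"
    using Cons.prems by (intro force_forced) auto
  moreover have "(force R V)\<^sup>*\<^sup>* (forced R V B y) (foldl (forced R V) (forced R V B y) ys)"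
    using Cons.prems forced_superset[of B R V y] by (intro Cons.IH) auto
  ultimately show ?case by simp
qed simp

lemma foldl_forced_subset: "B \<subseteq> V \<Longrightarrow> foldl (forced R V) B ys \<subseteq> V"
  by (induction ys arbitrary: B) (auto simp: forced_subset)

lemma all_true_iff [simp]: "all_true b \<longleftrightarrow> (\<forall>x\<in>set b. x)"
  by (induction b rule: all_true.induct) auto

text \<open>The flag \<open>a\<close> hands over the outcome of \<open>all_true\<close> from the
  previous call. The first part therefore assumes that a true flag is correct, and the second part
  discharges this.\<close>

lemma saturates_sound:
  assumes "distinct xs"
  shows "saturates a fuel (adjacency R xs xs) bl \<Longrightarrow> bl = map (\<lambda>x. x \<in> B) xs \<Longrightarrow>
      B \<subseteq> set xs \<Longrightarrow> a \<longrightarrow> B = set xs \<Longrightarrow> (force R (set xs))\<^sup>*\<^sup>* B (set xs)"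
    and "saturates' bl fuel (adjacency R xs xs) \<Longrightarrow> bl = map (\<lambda>x. x \<in> B) xs \<Longrightarrow>
      B \<subseteq> set xs \<Longrightarrow> (force R (set xs))\<^sup>*\<^sup>* B (set xs)"
proof (induction a fuel "adjacency R xs xs" bl and bl fuel "adjacency R xs xs"
    arbitrary: B and B rule: saturates_saturates'.induct)
  case (3 x fuel bl)
  let ?B = "foldl (forced R (set xs)) B (filter (\<lambda>x. x \<in> B) xs)"
  have "(force R (set xs))\<^sup>*\<^sup>* ?B (set xs)"
  proof (rule 3(1))
    show "saturates' (sweep (adjacency R xs xs) bl bl) fuel (adjacency R xs xs)"
      using 3(2) by simp
    show "sweep (adjacency R xs xs) bl bl = map (\<lambda>x. x \<in> ?B) xs"
      unfolding 3(3) by (rule sweep_eq[OF assms])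
    show "?B \<subseteq> set xs" using 3(4) by (rule foldl_forced_subset)
  qed
  moreover have "(force R (set xs))\<^sup>*\<^sup>* B ?B"
    by (rule forces_foldl) auto
  ultimately show ?case by (rule rtranclp_trans[rotated])
next
  case (4 bl fuel)
  show ?case
  proof (rule 4(1))
    show "all_true bl \<longrightarrow> B = set xs"
      using 4(3,4) by auto
    show "saturates (all_true bl) fuel (adjacency R xs xs) bl"
      using 4(2) by simp
  qed (fact 4)+
next
  case (1 fuel bl)
  then have "B = set xs" by blast
  then show ?case by (simp only: rtranclp.rtrancl_refl)
next
  case (2 bl)
  then show ?case by (simp only: saturates.simps)
qed

fun still :: "bool list list \<Rightarrow> bool list \<Rightarrow> bool list \<Rightarrow> bool" where
  "still [] c bl = True"
| "still (r # F) [] bl = True"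
| "still (r # F) (True # c) bl = (bits_equal (recolour r bl) bl \<and> still F c bl)"
| "still (r # F) (False # c) bl = still F c bl"

text \<open>The final test itself certifies a proper superset in which nothing can be forced, so the
  number of sweeps before it affects success but not soundness.\<close>

fun stalls :: "'a list \<Rightarrow> bool list list \<Rightarrow> bool list \<Rightarrow> bool" where
  "stalls [] F bl = (\<not> all_true bl \<and> still F bl bl)"
| "stalls (x # fuel) F bl = stalls fuel F (sweep F bl bl)"

lemma still_sound:
  assumes "distinct xs" "still (adjacency R ys xs) (map P ys) (map (\<lambda>x. x \<in> B) xs)"
    and "y \<in> set ys" "P y" "B \<subseteq> set xs"
  shows "forced R (set xs) B y = B"
  using assms(2,3)
proof (induction ys)
  case (Cons z ys)
  show ?case
  proof (cases "y = z")
    case True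
    then have "map (\<lambda>x. x \<in> forced R (set xs) B y) xs = map (\<lambda>x. x \<in> B) xs"
      using Cons.prems(1) assms(4) by (simp add: adjacency_def recolour_eq[OF assms(1)])
    then show ?thesis using forced_subset[OF assms(5), of R y] assms(5) by auto
  next
    case False
    then show ?thesis using Cons by (cases "P z") (auto simp: adjacency_def)
  qed
qed simp

lemma foldl_forced_superset: "B \<subseteq> foldl (forced R V) B ys"
proof (induction ys arbitrary: B)
  case (Cons y ys)
  show ?case using order_trans[OF forced_superset Cons.IH] by simp
qed simp

text \<open>The initial set \<open>Z\<close> stays fixed while \<open>B\<close> grows with each
  sweep; this is why the induction needs \<open>Z \<subseteq> B\<close> instead of equality.\<close>

lemma stalls_sound:
  assumes "distinct xs"
  shows "stalls fuel (adjacency R xs xs) (map (\<lambda>x. x \<in> B) xs) \<Longrightarrow> B \<subseteq> set xs \<Longrightarrow> Z \<subseteq> B \<Longrightarrow>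
    \<not> (force R (set xs))\<^sup>*\<^sup>* Z (set xs)"
proof (induction fuel arbitrary: B)
  case Nil
  then have "\<forall>b\<in>B. forced R (set xs) B b = B"
    using still_sound[OF assms, of R xs "\<lambda>x. x \<in> B" B] by auto
  moreover have "\<not> set xs \<subseteq> B" using Nil.prems(1) by auto
  ultimately show ?case using stuck_superset[of R "set xs" Z "set xs" B] Nil.prems(3) by blast
next
  case (Cons x fuel)
  let ?B = "foldl (forced R (set xs)) B (filter (\<lambda>x. x \<in> B) xs)"
  show ?case
  proof (rule Cons.IH)
    show "stalls fuel (adjacency R xs xs) (map (\<lambda>x. x \<in> ?B) xs)"
      using Cons.prems(1) by (simp add: sweep_eq[OF assms])
    show "?B \<subseteq> set xs" using Cons.prems(2) by (rule foldl_forced_subset)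
    show "Z \<subseteq> ?B" using Cons.prems(3) foldl_forced_superset[of B] by (rule order_trans)
  qed
qed

fun fills :: "'a list \<Rightarrow> bool list \<Rightarrow> bool list list \<Rightarrow> bool list \<Rightarrow> bool" where
  "fills [] c F bl = all_true bl"
| "fills (x # fuel) c F bl = fills fuel c F (sweep F c bl)"

lemma vanishes_foldl:
  "A *v x = 0 \<Longrightarrow> \<forall>i\<in>B. x $ i = 0 \<Longrightarrow>
    \<forall>i\<in>foldl (forced (\<lambda>u v. A $ u $ v \<noteq> 0) UNIV) B ys. (x :: real^'v) $ i = 0"
proof (induction ys arbitrary: B)
  case (Cons y ys)
  show ?case
    unfolding foldl_Cons by (rule Cons.IH[OF Cons.prems(1) vanishes_forced[OF Cons.prems]])
qed (simp only: foldl_Nil)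

lemma fills_sound:
  fixes A :: "real^'v^'v"
  assumes "distinct xs" "set xs = UNIV" "A *v x = 0"
  shows "fills fuel (map (\<lambda>_. True) xs) (adjacency (\<lambda>u v. A $ u $ v \<noteq> 0) xs xs) (map (\<lambda>x. x \<in> B) xs) \<Longrightarrow>
    \<forall>i\<in>B. x $ i = 0 \<Longrightarrow> x = 0"
proof (induction fuel arbitrary: B)
  case Nil
  then have "i \<in> B" for i using assms(2) by auto
  then show ?case using Nil.prems(2) by (simp add: vec_eq_iff)
next
  case (Cons y fuel)
  show ?case
    by (rule Cons.IH[OF _ vanishes_foldl[OF assms(3) Cons.prems(2), of "filter (\<lambda>_. True) xs"]])
      (use Cons.prems(1) sweep_eq[OF assms(1), of "\<lambda>u v. A $ u $ v \<noteq> 0" xs "\<lambda>_. True" B] assms(2) in simp)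
qed

subsection \<open>Sets of bit lists\<close>

datatype trie = Void | End | Split trie trie

fun trie_insert :: "bool list \<Rightarrow> trie \<Rightarrow> trie" where
  "trie_insert [] t = End"
| "trie_insert (True # s) (Split a b) = Split a (trie_insert s b)"
| "trie_insert (False # s) (Split a b) = Split (trie_insert s a) b"
| "trie_insert (True # s) Void = Split Void (trie_insert s Void)"
| "trie_insert (False # s) Void = Split (trie_insert s Void) Void"
| "trie_insert (b # s) End = End"

fun trie_member :: "bool list \<Rightarrow> trie \<Rightarrow> bool" where
  "trie_member [] End = True"
| "trie_member (True # s) (Split a b) = trie_member s b"
| "trie_member (False # s) (Split a b) = trie_member s a"
| "trie_member _ _ = False"

fun trie_of :: "bool list list \<Rightarrow> trie \<Rightarrow> trie" where
  "trie_of [] t = t"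
| "trie_of (s # ss) t = trie_of ss (trie_insert s t)"

lemma bits_cases:
  obtains "s = []" | s' where "s = True # s'" | s' where "s = False # s'"
proof (cases s)
  case (Cons b s')
  then show ?thesis using that by (cases b) auto
qed (use that in simp)

lemma trie_member_Void [simp]: "\<not> trie_member s Void"
  by (cases s rule: bits_cases) auto

text \<open>Insertion may drop a word when lengths clash, but it never invents one. A dropped word
  can only make a later membership test fail.\<close>

lemma trie_member_insert: "trie_member s (trie_insert s' t) \<Longrightarrow> s = s' \<or> trie_member s t"
proof (induction s' t arbitrary: s rule: trie_insert.induct)
  case (1 t)
  then show ?case by (cases s rule: bits_cases) simp_all
next
  case (2 s' a b)
  then show ?case by (cases s rule: bits_cases) simp_all
next
  case (3 s' a b)
  then show ?case by (cases s rule: bits_cases) simp_all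
next
  case (4 s')
  then show ?case by (cases s rule: bits_cases) fastforce+
next
  case (5 s')
  then show ?case by (cases s rule: bits_cases) fastforce+
qed simp_all

lemma trie_member_trie_of: "trie_member s (trie_of ss t) \<Longrightarrow> s \<in> set ss \<or> trie_member s t"
  by (induction ss arbitrary: t) (auto dest: trie_member_insert)

definition trie_all :: "(bool list \<Rightarrow> bool) \<Rightarrow> trie \<Rightarrow> bool" where
  "trie_all P t \<longleftrightarrow> (\<forall>s. trie_member s t \<longrightarrow> P s)"

lemma trie_all_Void: "trie_all P Void"
  by (simp add: trie_all_def)

lemma trie_all_insert: "P s \<Longrightarrow> trie_all P t \<Longrightarrow> trie_all P (trie_insert s t)"
  unfolding trie_all_def by (metis trie_member_insert)

subsection \<open>Neighbourhoods of a heaviest vertex\<close>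

definition degree :: "('a \<Rightarrow> 'a \<Rightarrow> bool) \<Rightarrow> 'a set \<Rightarrow> 'a \<Rightarrow> nat" where
  "degree R V x = card {u \<in> V. R x u}"

definition weight :: "('a \<Rightarrow> 'a \<Rightarrow> bool) \<Rightarrow> 'a set \<Rightarrow> 'a \<Rightarrow> nat" where
  "weight R V x = (\<Sum>u | u \<in> V \<and> R x u. degree R V u)"

text \<open>Maximality in the lexicographic order of degree and weight. The more a maximal vertex is
  constrained, the fewer neighbourhoods have to be certified for each smaller graph.\<close>

definition heaviest :: "('a \<Rightarrow> 'a \<Rightarrow> bool) \<Rightarrow> 'a set \<Rightarrow> 'a \<Rightarrow> bool" where
  "heaviest R V v \<longleftrightarrow> (\<forall>x\<in>V. degree R V x < degree R V v \<or>
     degree R V x = degree R V v \<and> weight R V x \<le> weight R V v)"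

lemma ex_heaviest:
  assumes "finite V" "V \<noteq> {}"
  obtains v where "v \<in> V" "heaviest R V v"
proof -
  have ex_max: "\<exists>v\<in>A. \<forall>x\<in>A. f x \<le> f v" if "finite A" "A \<noteq> {}" for A and f :: "'a \<Rightarrow> nat"
    using Max_in[of "f ` A"] Max_ge[of "f ` A"] that by fastforce
  obtain v where v: "v \<in> V" "\<forall>x\<in>V. degree R V x \<le> degree R V v"
    using ex_max[OF assms] by blast
  let ?A = "{x \<in> V. degree R V x = degree R V v}"
  have "finite ?A" "?A \<noteq> {}" using assms(1) v(1) by auto
  from ex_max[OF this] obtain w
    where w: "w \<in> ?A" "\<forall>x\<in>?A. weight R V x \<le> weight R V w" by blast
  then have "heaviest R V w"
    unfolding heaviest_def using v(2) by (metis (mono_tags, lifting) le_neq_implies_less mem_Collect_eq)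
  with w(1) show ?thesis by (intro that) auto
qed

fun degrees :: "bool list list \<Rightarrow> nat list" where
  "degrees [] = []"
| "degrees (r # F) = popcount r # degrees F"

fun weigh :: "bool list \<Rightarrow> nat list \<Rightarrow> nat" where
  "weigh [] ds = 0"
| "weigh (b # r) [] = 0"
| "weigh (False # r) (d # ds) = weigh r ds"
| "weigh (True # r) (d # ds) = d + weigh r ds"

fun weights :: "bool list list \<Rightarrow> nat list \<Rightarrow> nat list" where
  "weights [] ds = []"
| "weights (r # F) ds = weigh r ds # weights F ds"

text \<open>A sufficient criterion for the new vertex to be beaten. An old vertex of larger degree
  but no larger weight escapes it; such vertices are excluded beforehand by the degree conditions in
  \<open>covers_if\<close>.\<close>

fun exceeded :: "nat \<Rightarrow> nat \<Rightarrow> nat list \<Rightarrow> nat list \<Rightarrow> bool" where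
  "exceeded d w (d' # ds) (w' # ws) = ((leq d d' \<and> leq (Suc w) w') \<or> exceeded d w ds ws)"
| "exceeded d w _ _ = False"

fun head_exceeded :: "nat list \<Rightarrow> nat list \<Rightarrow> bool" where
  "head_exceeded (d # ds) (w # ws) = exceeded d w ds ws"
| "head_exceeded _ _ = False"

definition not_heaviest' :: "bool list list \<Rightarrow> nat list \<Rightarrow> bool" where
  "not_heaviest' F ds = head_exceeded ds (weights F ds)"

definition not_heaviest :: "bool list list \<Rightarrow> bool" where
  "not_heaviest F = not_heaviest' F (degrees F)"

fun left :: "trie \<Rightarrow> trie" where
  "left (Split a b) = a"
| "left _ = Void"

fun right :: "trie \<Rightarrow> trie" where
  "right (Split a b) = b"
| "right _ = Void"

fun justified :: "bool \<Rightarrow> bool list \<Rightarrow> bool list list \<Rightarrow> bool" where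
  "justified True acc F = True"
| "justified False acc F = not_heaviest (extend (rev acc) F)"

text \<open>Every \<open>n\<close>-element subset of \<open>allowed\<close> belongs to the trie, unless a new vertex with this
  neighbourhood would not be a heaviest vertex.\<close>

fun covers :: "bool list \<Rightarrow> nat \<Rightarrow> trie \<Rightarrow> bool list \<Rightarrow> bool list list \<Rightarrow> bool" where
  "covers [] 0 t acc F = justified (trie_member [] t) acc F"
| "covers [] (Suc n) t acc F = True"
| "covers (False # allowed) n t acc F = covers allowed n (left t) (False # acc) F"
| "covers (True # allowed) 0 t acc F = covers allowed 0 (left t) (False # acc) F"
| "covers (True # allowed) (Suc n) t acc F =
     (covers allowed (Suc n) (left t) (False # acc) F \<and> covers allowed n (right t) (True # acc) F)"

fun all_leq :: "nat list \<Rightarrow> nat \<Rightarrow> bool" where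
  "all_leq [] n = True"
| "all_leq (d # ds) n = (leq d n \<and> all_leq ds n)"

fun below :: "nat list \<Rightarrow> nat \<Rightarrow> bool list" where
  "below [] n = []"
| "below (d # ds) n = leq (Suc d) n # below ds n"

text \<open>Here \<open>n\<close> is the degree of the new vertex and \<open>ds\<close> are the
  degrees before the extension. If the new vertex is heaviest, no old degree exceeds
  \<open>n\<close>; and a neighbour gains one, so its old degree must be less than \<open>n\<close>.
  These are the conditions \<open>all_leq\<close> and \<open>below\<close>.\<close>

fun covers_if :: "bool \<Rightarrow> nat list \<Rightarrow> nat \<Rightarrow> trie \<Rightarrow> bool list list \<Rightarrow> bool" where
  "covers_if False ds n t F = True"
| "covers_if True ds n t F = covers (below ds n) n t [] F"

fun covers_upto :: "nat \<Rightarrow> nat list \<Rightarrow> trie \<Rightarrow> bool list list \<Rightarrow> bool" where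
  "covers_upto 0 ds t F = covers_if (all_leq ds 0) ds 0 t F"
| "covers_upto (Suc n) ds t F =
     (covers_if (all_leq ds (Suc n)) ds (Suc n) t F \<and> covers_upto n ds t F)"

fun len :: "'a list \<Rightarrow> nat" where
  "len [] = 0"
| "len (x # xs) = Suc (len xs)"

definition covers_all :: "bool list list \<Rightarrow> trie \<Rightarrow> bool" where
  "covers_all F t = covers_upto (len F) (degrees F) t F"

lemma degrees_adjacency: "distinct ys \<Longrightarrow> degrees (adjacency R xs ys) = map (degree R (set ys)) xs"
  by (induction xs) (auto simp: adjacency_def degree_def popcount_map)

lemma weigh_map: "distinct ys \<Longrightarrow> weigh (map P ys) (map f ys) = (\<Sum>u | u \<in> set ys \<and> P u. f u)"
proof (induction ys)
  case (Cons y ys)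
  show ?case
  proof (cases "P y")
    case True
    then have "{u. u \<in> set (y # ys) \<and> P u} = insert y {u. u \<in> set ys \<and> P u}" by auto
    with Cons True show ?thesis by simp
  next
    case False
    then have "{u. u \<in> set (y # ys) \<and> P u} = {u. u \<in> set ys \<and> P u}" by auto
    with Cons False show ?thesis by simp
  qed
qed simp

lemma weights_adjacency:
  "distinct ys \<Longrightarrow>
     weights (adjacency R xs ys) (map (degree R (set ys)) ys) = map (weight R (set ys)) xs"
  by (induction xs) (auto simp: adjacency_def weight_def weigh_map)

lemma exceeded_map:
  "exceeded d w (map f xs) (map g xs) \<longleftrightarrow> (\<exists>x\<in>set xs. d \<le> f x \<and> w < g x)"
  by (induction xs) (auto simp: Suc_le_eq)

lemma not_heaviest_sound:
  assumes "not_heaviest (adjacency R (v # xs) (v # xs))" "distinct (v # xs)"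
  shows "\<not> heaviest R (insert v (set xs)) v"
proof -
  have "head_exceeded (map (degree R (set (v # xs))) (v # xs))
      (map (weight R (set (v # xs))) (v # xs))"
    using assms(1)
    by (simp only: not_heaviest_def not_heaviest'_def degrees_adjacency[OF assms(2)]
        weights_adjacency[OF assms(2)])
  then obtain x where "x \<in> set xs" "degree R (set (v # xs)) v \<le> degree R (set (v # xs)) x"
    "weight R (set (v # xs)) v < weight R (set (v # xs)) x"
    unfolding list.map(2) head_exceeded.simps exceeded_map by blast
  then show ?thesis by (force simp: heaviest_def)
qed

lemma trie_member_left: "trie_member s (left t) \<Longrightarrow> trie_member (False # s) t"
  and trie_member_right: "trie_member s (right t) \<Longrightarrow> trie_member (True # s) t"
  by (cases t; simp)+

text \<open>Invariant: \<open>acc\<close> holds, in reverse, the bits that have been decided,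
  \<open>t\<close> is the subtrie reached along them, and \<open>s\<close> consists of the bits
  still to come.\<close>

lemma covers_sound:
  "covers allowed n t acc F \<Longrightarrow> list_all2 (\<longrightarrow>) s allowed \<Longrightarrow> popcount s = n \<Longrightarrow>
     trie_member s t \<or> not_heaviest (extend (rev acc @ s) F)"
proof (induction allowed n t acc F arbitrary: s rule: covers.induct)
  case (1 t acc F)
  then show ?case by (cases "trie_member [] t") auto
next
  case (3 allowed n t acc F)
  then obtain s' where "s = False # s'" "list_all2 (\<longrightarrow>) s' allowed"
    by (auto simp: list_all2_Cons2)
  with 3 show ?case using trie_member_left by fastforce
next
  case (4 allowed t acc F)
  then obtain c s' where s: "s = c # s'" "list_all2 (\<longrightarrow>) s' allowed"
    by (auto simp: list_all2_Cons2)
  with 4(4) have "\<not> c" by (cases c) auto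
  with 4 s show ?case using trie_member_left by fastforce
next
  case (5 allowed n t acc F)
  then obtain c s' where s: "s = c # s'" "list_all2 (\<longrightarrow>) s' allowed"
    by (auto simp: list_all2_Cons2)
  then show ?case
    using 5 trie_member_left[of s' t] trie_member_right[of s' t] by (cases c) fastforce+
qed simp_all

lemma covers_upto: "covers_upto m ds t F \<Longrightarrow> n \<le> m \<Longrightarrow> covers_if (all_leq ds n) ds n t F"
  by (induction m) (auto simp: le_Suc_eq)

lemma all_leq_iff [simp]: "all_leq ds n \<longleftrightarrow> (\<forall>d\<in>set ds. d \<le> n)"
  by (induction ds) auto

lemma below_eq_map: "below ds n = map (\<lambda>d. d < n) ds"
  by (induction ds) auto

lemma len_eq_length [simp]: "len xs = length xs"
  by (induction xs) auto

lemma length_adjacency [simp]: "length (adjacency R xs ys) = length xs"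
  by (simp add: adjacency_def)

lemma covers_all_sound:
  fixes R :: "'a \<Rightarrow> 'a \<Rightarrow> bool"
  assumes "covers_all (adjacency R xs xs) t"
    and "distinct xs" "v \<notin> set xs" "\<And>u w. R u w \<longleftrightarrow> R w u" "\<not> R v v"
    and max: "heaviest R (insert v (set xs)) v"
    and ext: "extend (map (R v) xs) (adjacency R xs xs) = adjacency R (v # xs) (v # xs)"
  shows "trie_member (map (R v) xs) t"
proof -
  let ?n = "popcount (map (R v) xs)" and ?d = "degree R (set xs)"
  have ds: "degrees (adjacency R xs xs) = map ?d xs"
    by (rule degrees_adjacency[OF assms(2)])
  have n: "?n = degree R (insert v (set xs)) v"
    unfolding degree_def using assms(2,5)
    by (subst popcount_map) (auto intro: arg_cong[where f = card])
  have dv: "?d x + (if R v x then 1 else 0) \<le> ?n" if "x \<in> set xs" for x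
  proof -
    have "{u \<in> insert v (set xs). R x u} =
      (if R v x then insert v {u \<in> set xs. R x u} else {u \<in> set xs. R x u})"
      using assms(4) by auto
    then have "degree R (insert v (set xs)) x = ?d x + (if R v x then 1 else 0)"
      using assms(3) by (simp add: degree_def)
    moreover have "degree R (insert v (set xs)) x \<le> ?n"
      using max that unfolding heaviest_def n by (metis insertCI le_eq_less_or_eq)
    ultimately show ?thesis by simp
  qed
  \<comment> \<open>\<open>covers_upto\<close> starts from the number of old vertices, which bounds
    the degree of the new one.\<close>
  have "?n \<le> length xs"
    using assms(2) by (subst popcount_map) (auto simp: card_length intro: order_trans[OF card_mono])
  then have "covers_if (all_leq (map ?d xs) ?n) (map ?d xs) ?n t (adjacency R xs xs)"
    using covers_upto assms(1) unfolding covers_all_def ds by fastforce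
  moreover have "all_leq (map ?d xs) ?n"
    unfolding all_leq_iff
  proof safe
    fix d assume "d \<in> set (map ?d xs)"
    then obtain x where "x \<in> set xs" "d = ?d x" by auto
    then show "d \<le> ?n" using dv[of x] by linarith
  qed
  ultimately have "covers (below (map ?d xs) ?n) ?n t [] (adjacency R xs xs)"
    by (simp del: all_leq_iff)
  moreover have "list_all2 (\<longrightarrow>) (map (R v) xs) (below (map ?d xs) ?n)"
  proof -
    have "R v x \<longrightarrow> ?d x < ?n" if "x \<in> set xs" for x
      using dv[OF that] by (cases "R v x") auto
    then show ?thesis
      unfolding below_eq_map map_map list_all2_map1 list_all2_map2
      by (simp add: list_all2_same)
  qed
  ultimately have "trie_member (map (R v) xs) t \<or>
      not_heaviest (extend (rev [] @ map (R v) xs) (adjacency R xs xs))"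
    by (rule covers_sound) (rule refl)
  moreover have "\<not> not_heaviest (adjacency R (v # xs) (v # xs))"
    using not_heaviest_sound[of R v xs] max assms(2,3) by auto
  ultimately show ?thesis by (simp only: rev.simps append_Nil ext simp_thms)
qed

subsection \<open>Permutations\<close>

fun insert_at :: "nat \<Rightarrow> 'a \<Rightarrow> 'a list \<Rightarrow> 'a list" where
  "insert_at 0 x ys = x # ys"
| "insert_at (Suc n) x [] = [x]"
| "insert_at (Suc n) x (y # ys) = y # insert_at n x ys"

fun octal :: "bool \<Rightarrow> bool \<Rightarrow> bool \<Rightarrow> nat" where
  "octal False False False = 0"
| "octal True False False = Suc 0"
| "octal False True False = Suc (Suc 0)"
| "octal True True False = Suc (Suc (Suc 0))"
| "octal False False True = Suc (Suc (Suc (Suc 0)))"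
| "octal True False True = Suc (Suc (Suc (Suc (Suc 0))))"
| "octal False True True = Suc (Suc (Suc (Suc (Suc (Suc 0)))))"
| "octal True True True = Suc (Suc (Suc (Suc (Suc (Suc (Suc 0))))))"

text \<open>Only the three low bits count, so the characters \<open>0\<close> to \<open>7\<close>
  and \<open>H\<close> to \<open>O\<close> both stand for the positions 0 to 7. The fourth bit,
  which tells the two ranges apart, is free to record adjacency to the new vertex: one string
  encodes both a neighbourhood and a permutation.\<close>

fun index :: "char \<Rightarrow> nat" where
  "index (Char b0 b1 b2 b3 b4 b5 b6 b7) = octal b0 b1 b2"

fun fourth_bit :: "char \<Rightarrow> bool" where
  "fourth_bit (Char b0 b1 b2 b3 b4 b5 b6 b7) = b3"

fun sixth_bit :: "char \<Rightarrow> bool" where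
  "sixth_bit (Char b0 b1 b2 b3 b4 b5 b6 b7) = b5"

fun seven_bits :: "char \<Rightarrow> bool list" where
  "seven_bits (Char b0 b1 b2 b3 b4 b5 b6 b7) = [b0, b1, b2, b3, b4, b5, b6]"

fun permute :: "string \<Rightarrow> 'a list \<Rightarrow> 'a list" where
  "permute [] xs = xs"
| "permute (c # cs) [] = []"
| "permute (c # cs) (x # xs) = insert_at (index c) x (permute cs xs)"

fun upper :: "bool list list \<Rightarrow> bool list list" where
  "upper [] = []"
| "upper (r # F) = tl r # upper (map tl F)"

definition permuted_code :: "string \<Rightarrow> bool list list \<Rightarrow> bool list" where
  "permuted_code p F = concat (upper (map (permute p) (permute p F)))"

lemma map_insert_at: "map f (insert_at n x ys) = insert_at n (f x) (map f ys)"
  by (induction n x ys rule: insert_at.induct) auto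

lemma map_permute: "map f (permute p xs) = permute p (map f xs)"
  by (induction p xs rule: permute.induct) (auto simp: map_insert_at)

lemma mset_insert_at: "mset (insert_at n x ys) = add_mset x (mset ys)"
  by (induction n x ys rule: insert_at.induct) auto

lemma mset_permute: "mset (permute p xs) = mset xs"
  by (induction p xs rule: permute.induct) (auto simp: mset_insert_at)

lemma distinct_permute: "distinct (permute p xs) \<longleftrightarrow> distinct xs"
  and set_permute: "set (permute p xs) = set xs"
  using mset_permute[of p xs] by (metis mset_eq_imp_distinct_iff, metis mset_eq_setD)

lemma upper_adjacency: "upper (adjacency R xs xs) = rows R xs"
proof (induction xs)
  case (Cons x xs)
  then show ?case by (simp add: adjacency_def comp_def)
qed (simp add: adjacency_def)

lemma permuted_code: "permuted_code p (adjacency R xs xs) = concat (rows R (permute p xs))"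
proof -
  have "map (permute p) (permute p (adjacency R xs xs)) = adjacency R (permute p xs) (permute p xs)"
    by (simp add: adjacency_def map_permute[symmetric] comp_def)
  then show ?thesis by (simp add: permuted_code_def upper_adjacency)
qed

subsection \<open>Tables\<close>

datatype 'a lookup_tree = Tip 'a | Fork "'a lookup_tree" "'a lookup_tree"

fun branch :: "'a lookup_tree \<Rightarrow> bool \<Rightarrow> 'a lookup_tree" where
  "branch (Tip a) b = Tip a"
| "branch (Fork l r) False = l"
| "branch (Fork l r) True = r"

fun tip :: "'a list lookup_tree \<Rightarrow> 'a list" where
  "tip (Tip a) = a"
| "tip (Fork l r) = []"

text \<open>Seven branchings suffice for ASCII characters. In a tree grown from
  \<open>Tip []\<close> an absent name yields \<open>[]\<close>, the zero vector.\<close>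

fun lookup :: "'a list lookup_tree \<Rightarrow> char \<Rightarrow> 'a list" where
  "lookup t (Char a b c d e f g h) =
     tip (branch (branch (branch (branch (branch (branch (branch t a) b) c) d) e) f) g)"

fun lookups :: "'a list lookup_tree \<Rightarrow> string \<Rightarrow> 'a list list" where
  "lookups t [] = []"
| "lookups t (c # cs) = lookup t c # lookups t cs"

fun tree_insert :: "bool list \<Rightarrow> 'a list \<Rightarrow> 'a list lookup_tree \<Rightarrow> 'a list lookup_tree" where
  "tree_insert [] v t = Tip v"
| "tree_insert (False # bs) v (Fork l r) = Fork (tree_insert bs v l) r"
| "tree_insert (True # bs) v (Fork l r) = Fork l (tree_insert bs v r)"
| "tree_insert (False # bs) v (Tip a) = Fork (tree_insert bs v (Tip a)) (Tip a)"
| "tree_insert (True # bs) v (Tip a) = Fork (Tip a) (tree_insert bs v (Tip a))"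

fun digit :: "bool \<Rightarrow> bool \<Rightarrow> bool \<Rightarrow> bool list" where
  "digit False False False = [False, False, False]"
| "digit True False False = [False, False]"
| "digit False True False = [False]"
| "digit True True False = []"
| "digit False False True = [True]"
| "digit True False True = [True, True]"
| "digit False True True = [True, True, True]"
| "digit True True True = []"

text \<open>The characters \<open>0, \<dots>, 6\<close> stand for \<open>-3, \<dots>, 3\<close>.\<close>

fun digits :: "string \<Rightarrow> bool list list" where
  "digits [] = []"
| "digits (Char b0 b1 b2 b3 b4 b5 b6 b7 # cs) = digit b0 b1 b2 # digits cs"

fun binary :: "string \<Rightarrow> bool list" where
  "binary [] = []"
| "binary (Char b0 b1 b2 b3 b4 b5 b6 b7 # cs) = b0 # binary cs"

fun tree_of :: "(string \<Rightarrow> 'a list) \<Rightarrow> string list \<Rightarrow> 'a list lookup_tree \<Rightarrow> 'a list lookup_tree" where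
  "tree_of f [] t = t"
| "tree_of f ([] # vs) t = tree_of f vs t"
| "tree_of f ((c # v) # vs) t = tree_of f vs (tree_insert (seven_bits c) (f v) t)"

text \<open>The diagonal form, the vectors, and the names of the vectors.\<close>

datatype vector_table = Vector_Table "bool list list" "bool list list lookup_tree" string

fun eight_if :: "bool \<Rightarrow> nat" where
  "eight_if False = 0"
| "eight_if True = Suc (octal True True True)"

text \<open>The low four bits of the first character of a word give the position of the table:
  \<open>@\<close> and \<open>P\<close> name the first table, \<open>A\<close> the second, and so
  on. The sixth bit is clear in these characters but set in the exclamation mark, and so
  distinguishes words that refer to exceptional graphs.\<close>

definition select :: "char \<Rightarrow> 'a list \<Rightarrow> 'a list" where
  "select c ts = suffix (index c) (suffix (eight_if (fourth_bit c)) ts)"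

subsection \<open>Certificates\<close>

text \<open>One character per nonempty row above the diagonal; a row followed by k characters has k
  + 1 entries. Rows have at most six entries for the graphs on at most 7 vertices, which leaves high
  bits free to keep the characters printable.\<close>

fun unpack :: "string \<Rightarrow> bool list" where
  "unpack [] = []"
| "unpack (c # cs) = prefix (Suc (len cs)) (seven_bits c) @ unpack cs"

text \<open>Padding and truncation give a bit list the right length by construction, as
  \<open>ex_subset_of_bits\<close> demands.\<close>

fun fit :: "'a list \<Rightarrow> bool list \<Rightarrow> bool list" where
  "fit [] bs = []"
| "fit (x # xs) [] = False # fit xs []"
| "fit (x # xs) (b # bs) = b # fit xs bs"

fun insert_if :: "bool \<Rightarrow> bool list \<Rightarrow> trie \<Rightarrow> trie" where
  "insert_if True s T = trie_insert s T"
| "insert_if False s T = T"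

fun scales :: "bool list list \<Rightarrow> bool list list list \<Rightarrow> bool list list list" where
  "scales D [] = []"
| "scales D (v # vs) = scale D v # scales D vs"

fun monus :: "nat \<Rightarrow> nat \<Rightarrow> nat" where
  "monus m 0 = m"
| "monus 0 (Suc n) = 0"
| "monus (Suc m) (Suc n) = monus m n"

fun forcing_if :: "bool \<Rightarrow> bool list list \<Rightarrow> bool list \<Rightarrow> bool" where
  "forcing_if False F z = False"
| "forcing_if True F z = saturates False F F (False # z)"

fun any_forcing :: "bool \<Rightarrow> bool list list \<Rightarrow> nat \<Rightarrow> bool list list \<Rightarrow> bool" where
  "any_forcing True zs m F = True"
| "any_forcing False [] m F = False"
| "any_forcing False (z # zs) m F = any_forcing (forcing_if (leq (popcount z) m) F z) zs m F"

definition insert_forcing :: "bool list list \<Rightarrow> nat \<Rightarrow> bool list list \<Rightarrow> bool list \<Rightarrow> trie \<Rightarrow> trie" where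
  "insert_forcing F m zs s T = insert_if (any_forcing False zs m (extend s F)) s T"

text \<open>If \<open>b\<close> is true, then the zero forcing set of the old graph together with the new vertex is
  small enough. Otherwise one of the sets \<open>zs\<close> has to be a zero forcing set of the new graph.\<close>

fun insert_word :: "bool \<Rightarrow> bool list list \<Rightarrow> nat \<Rightarrow> bool list list \<Rightarrow> bool list \<Rightarrow> trie \<Rightarrow> trie" where
  "insert_word True F m zs s T = trie_insert s T"
| "insert_word False F m zs s T = insert_forcing F m zs s T"

fun insert_words :: "bool \<Rightarrow> bool list list \<Rightarrow> nat \<Rightarrow> bool list list \<Rightarrow>
    bool list list lookup_tree \<Rightarrow> bool list list list \<Rightarrow> string \<Rightarrow> trie \<Rightarrow> trie" where
  "insert_words b F m zs t vs [] T = T"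
| "insert_words b F m zs t vs (c # cs) T =
     insert_words b F m zs t vs cs (insert_word b F m zs (incidences vs (lookup t c)) T)"

fun run_embedded :: "bool \<Rightarrow> bool list list \<Rightarrow> nat \<Rightarrow> bool list list \<Rightarrow> nat \<Rightarrow>
    bool list list lookup_tree \<Rightarrow> bool list list list \<Rightarrow> string \<Rightarrow> trie \<Rightarrow> trie" where
  "run_embedded False F k zs m t vs ws T = T"
| "run_embedded True F k zs m t vs ws T = insert_words (leq (Suc k) m) F m zs t vs ws T"

text \<open>The difference passed on is the order of the extended graph minus the dimension, a lower
  bound for its maximum nullity and hence the permitted size of a zero forcing set. The test on
  \<open>len D\<close> keeps the truncated subtraction from claiming a bound of 0 when the dimension
  is too large.\<close>

definition run_embedding :: "bool list list \<Rightarrow> bool list list \<Rightarrow> nat \<Rightarrow> bool list list \<Rightarrow>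
    bool list list \<Rightarrow> bool list list lookup_tree \<Rightarrow> bool list list list \<Rightarrow> string \<Rightarrow> trie \<Rightarrow> trie"
  where "run_embedding H F k zs D t vs ws T =
    run_embedded (embeds D H vs \<and> leq (len D) (Suc (len F))) F k zs
      (monus (Suc (len F)) (len D)) t (scales D vs) ws T"

fun words_or_all :: "string \<Rightarrow> string \<Rightarrow> string" where
  "words_or_all [] names = names"
| "words_or_all (c # cs) names = c # cs"

fun run_table :: "bool list list \<Rightarrow> bool list list \<Rightarrow> nat \<Rightarrow> bool list list \<Rightarrow> vector_table list \<Rightarrow>
    string \<Rightarrow> trie \<Rightarrow> trie" where
  "run_table H F k zs [] cs T = T"
| "run_table H F k zs (Vector_Table D t names # ts) cs T = run_embedding H F k zs D t
     (lookups t (prefix (len F) cs)) (words_or_all (suffix (len F) cs) names) T"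

definition insert_permuted :: "bool list list \<Rightarrow> trie \<Rightarrow> bool list \<Rightarrow> string \<Rightarrow> trie \<Rightarrow> trie" where
  "insert_permuted F ex s p T = insert_if (trie_member (permuted_code p (extend s F)) ex) s T"

fun run_group_if :: "bool \<Rightarrow> bool list list \<Rightarrow> bool list list \<Rightarrow> nat \<Rightarrow> bool list list \<Rightarrow> trie \<Rightarrow>
    vector_table list \<Rightarrow> string \<Rightarrow> trie \<Rightarrow> trie" where
  "run_group_if True H F k zs ex ts cs T = insert_permuted F ex (map fourth_bit cs) cs T"
| "run_group_if False H F k zs ex ts cs T = run_table H F k zs ts cs T"

fun run_groups :: "bool list list \<Rightarrow> bool list list \<Rightarrow> nat \<Rightarrow> bool list list \<Rightarrow> trie \<Rightarrow>
    vector_table list \<Rightarrow> string list \<Rightarrow> trie \<Rightarrow> trie" where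
  "run_groups H F k zs ex ts [] T = T"
| "run_groups H F k zs ex ts ([] # gs) T = run_groups H F k zs ex ts gs T"
| "run_groups H F k zs ex ts ((c # cs) # gs) T = run_groups H F k zs ex ts gs
     (run_group_if (sixth_bit c) H F k zs ex (select c ts) cs T)"

fun certified_sets :: "bool list list \<Rightarrow> bool list list \<Rightarrow> trie \<Rightarrow> vector_table list \<Rightarrow>
    bool list list \<Rightarrow> string list \<Rightarrow> bool" where
  "certified_sets H F ex ts [] gs = False"
| "certified_sets H F ex ts (z # zs) gs = (saturates False F F z \<and>
     covers_all F (run_groups H F (popcount z) (z # zs) ex ts gs Void))"

text \<open>The bits for 7 vertices are spread over two characters as 4 + 3, which leaves the high
  bits free for printable characters.\<close>

fun vertex_sets :: "bool list list \<Rightarrow> string \<Rightarrow> bool list list" where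
  "vertex_sets F (c # c' # cs) =
     fit F (prefix 4 (seven_bits c) @ prefix 3 (seven_bits c')) # vertex_sets F cs"
| "vertex_sets F _ = []"

fun certified_matrix :: "bool list list \<Rightarrow> bool list list \<Rightarrow> trie \<Rightarrow> vector_table list \<Rightarrow>
    string list \<Rightarrow> bool" where
  "certified_matrix H F ex ts [] = False"
| "certified_matrix H F ex ts (w # gs) = certified_sets H F ex ts (vertex_sets F w) gs"

definition certified_rows :: "bool list list \<Rightarrow> trie \<Rightarrow> vector_table list \<Rightarrow> string list \<Rightarrow> bool" where
  "certified_rows H ex ts ws = certified_matrix H (complete_matrix H) ex ts ws"

fun is_space :: "char \<Rightarrow> bool" where
  "is_space (Char b0 b1 b2 b3 b4 b5 b6 b7) =
     (\<not> (b0 \<or> b1 \<or> b2 \<or> b3 \<or> b4) \<and> b5 \<and> \<not> (b6 \<or> b7))"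

fun add_char :: "bool \<Rightarrow> char \<Rightarrow> string list \<Rightarrow> string list" where
  "add_char True c ws = [] # ws"
| "add_char False c [] = [[c]]"
| "add_char False c (w # ws) = (c # w) # ws"

fun split_words :: "string \<Rightarrow> string list" where
  "split_words [] = []"
| "split_words (c # cs) = add_char (is_space c) c (split_words cs)"

definition graph_code :: "nat \<Rightarrow> string \<Rightarrow> bool list" where
  "graph_code m d = unpack (prefix m d)"

definition certified :: "nat \<Rightarrow> trie \<Rightarrow> vector_table list \<Rightarrow> string \<Rightarrow> bool" where
  "certified m ex ts d =
     certified_rows (split_rows (Suc m) (graph_code m d)) ex ts (split_words (suffix m d))"

fun all_certified :: "nat \<Rightarrow> trie \<Rightarrow> vector_table list \<Rightarrow> string list \<Rightarrow> bool" where
  "all_certified m ex ts [] = True"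
| "all_certified m ex ts (d # ds) = (certified m ex ts d \<and> all_certified m ex ts ds)"

lemma scales_eq_map: "scales D vs = map (scale D) vs"
  by (induction vs) auto

lemma monus_eq [simp]: "monus m n = m - n"
  by (induction m n rule: monus.induct) auto

lemma length_fit [simp]: "length (fit xs bs) = length xs"
  by (induction xs bs rule: fit.induct) auto

lemma trie_all_insert_if:
  "(b \<Longrightarrow> P s) \<Longrightarrow> trie_all P T \<Longrightarrow> trie_all P (insert_if b s T)"
  by (cases b) (auto intro: trie_all_insert)

section \<open>Soundness of certificates for arbitrary symmetric irreflexive relations\<close>

definition settled :: "('a \<Rightarrow> 'a \<Rightarrow> bool) \<Rightarrow> trie \<Rightarrow> 'a set \<Rightarrow> bool" where
  "settled R ex V \<longleftrightarrow>
     (\<exists>D f B. represents D f R V \<and> B \<subseteq> V \<and> (force R V)\<^sup>*\<^sup>* B V \<and> card B + length D \<le> card V) \<or>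
     (\<exists>xs. distinct xs \<and> set xs = V \<and> trie_member (concat (rows R xs)) ex)"

text \<open>\<open>R\<close> is fixed while \<open>V\<close> runs over all vertex sets of the given
  size, so deleting a vertex leads to another instance for the same \<open>R\<close>. Choosing the
  enumeration \<open>xs\<close> takes the place of an isomorphism.\<close>

definition catalogued :: "('a \<Rightarrow> 'a \<Rightarrow> bool) \<Rightarrow> nat \<Rightarrow> bool list set \<Rightarrow> bool" where
  "catalogued R n C \<longleftrightarrow>
     (\<forall>V. finite V \<and> card V = n \<longrightarrow> (\<exists>xs. distinct xs \<and> set xs = V \<and> concat (rows R xs) \<in> C))"

locale simple_graph_relation =
  fixes R :: "'a \<Rightarrow> 'a \<Rightarrow> bool"
  assumes sym: "R u v \<longleftrightarrow> R v u" and irrefl: "\<not> R u u"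
begin

lemma extend_adjacency:
  "extend (map (R v) xs) (adjacency R xs xs) = adjacency R (v # xs) (v # xs)"
  unfolding extend_def using add_column_adjacency[of R v xs xs] sym
  by (simp add: adjacency_def irrefl)

lemma complete_matrix_rows: "complete_matrix (rows R xs) = adjacency R xs xs"
proof (induction xs)
  case (Cons x xs)
  then show ?case by (simp add: extend_adjacency)
qed (simp add: adjacency_def)

lemma embeds_represents:
  "distinct xs \<Longrightarrow> embeds D (rows R xs) vs \<Longrightarrow> \<exists>f. map f xs = vs \<and> represents D f R (set xs)"
proof (induction xs arbitrary: vs)
  case Nil
  then show ?case by (cases vs) (auto simp: represents_def)
next
  case (Cons x xs)
  then obtain v vs' where vs: "vs = v # vs'" by (cases vs) auto
  with Cons obtain f where f: "map f xs = vs'" "represents D f R (set xs)" by auto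
  have "R x y \<longleftrightarrow> form D v (f y) \<noteq> 0" if "y \<in> set xs" for y
    using Cons.prems(2) that
    by (auto simp: vs f(1)[symmetric] incidences_eq_map nonempty_dot_scale simp del: nonempty_iff)
  then have "represents D (f(x := v)) R (set (x # xs))"
    using f(2) Cons.prems(1) sym form_commute[of D v] unfolding represents_def by auto
  moreover have "map (f(x := v)) (x # xs) = vs"
    using Cons.prems(1) by (simp add: vs f(1) map_fun_upd)
  ultimately show ?case by blast
qed

lemma represents_insert:
  assumes "represents D f R (set xs)" "v \<notin> set xs"
    and "incidences (scales D (map f xs)) w = map (R v) xs"
  shows "represents D (f(v := w)) R (insert v (set xs))"
proof -
  have "R v y \<longleftrightarrow> form D w (f y) \<noteq> 0" if "y \<in> set xs" for y
    using assms(3) that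
    by (auto simp: scales_eq_map incidences_eq_map nonempty_dot_scale form_commute[of D w]
        simp del: nonempty_iff)
  then show ?thesis
    using assms(1,2) sym form_commute[of D w] unfolding represents_def by auto
qed

text \<open>A property of the neighbourhood \<open>s\<close> alone, for every vertex that might have
  it. The members of a trie can thus be certified before the new vertex is known.\<close>

definition settles :: "trie \<Rightarrow> 'a list \<Rightarrow> bool list \<Rightarrow> bool" where
  "settles ex xs s \<longleftrightarrow>
     (\<forall>v. v \<notin> set xs \<longrightarrow> s = map (R v) xs \<longrightarrow> settled R ex (insert v (set xs)))"

lemma settled_if_represented:
  assumes "represents D f R (set xs)" "v \<notin> set xs" "distinct xs"
    and "incidences (scales D (map f xs)) w = map (R v) xs"
    and "B \<subseteq> insert v (set xs)" "(force R (insert v (set xs)))\<^sup>*\<^sup>* B (insert v (set xs))"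
    and "card B + length D \<le> Suc (length xs)"
  shows "settled R ex (insert v (set xs))"
proof -
  have "card (insert v (set xs)) = Suc (length xs)"
    using assms(2,3) by (simp add: distinct_card)
  with assms(5-7) represents_insert[OF assms(1,2,4)] show ?thesis
    unfolding settled_def by (metis (no_types, lifting))
qed

text \<open>The flag reports the success of the candidate just removed from the list, so nothing is
  claimed when it is true at the outset. All candidates leave the new vertex white, which gives
  \<open>B \<subseteq> set xs\<close>.\<close>

lemma any_forcing_sound:
  assumes "any_forcing b zs m (adjacency R (v # xs) (v # xs))" "\<not> b"
    and "distinct xs" "v \<notin> set xs" "\<forall>z\<in>set zs. length z = length xs"
  shows "\<exists>B\<subseteq>set xs. card B \<le> m \<and> (force R (insert v (set xs)))\<^sup>*\<^sup>* B (insert v (set xs))"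
  using assms(1,2,5)
proof (induction zs arbitrary: b)
  case Nil
  then show ?case by simp
next
  case (Cons z zs)
  let ?F = "adjacency R (v # xs) (v # xs)"
  let ?c = "forcing_if (leq (popcount z) m) ?F z"
  have "b = False" using Cons.prems(2) by simp
  have c: "any_forcing ?c zs m ?F"
    using Cons.prems(1) unfolding \<open>b = False\<close> any_forcing.simps .
  show ?case
  proof (cases ?c)
    case True
    then have z: "popcount z \<le> m" "saturates False ?F ?F (False # z)"
      by (cases "leq (popcount z) m"; simp)+
    obtain B where B: "B \<subseteq> set xs" "z = map (\<lambda>x. x \<in> B) xs" "popcount z = card B"
      using ex_subset_of_bits[OF assms(3), of z] Cons.prems(3) by auto
    have "(force R (set (v # xs)))\<^sup>*\<^sup>* B (set (v # xs))"
    proof (rule saturates_sound(1)[OF _ z(2)])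
      show "False # z = map (\<lambda>x. x \<in> B) (v # xs)"
        using B(1,2) assms(4) by auto
    qed (use assms(3,4) B(1) in auto)
    with z(1) B(1,3) show ?thesis by (intro exI[of _ B]) simp
  next
    case False
    then show ?thesis using Cons.IH[OF c] Cons.prems(3) by simp
  qed
qed

lemma insert_words_settles:
  assumes xs: "distinct xs" and f: "represents D f R (set xs)"
    and B: "B \<subseteq> set xs" "(force R (set xs))\<^sup>*\<^sup>* B (set xs)"
    and m: "m + length D \<le> Suc (length xs)" and b: "b \<Longrightarrow> card B < m"
    and zs: "\<forall>z\<in>set zs. length z = length xs"
  shows "trie_all (settles ex xs) T \<Longrightarrow> trie_all (settles ex xs)
    (insert_words b (adjacency R xs xs) m zs t (scales D (map f xs)) ws T)"
proof (induction ws arbitrary: T)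
  case (Cons w ws)
  let ?s = "incidences (scales D (map f xs)) (lookup t w)"
  have settles: "settles ex xs ?s"
    if "b \<or> any_forcing False zs m (extend ?s (adjacency R xs xs))"
    unfolding settles_def
  proof (intro allI impI)
    fix v assume v: "v \<notin> set xs" "?s = map (R v) xs"
    let ?V = "insert v (set xs)"
    have "\<exists>C\<subseteq>?V. card C \<le> m \<and> (force R ?V)\<^sup>*\<^sup>* C ?V"
    proof (cases b)
      case True
      have "card (insert v B) \<le> m"
        using b[OF True] B(1) v(1) by (subst card_insert_disjoint) (auto intro: finite_subset)
      then show ?thesis
        using force_insert_closure[OF B(2) v(1)] B(1) by (intro exI[of _ "insert v B"]) auto
    next
      case False
      then have "any_forcing False zs m (adjacency R (v # xs) (v # xs))"
        using that by (simp add: v(2) extend_adjacency)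
      from any_forcing_sound[OF this _ xs v(1) zs] show ?thesis by blast
    qed
    then obtain C where C: "C \<subseteq> ?V" "card C \<le> m" "(force R ?V)\<^sup>*\<^sup>* C ?V" by blast
    have "card C + length D \<le> Suc (length xs)" using C(2) m by linarith
    then show "settled R ex ?V"
      by (rule settled_if_represented[OF f v(1) xs v(2) C(1,3)])
  qed
  have "trie_all (settles ex xs) (insert_word b (adjacency R xs xs) m zs ?s T)"
    using settles Cons.prems
    by (cases b) (auto simp: insert_forcing_def intro: trie_all_insert trie_all_insert_if)
  then show ?case by (simp add: Cons.IH)
qed simp

text \<open>The counterpart of \<open>settles\<close> for membership in a catalogue. It serves
  twice: with the exceptional codes, and with the codes of the next catalogue.\<close>

definition linkable :: "trie \<Rightarrow> 'a list \<Rightarrow> bool list \<Rightarrow> bool" where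
  "linkable t xs s \<longleftrightarrow> (\<forall>v. v \<notin> set xs \<longrightarrow> s = map (R v) xs \<longrightarrow>
    (\<exists>ys. distinct ys \<and> set ys = insert v (set xs) \<and> trie_member (concat (rows R ys)) t))"

lemma linkable_permuted:
  assumes "distinct xs" "trie_member (permuted_code p (extend s (adjacency R xs xs))) t"
  shows "linkable t xs s"
  unfolding linkable_def
proof (intro allI impI)
  fix v assume v: "v \<notin> set xs" "s = map (R v) xs"
  have "trie_member (concat (rows R (permute p (v # xs)))) t"
    using assms(2) unfolding v(2) extend_adjacency permuted_code .
  moreover have "distinct (permute p (v # xs))" "set (permute p (v # xs)) = insert v (set xs)"
    using assms(1) v(1) by (simp_all add: distinct_permute set_permute)
  ultimately show "\<exists>ys. distinct ys \<and> set ys = insert v (set xs) \<and> trie_member (concat (rows R ys)) t"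
    by blast
qed

lemma settles_if_linkable: "linkable ex xs s \<Longrightarrow> settles ex xs s"
  unfolding linkable_def settles_def settled_def by blast

lemma run_table_settles:
  assumes xs: "distinct xs" and B: "B \<subseteq> set xs" "(force R (set xs))\<^sup>*\<^sup>* B (set xs)"
    and zs: "\<forall>z\<in>set zs. length z = length xs" and T: "trie_all (settles ex xs) T"
  shows "trie_all (settles ex xs)
    (run_table (rows R xs) (adjacency R xs xs) (card B) zs ts cs T)"
proof (cases ts)
  case Nil
  then show ?thesis using T by simp
next
  case (Cons tab ts')
  obtain D t names where tab: "tab = Vector_Table D t names" by (cases tab)
  let ?vs = "lookups t (prefix (length xs) cs)" and ?ws = "words_or_all (suffix (length xs) cs) names"
  let ?c = "embeds D (rows R xs) ?vs \<and> leq (len D) (Suc (length xs))"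
  have "trie_all (settles ex xs) (run_embedded ?c (adjacency R xs xs) (card B) zs
      (Suc (length xs) - length D) t (scales D ?vs) ?ws T)"
  proof (cases ?c)
    case True
    then obtain f where f: "map f xs = ?vs" "represents D f R (set xs)"
      using embeds_represents[OF xs] by blast
    have "trie_all (settles ex xs) (insert_words (leq (Suc (card B)) (Suc (length xs) - length D))
        (adjacency R xs xs) (Suc (length xs) - length D) zs t (scales D (map f xs)) ?ws T)"
      using True by (intro insert_words_settles[OF xs f(2) B _ _ zs T]) auto
    then show ?thesis unfolding f(1) using True by simp
  next
    case False
    then have "?c = False" by blast
    then show ?thesis using T by (simp only: run_embedded.simps)
  qed
  then show ?thesis by (simp add: Cons tab run_embedding_def)
qed

lemma run_groups_settles:
  assumes "distinct xs" "B \<subseteq> set xs" "(force R (set xs))\<^sup>*\<^sup>* B (set xs)"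
    and "\<forall>z\<in>set zs. length z = length xs"
  shows "trie_all (settles ex xs) T \<Longrightarrow> trie_all (settles ex xs)
    (run_groups (rows R xs) (adjacency R xs xs) (card B) zs ex ts gs T)"
proof (induction gs arbitrary: T)
  case (Cons g gs)
  show ?case
  proof (cases g)
    case Nil
    then show ?thesis using Cons by simp
  next
    case g: (Cons c cs)
    have "trie_all (settles ex xs)
        (run_group_if b (rows R xs) (adjacency R xs xs) (card B) zs ex ts cs T)" for b ts
      using run_table_settles[OF assms Cons.prems] Cons.prems
      by (cases b) (auto simp: insert_permuted_def
          intro!: trie_all_insert_if settles_if_linkable linkable_permuted[OF assms(1)])
    then show ?thesis unfolding g run_groups.simps by (intro Cons.IH)
  qed
qed simp

lemma length_vertex_sets: "z \<in> set (vertex_sets F w) \<Longrightarrow> length z = length F"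
  by (induction F w rule: vertex_sets.induct) auto

text \<open>The trie is used from both sides: every member is settled because of the way it was
  inserted, and the neighbourhood of a heaviest vertex is a member because the trie passed the
  coverage test.\<close>

lemma certified_sound:
  assumes "certified m ex ts d" "distinct xs" "length xs = Suc m"
    and "concat (rows R xs) = graph_code m d" "v \<notin> set xs" "heaviest R (insert v (set xs)) v"
  shows "settled R ex (insert v (set xs))"
proof -
  let ?F = "adjacency R xs xs"
  have "split_rows (Suc m) (graph_code m d) = rows R xs"
    using split_rows[of xs R] unfolding assms(3,4) .
  then have "certified_matrix (rows R xs) ?F ex ts (split_words (suffix m d))"
    using assms(1) by (simp only: certified_def certified_rows_def complete_matrix_rows)
  then obtain w gs where "certified_sets (rows R xs) ?F ex ts (vertex_sets ?F w) gs"
    by (cases "split_words (suffix m d)") auto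
  then obtain z zs where z: "vertex_sets ?F w = z # zs" "saturates False ?F ?F z"
    "covers_all ?F (run_groups (rows R xs) ?F (popcount z) (z # zs) ex ts gs Void)"
    by (cases "vertex_sets ?F w") auto
  have l: "\<forall>z\<in>set (z # zs). length z = length xs"
    using length_vertex_sets[of _ ?F w] by (simp add: z(1))
  then obtain B where B: "B \<subseteq> set xs" "z = map (\<lambda>x. x \<in> B) xs" "popcount z = card B"
    using ex_subset_of_bits[OF assms(2), of z] by auto
  have "(force R (set xs))\<^sup>*\<^sup>* B (set xs)"
    using saturates_sound(1)[OF assms(2) z(2) B(2,1)] by simp
  then have "trie_all (settles ex xs)
      (run_groups (rows R xs) ?F (popcount z) (z # zs) ex ts gs Void)"
    unfolding B(3) by (intro run_groups_settles[OF assms(2) B(1) _ l trie_all_Void])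
  moreover have "trie_member (map (R v) xs)
      (run_groups (rows R xs) ?F (popcount z) (z # zs) ex ts gs Void)"
    by (rule covers_all_sound[OF z(3) assms(2,5) sym irrefl assms(6) extend_adjacency])
  ultimately show ?thesis
    using assms(5) by (auto simp: trie_all_def settles_def)
qed

lemma catalogued_remove_heaviest:
  assumes "catalogued R n C" "finite V" "card V = Suc n"
  obtains v xs where "distinct xs" "v \<notin> set xs" "V = insert v (set xs)" "length xs = n"
    "concat (rows R xs) \<in> C" "heaviest R (insert v (set xs)) v"
proof -
  have "V \<noteq> {}" using assms(3) by auto
  then obtain v where v: "v \<in> V" "heaviest R V v"
    using ex_heaviest[OF assms(2)] by blast
  have n: "card (V - {v}) = n" using assms(2,3) v(1) by simp
  then obtain xs where xs: "distinct xs" "set xs = V - {v}" "concat (rows R xs) \<in> C"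
    using assms(1,2) unfolding catalogued_def by (metis finite_Diff)
  have V: "V = insert v (set xs)" using xs(2) v(1) by auto
  show ?thesis
  proof (rule that)
    show "distinct xs" "concat (rows R xs) \<in> C" "V = insert v (set xs)" by fact+
    show "v \<notin> set xs" using xs(2) by simp
    show "length xs = n" using n distinct_card[OF xs(1)] xs(2) by simp
    show "heaviest R (insert v (set xs)) v" using v(2) unfolding V .
  qed
qed

end

subsection \<open>Catalogues of small graphs\<close>

fun take_along :: "'b list \<Rightarrow> 'a list \<Rightarrow> 'a list" where
  "take_along [] cs = []"
| "take_along (x # xs) [] = []"
| "take_along (x # xs) (c # cs) = c # take_along xs cs"

fun drop_along :: "'b list \<Rightarrow> 'a list \<Rightarrow> 'a list" where
  "drop_along [] cs = cs"
| "drop_along (x # xs) [] = []"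
| "drop_along (x # xs) (c # cs) = drop_along xs cs"

text \<open>Each block of characters encodes a neighbourhood \<open>s\<close> of the new vertex and a permutation that
  takes the extended graph into the next catalogue. The first list only bounds the number of
  blocks.\<close>

fun run_links :: "'b list \<Rightarrow> bool list list \<Rightarrow> trie \<Rightarrow> string \<Rightarrow> trie \<Rightarrow> trie" where
  "run_links [] F t cs T = T"
| "run_links (x # fuel) F t [] T = T"
| "run_links (x # fuel) F t (c # cs) T = run_links fuel F t (drop_along F (c # cs))
     (insert_permuted F t (map fourth_bit (take_along F (c # cs))) (take_along F (c # cs)) T)"

definition linked_matrix :: "bool list list \<Rightarrow> trie \<Rightarrow> string \<Rightarrow> bool" where
  "linked_matrix F t cs \<longleftrightarrow> covers_all F (run_links cs F t cs Void)"

fun all_linked :: "nat \<Rightarrow> trie \<Rightarrow> string list \<Rightarrow> bool" where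
  "all_linked m t [] = True"
| "all_linked m t (d # ds) = (linked_matrix (complete_matrix (split_rows (Suc m) (graph_code m d)))
     t (suffix m d) \<and> all_linked m t ds)"

lemma all_linked_iff:
  "all_linked m t ds \<longleftrightarrow> (\<forall>d\<in>set ds. linked_matrix (complete_matrix
     (split_rows (Suc m) (graph_code m d))) t (suffix m d))"
  by (induction ds) auto

lemma all_certified_iff: "all_certified m ex ts ds \<longleftrightarrow> (\<forall>d\<in>set ds. certified m ex ts d)"
  by (induction ds) auto

context simple_graph_relation
begin

lemma run_links_linkable:
  "distinct xs \<Longrightarrow> trie_all (linkable t xs) T \<Longrightarrow>
     trie_all (linkable t xs) (run_links fuel (adjacency R xs xs) t cs T)"
proof (induction fuel "adjacency R xs xs" t cs T rule: run_links.induct)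
  case (3 x fuel t c cs T)
  have "trie_all (linkable t xs) (insert_permuted (adjacency R xs xs) t s p T)" for s p
    unfolding insert_permuted_def using 3(2,3)
    by (intro trie_all_insert_if) (auto intro: linkable_permuted)
  then show ?case using 3(1,2) by simp
qed simp_all

text \<open>Completeness propagates: a heaviest vertex is removed, the rest is listed, and the
  coverage test shows that the permitted extension was permuted onto a code of the next
  list.\<close>

lemma catalogued_Suc:
  assumes "catalogued R (Suc m) (set (map (graph_code m) ds))" "all_linked m (trie_of ss Void) ds"
  shows "catalogued R (Suc (Suc m)) (set ss)"
  unfolding catalogued_def
proof (intro allI impI, elim conjE)
  fix V :: "'a set" assume V: "finite V" "card V = Suc (Suc m)"
  obtain v xs where xs: "distinct xs" "v \<notin> set xs" "V = insert v (set xs)" "length xs = Suc m"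
    "concat (rows R xs) \<in> set (map (graph_code m) ds)" "heaviest R (insert v (set xs)) v"
    by (rule catalogued_remove_heaviest[OF assms(1) V]) (rule that)
  let ?F = "adjacency R xs xs" and ?t = "trie_of ss Void"
  from xs(5) obtain d where d: "d \<in> set ds" "graph_code m d = concat (rows R xs)" by auto
  have "split_rows (Suc m) (graph_code m d) = rows R xs"
    using split_rows[of xs R] unfolding xs(4) d(2) .
  then have "linked_matrix ?F ?t (suffix m d)"
    using assms(2) d(1) by (metis all_linked_iff complete_matrix_rows)
  then have "trie_member (map (R v) xs) (run_links (suffix m d) ?F ?t (suffix m d) Void)"
    unfolding linked_matrix_def
    by (rule covers_all_sound[OF _ xs(1,2) sym irrefl xs(6) extend_adjacency])
  moreover have "trie_all (linkable ?t xs) (run_links (suffix m d) ?F ?t (suffix m d) Void)"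
    using xs(1) by (intro run_links_linkable) (simp_all add: trie_all_Void)
  ultimately obtain ys where "distinct ys" "set ys = V" "trie_member (concat (rows R ys)) ?t"
    using xs(2,3) unfolding trie_all_def linkable_def by blast
  then show "\<exists>xs. distinct xs \<and> set xs = V \<and> concat (rows R xs) \<in> set ss"
    using trie_member_trie_of[of _ ss Void] by auto
qed

text \<open>The code of a graph on one vertex is empty, whatever the string \<open>d\<close>
  contains.\<close>

lemma catalogued_1: "catalogued R 1 (set (map (graph_code 0) [d]))"
proof -
  have "\<exists>xs. distinct xs \<and> set xs = V \<and> concat (rows R xs) = []" if "card V = 1" for V :: "'a set"
  proof -
    obtain x where "V = {x}" using \<open>card V = 1\<close> by (auto simp: card_1_singleton_iff)
    then show ?thesis by (intro exI[of _ "[x]"]) simp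
  qed
  then show ?thesis by (simp add: catalogued_def graph_code_def)
qed

lemma all_certified_sound:
  assumes "catalogued R (Suc m) (set (map (graph_code m) ds))"
    and "\<And>d. d \<in> set ds \<Longrightarrow> certified m ex ts d"
    and "finite V" "card V = Suc (Suc m)"
  shows "settled R ex V"
proof -
  obtain v xs where xs: "distinct xs" "v \<notin> set xs" "V = insert v (set xs)" "length xs = Suc m"
    "concat (rows R xs) \<in> set (map (graph_code m) ds)" "heaviest R (insert v (set xs)) v"
    by (rule catalogued_remove_heaviest[OF assms(1,3,4)]) (rule that)
  from xs(5) obtain d where "d \<in> set ds" "concat (rows R xs) = graph_code m d"
    by auto
  then show ?thesis
    using certified_sound[OF assms(2) xs(1,4) _ xs(2,6)] xs(3) by blast
qed

end

subsection \<open>Bounds for single graphs\<close>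

text \<open>Every set of at most \<open>k\<close> vertices fails to force all vertices; \<open>bs\<close> collects the choices for
  the vertices that were already visited.\<close>

fun small_stall :: "'a list \<Rightarrow> bool list list \<Rightarrow> nat \<Rightarrow> bool list \<Rightarrow> bool" where
  "small_stall [] F k bs = stalls F F bs"
| "small_stall (x # xs) F 0 bs = small_stall xs F 0 (False # bs)"
| "small_stall (x # xs) F (Suc k) bs =
     (small_stall xs F (Suc k) (False # bs) \<and> small_stall xs F k (True # bs))"

text \<open>The nonzero pattern of a symmetric matrix with the given graph, where \<open>ls\<close>
  prescribes which diagonal entries are nonzero.\<close>

fun complete_diagonal :: "bool list list \<Rightarrow> bool list \<Rightarrow> bool list list" where
  "complete_diagonal [] ls = []"
| "complete_diagonal (s # G) [] = []"
| "complete_diagonal (s # G) (l # ls) = (l # s) # add_column s (complete_diagonal G ls)"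

fun trues :: "'a list \<Rightarrow> bool list" where
  "trues [] = []"
| "trues (x # xs) = True # trues xs"

text \<open>Four sweeps are enough for the graphs to which this is applied; the number is irrelevant
  to soundness.\<close>

fun any_fills :: "bool \<Rightarrow> bool list list \<Rightarrow> nat \<Rightarrow> bool list list \<Rightarrow> bool" where
  "any_fills True zs k F = True"
| "any_fills False [] k F = False"
| "any_fills False (z # zs) k F =
     any_fills (leq (popcount z) k \<and> fills (prefix (Suc (Suc (Suc (Suc 0)))) F) (trues F) F (fit F z)) zs k F"

fun small_fill :: "'a list \<Rightarrow> bool list list \<Rightarrow> nat \<Rightarrow> bool list list \<Rightarrow> bool list \<Rightarrow> bool" where
  "small_fill [] G k zs ls = any_fills False zs k (complete_diagonal G ls)"
| "small_fill (x # xs) G k zs ls =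
     (small_fill xs G k zs (False # ls) \<and> small_fill xs G k zs (True # ls))"

lemma small_stall_sound:
  "small_stall xs F k bs \<Longrightarrow> length ys = length xs \<Longrightarrow> popcount ys \<le> k \<Longrightarrow> stalls F F (rev ys @ bs)"
proof (induction xs F k bs arbitrary: ys rule: small_stall.induct)
  case (2 x xs F bs)
  then obtain y ys' where "ys = y # ys'" by (cases ys) auto
  with 2 show ?case by (cases y) auto
next
  case (3 x xs F k bs)
  then obtain y ys' where "ys = y # ys'" by (cases ys) auto
  with 3 show ?case by (cases y) auto
qed simp

lemma small_fill_sound:
  "small_fill xs G k zs ls \<Longrightarrow> length ys = length xs \<Longrightarrow>
     any_fills False zs k (complete_diagonal G (rev ys @ ls))"
proof (induction xs G k zs ls arbitrary: ys rule: small_fill.induct)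
  case (2 x xs G k zs ls)
  then obtain y ys' where "ys = y # ys'" by (cases ys) auto
  with 2 show ?case by (cases y) auto
qed simp

lemma popcount_rev: "popcount (rev bs) = popcount bs"
proof -
  have "popcount bs = length (filter id bs)" for bs
    by (induction bs rule: popcount.induct) auto
  then show ?thesis by (simp add: rev_filter[symmetric])
qed

lemma trues_eq: "trues xs = map (\<lambda>_. True) xs"
  by (induction xs) auto

lemma complete_diagonal_rows:
  "(\<And>u w. R u w \<longleftrightarrow> R w u) \<Longrightarrow>
     complete_diagonal (rows R xs) (map (\<lambda>x. R x x) xs) = adjacency R xs xs"
proof (induction xs)
  case (Cons x xs)
  then show ?case using add_column_adjacency[of R x xs xs] by (simp add: adjacency_def)
qed (simp add: adjacency_def)

lemma popcount_fit: "popcount (fit xs z) \<le> popcount z"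
proof (induction xs z rule: fit.induct)
  case (2 x xs)
  then show ?case by simp
next
  case (3 x xs b bs)
  then show ?case by (cases b) auto
qed simp

text \<open>If zeros spread from \<open>B\<close> to all coordinates, the only kernel vector
  vanishing on \<open>B\<close> is 0, so \<open>kernel_vector_vanishing\<close> excludes a nullity
  above \<open>card B\<close>.\<close>

lemma any_fills_sound:
  fixes A :: "real^'v^'v"
  assumes "any_fills b zs k (adjacency (\<lambda>u v. A $ u $ v \<noteq> 0) xs xs)" "\<not> b"
    and xs: "distinct xs" "set xs = UNIV"
  shows "nullity A \<le> k"
  using assms(1,2)
proof (induction zs arbitrary: b)
  case Nil
  then show ?case by simp
next
  case (Cons z zs)
  let ?F = "adjacency (\<lambda>u v. A $ u $ v \<noteq> 0) xs xs"
  let ?fuel = "prefix (Suc (Suc (Suc (Suc 0)))) ?F"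
  let ?c = "leq (popcount z) k \<and> fills ?fuel (trues ?F) ?F (fit ?F z)"
  have "b = False" using Cons.prems(2) by simp
  have c: "any_fills ?c zs k ?F"
    using Cons.prems(1) unfolding \<open>b = False\<close> any_fills.simps .
  show ?case
  proof (cases ?c)
    case True
    obtain B where B: "fit ?F z = map (\<lambda>x. x \<in> B) xs" "popcount (fit ?F z) = card B"
      using ex_subset_of_bits[OF xs(1), of "fit ?F z"] by auto
    have "card B \<le> k" using B(2) True popcount_fit[of ?F z] by simp
    moreover have "nullity A \<le> card B"
    proof (rule ccontr)
      assume "\<not> nullity A \<le> card B"
      then obtain x where x: "A *v x = 0" "x \<noteq> 0" "\<forall>i\<in>B. x $ i = 0"
        using kernel_vector_vanishing[of B A] by auto
      have "trues ?F = map (\<lambda>_. True) xs"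
        by (simp add: trues_eq adjacency_def comp_def)
      then have "x = 0"
        using fills_sound[OF xs x(1) _ x(3), of ?fuel] True B(1) by simp
      with x(2) show False ..
    qed
    ultimately show ?thesis by simp
  next
    case False
    then show ?thesis using Cons.IH[OF c] by blast
  qed
qed

text \<open>The number \<open>k\<close> separates the two parameters: no set of at most
  \<open>k\<close> vertices is zero forcing, while for each zero pattern of the diagonal some set of
  at most \<open>k\<close> coordinates determines all kernel vectors.\<close>

lemma max_nullity_less_zero_forcing_number:
  fixes G :: "'v::finite pair_pre_digraph"
  assumes "pverts G = UNIV" "simple_graph_relation (\<lambda>u v. (u, v) \<in> parcs G)"
    and xs: "distinct xs" "set xs = UNIV"
    and "small_stall us (complete_matrix (rows (\<lambda>u v. (u, v) \<in> parcs G) xs)) k []"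
    and "small_fill us (rows (\<lambda>u v. (u, v) \<in> parcs G) xs) k zs []"
    and us: "length us = length xs"
  shows "max_nullity G < zero_forcing_number G"
proof -
  let ?R = "\<lambda>u v. (u, v) \<in> parcs G"
  interpret simple_graph_relation ?R by (rule assms(2))
  have "k < card Z" if Z: "zero_forcing_set G Z" for Z
  proof (rule ccontr)
    assume "\<not> k < card Z"
    moreover have "popcount (rev (map (\<lambda>x. x \<in> Z) xs)) = card Z"
      using popcount_map[OF xs(1), of "\<lambda>x. x \<in> Z"] by (simp add: popcount_rev xs(2))
    ultimately have "stalls (adjacency ?R xs xs) (adjacency ?R xs xs) (map (\<lambda>x. x \<in> Z) xs)"
      using small_stall_sound[OF assms(5), of "rev (map (\<lambda>x. x \<in> Z) xs)"]
      by (simp add: complete_matrix_rows us)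
    from stalls_sound[OF xs(1) this] Z show False
      by (simp add: xs(2) zero_forcing_set_def color_change_eq_force assms(1))
  qed
  moreover have "zero_forcing_set G UNIV"
    by (simp add: zero_forcing_set_def assms(1))
  ultimately have "k < zero_forcing_number G"
    unfolding zero_forcing_number_def by (subst Min_gr_iff) auto
  moreover have "nullity A \<le> k" if A: "A \<in> sym_matrices G" for A
  proof -
    let ?Q = "\<lambda>u v. A $ u $ v \<noteq> 0"
    have A_sym: "A $ u $ v = A $ v $ u" for u v
      using A unfolding sym_matrices_def transpose_def by (auto simp: vec_eq_iff) 
    have off: "?R u v \<longleftrightarrow> ?Q u v" if "u \<noteq> v" for u v
      using A that unfolding sym_matrices_def by blast
    have "rows ?R ys = rows ?Q ys" if "distinct ys" for ys
      using that
    proof (induction ys)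
      case (Cons y ys)
      then have "map (?R y) ys = map (?Q y) ys"
        by (intro map_cong refl off) auto
      with Cons show ?case by simp
    qed simp
    \<comment> \<open>The diagonal pattern of \<open>A\<close> is one of those enumerated by
      \<open>small_fill\<close>; it is reversed because the choices accumulate from the end.\<close>
    then have "any_fills False zs k (adjacency ?Q xs xs)"
      using small_fill_sound[OF assms(6), of "rev (map (\<lambda>x. ?Q x x) xs)"]
        complete_diagonal_rows[of ?Q xs] xs(1) A_sym us by simp
    then show ?thesis by (rule any_fills_sound) (use xs in auto)
  qed
  moreover have "sym_matrices G \<noteq> {}"
  proof -
    have "(\<chi> u v. if ?R u v then 1 else 0) \<in> sym_matrices G"
      by (auto simp: sym_matrices_def transpose_def vec_eq_iff sym)
    then show ?thesis by blast
  qed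
  ultimately show ?thesis
    unfolding max_nullity_def by (subst Max_less_iff) (auto simp: finite_nullities intro: le_less_trans)
qed

section \<open>Isomorphism as equality of adjacency rows\<close>

lemma rows_map: "rows R (map g ys) = rows (\<lambda>a b. R (g a) (g b)) ys"
  by (induction ys) auto

lemma rows_cong:
  "(\<And>a b. a \<in> set ys \<Longrightarrow> b \<in> set ys \<Longrightarrow> R a b \<longleftrightarrow> R' a b) \<Longrightarrow> rows R ys = rows R' ys"
  by (induction ys) auto

lemma length_rows [simp]: "length (rows R xs) = length xs"
  by (induction xs) auto

lemma rows_eqD:
  "rows R xs = rows R' ys \<Longrightarrow> i < j \<Longrightarrow> j < length xs \<Longrightarrow> R (xs ! i) (xs ! j) \<longleftrightarrow> R' (ys ! i) (ys ! j)"
proof (induction xs arbitrary: ys i j)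
  case (Cons x xs)
  then obtain y ys' where ys: "ys = y # ys'" by (cases ys) auto
  obtain j' where j: "j = Suc j'" using Cons.prems(2) by (cases j) auto
  have e: "map (R x) xs = map (R' y) ys'" "rows R xs = rows R' ys'"
    using Cons.prems(1) by (auto simp: ys)
  have l: "length xs = length ys'" using e(1) by (rule map_eq_imp_length_eq)
  show ?case
  proof (cases i)
    case 0
    have "map (R x) xs ! j' = map (R' y) ys' ! j'" using e(1) by simp
    then show ?thesis using Cons.prems(3) l by (simp add: ys j 0)
  next
    case (Suc i')
    then show ?thesis using Cons.IH[OF e(2), of i' j'] Cons.prems by (simp add: ys j)
  qed
qed simp

lemma pair_graph_relation:
  assumes "pair_graph G"
  shows "simple_graph_relation (\<lambda>u v. (u, v) \<in> parcs G)"
proof -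
  interpret pair_graph G by (rule assms)
  show ?thesis
    by unfold_locales
      (use pair_sym_arcs pair_no_loops in \<open>fastforce simp: symmetric_def sym_def\<close>)+
qed

text \<open>An isomorphism in the library maps vertices and arcs separately, but here arcs are
  pairs, so the vertex map determines the arc map. What remains is a bijection of the vertices,
  which amounts to an enumeration of \<open>G\<close> that matches the fixed enumeration of
  \<open>H\<close>; symmetry and irreflexivity reduce the comparison to pairs above the
  diagonal.\<close>

lemma digraph_iso_iff_rows:
  fixes G :: "'a pair_pre_digraph" and H :: "'b pair_pre_digraph"
  assumes "pair_graph G" "pair_graph H" "distinct ys" "set ys = pverts H"
  shows "digraph_iso (with_proj G) (with_proj H) \<longleftrightarrow>
    (\<exists>xs. distinct xs \<and> set xs = pverts G \<and>
      rows (\<lambda>u v. (u, v) \<in> parcs G) xs = rows (\<lambda>u v. (u, v) \<in> parcs H) ys)"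
    (is "?iso \<longleftrightarrow> ?rows")
proof
  interpret G: pair_graph G by (rule assms(1))
  assume ?iso
  then obtain h where h: "pre_digraph.digraph_isomorphism (with_proj G) h"
    "with_proj H = app_iso h (with_proj G)"
    by (auto simp: digraph_iso_def)
  let ?f = "iso_verts h"
  have f: "?f ` pverts G = pverts H" "inj_on ?f (pverts G)"
    using h by (auto simp: pre_digraph.digraph_isomorphism_def dest: arg_cong[where f = verts])
  have arcs: "iso_arcs h ` parcs G = parcs H"
    using arg_cong[OF h(2), of arcs] by simp
  \<comment> \<open>\<open>app_iso\<close> takes the tail and head functions of the image from
    \<open>h\<close>, so the equation with \<open>with_proj H\<close> identifies them with the
    projections.\<close>
  have ends: "iso_tail h = fst" "iso_head h = snd"
    using arg_cong[OF h(2), of tail] arg_cong[OF h(2), of head] by simp_all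
  have arc: "iso_arcs h (u, v) = (?f u, ?f v)" if "(u, v) \<in> parcs G" for u v
    using h(1) that ends by (auto simp: pre_digraph.digraph_isomorphism_def prod_eq_iff)
  have eq: "(u, v) \<in> parcs G \<longleftrightarrow> (?f u, ?f v) \<in> parcs H" if "u \<in> pverts G" "v \<in> pverts G" for u v
  proof
    assume "(?f u, ?f v) \<in> parcs H"
    then obtain u' v' where uv: "(u', v') \<in> parcs G" "(?f u, ?f v) = (?f u', ?f v')"
      using arcs arc by force
    then have "u = u'" "v = v'"
      using that f(2) G.in_arcsD1[OF uv(1)] G.in_arcsD2[OF uv(1)] by (auto dest: inj_onD)
    with uv(1) show "(u, v) \<in> parcs G" by simp
  qed (use arc arcs in force)
  \<comment> \<open>The required enumeration of \<open>G\<close> is the given one of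
    \<open>H\<close> pulled back along the isomorphism.\<close>
  let ?g = "the_inv_into (pverts G) ?f"
  have g: "?g y \<in> pverts G" "?f (?g y) = y" if "y \<in> set ys" for y
    using that assms(4) f by (auto intro: the_inv_into_into f_the_inv_into_f)
  have "rows (\<lambda>u v. (u, v) \<in> parcs G) (map ?g ys) = rows (\<lambda>u v. (u, v) \<in> parcs H) ys"
    unfolding rows_map by (rule rows_cong) (simp add: eq g)
  moreover have "distinct (map ?g ys)"
    using assms(3) g(2) by (auto simp: distinct_map intro: inj_on_inverseI)
  moreover have "set (map ?g ys) = pverts G"
    using f by (simp add: assms(4) flip: f(1))
  ultimately show ?rows by blast
next
  interpret G: pair_graph G by (rule assms(1))
  interpret H: pair_graph H by (rule assms(2))
  interpret RG: simple_graph_relation "\<lambda>u v. (u, v) \<in> parcs G"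
    by (rule pair_graph_relation[OF assms(1)])
  interpret RH: simple_graph_relation "\<lambda>u v. (u, v) \<in> parcs H"
    by (rule pair_graph_relation[OF assms(2)])
  assume ?rows
  then obtain xs where xs: "distinct xs" "set xs = pverts G"
    and r: "rows (\<lambda>u v. (u, v) \<in> parcs G) xs = rows (\<lambda>u v. (u, v) \<in> parcs H) ys"
    by blast
  have l: "length xs = length ys" using arg_cong[OF r, of length] by simp
  define f where "f x = the (map_of (zip xs ys) x)" for x
  have f: "f (xs ! i) = ys ! i" if "i < length xs" for i
    using that l xs(1) by (simp add: f_def map_of_zip_nth)
  have "map f xs = ys" using l f by (intro nth_equalityI) auto
  then have im: "f ` pverts G = pverts H" and inj: "inj_on f (pverts G)"
    using assms(3,4) xs by (metis set_map, metis distinct_map)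
  have eq: "(u, v) \<in> parcs G \<longleftrightarrow> (f u, f v) \<in> parcs H" if "u \<in> pverts G" "v \<in> pverts G" for u v
  proof -
    have "u \<in> set xs" "v \<in> set xs" using that xs(2) by simp_all
    then obtain i j where ij: "u = xs ! i" "v = xs ! j" "i < length xs" "j < length xs"
      unfolding in_set_conv_nth by blast
    show ?thesis
    proof (cases i j rule: linorder_cases)
      case less
      then show ?thesis using rows_eqD[OF r less] ij f l by simp
    next
      case equal
      then show ?thesis using ij RG.irrefl RH.irrefl by simp
    next
      case greater
      then have "(v, u) \<in> parcs G \<longleftrightarrow> (f v, f u) \<in> parcs H"
        using rows_eqD[OF r greater] ij f l by simp
      then show ?thesis using RG.sym RH.sym by blast
    qed
  qed
  have arcs: "map_prod f f ` parcs G = parcs H"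
  proof (intro equalityI subsetI)
    fix e assume "e \<in> map_prod f f ` parcs G"
    then obtain u v where "(u, v) \<in> parcs G" "e = (f u, f v)" by auto
    then show "e \<in> parcs H"
      using eq[of u v] G.in_arcsD1[of u v] G.in_arcsD2[of u v] by simp
  next
    fix e assume "e \<in> parcs H"
    then obtain u v where uv: "e = (u, v)" "(u, v) \<in> parcs H" by (cases e) auto
    then obtain u' v' where "u = f u'" "v = f v'" "u' \<in> pverts G" "v' \<in> pverts G"
      using H.in_arcsD1 H.in_arcsD2 im by (metis imageE)
    then show "e \<in> map_prod f f ` parcs G"
      using uv eq by force
  qed
  let ?h = "\<lparr>iso_verts = f, iso_arcs = map_prod f f, iso_head = snd, iso_tail = fst\<rparr>"
  have "pre_digraph.digraph_isomorphism (with_proj G) ?h"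
    unfolding pre_digraph.digraph_isomorphism_def
  proof (intro conjI)
    show "wf_digraph (with_proj G)" by unfold_locales
    show "inj_on (iso_arcs ?h) (arcs (with_proj G))"
      using inj G.in_arcsD1 G.in_arcsD2 by (auto simp: inj_on_def)
  qed (use inj in auto)
  moreover have "with_proj H = app_iso ?h (with_proj G)"
    by (simp add: app_iso_def with_proj_def im arcs)
  ultimately show ?iso
    by (auto simp: digraph_iso_def)
qed

section \<open>The exceptional graphs\<close>

definition exceptional_edges :: "nat rel list" where
  "exceptional_edges = [edges1, edges2, edges2 \<union> {(1, 2)}, edges2 \<union> {(1, 4)},
     edges2 \<union> {(1, 2), (2, 4)}, edges2 \<union> {(1, 2), (1, 4)}, edges2 \<union> {(1, 2), (1, 4), (2, 4)}]"

text \<open>The 28 entries above the diagonal in the vertex order 0 to 7, with rows of lengths 7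
  down to 1, listed in the order of \<open>exceptional_edges\<close>.\<close>

definition exceptional_codes :: "bool list list" where
  "exceptional_codes = map binary
     [''1000000111100010000100110010'', ''1101010010011101011000110000'',
      ''1101010110011101011000110000'', ''1101010011011101011000110000'',
      ''1101010110011111011000110000'', ''1101010111011101011000110000'',
      ''1101010111011111011000110000'']"

definition bounded_matrix :: "nat \<Rightarrow> bool list list \<Rightarrow> bool list list \<Rightarrow> bool list list \<Rightarrow> bool" where
  "bounded_matrix k zs G F \<longleftrightarrow> small_stall F F k [] \<and> small_fill F G k zs []"

definition bounded_rows :: "nat \<Rightarrow> bool list list \<Rightarrow> bool list list \<Rightarrow> bool" where
  "bounded_rows k zs G = bounded_matrix k zs G (complete_matrix G)"

fun all_bounded :: "nat \<Rightarrow> bool list list \<Rightarrow> bool list list \<Rightarrow> bool" where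
  "all_bounded k zs [] = True"
| "all_bounded k zs (bs # ss) = (bounded_rows k zs (split_rows 8 bs) \<and> all_bounded k zs ss)"

lemma graph_of_simps [simp]:
  "pverts (graph_of es) = {0..7}" "(u, v) \<in> parcs (graph_of es) \<longleftrightarrow> (u, v) \<in> es \<or> (v, u) \<in> es"
  by (auto simp: graph_of_def)

lemma exceptional_graphs:
  "{E1, E2, E3, E4, E5, E6, E7} = graph_of ` set exceptional_edges"
  by (simp add: exceptional_edges_def E1_def E2_def E3_def E4_def E5_def E6_def E7_def)

lemma pair_graph_exceptional: "es \<in> set exceptional_edges \<Longrightarrow> pair_graph (graph_of es)"
proof -
  have *: "pair_graph (graph_of es)" if "es \<subseteq> {0..7} \<times> {0..7}" "\<forall>(u, v)\<in>es. u \<noteq> v" for es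
  proof unfold_locales
    show "finite (parcs (graph_of es))"
      using finite_subset[OF that(1)] by (simp add: graph_of_def)
    show "symmetric (with_proj (graph_of es))"
      by (auto simp: symmetric_def sym_def)
  qed (use that in \<open>auto simp: graph_of_def\<close>)
  assume "es \<in> set exceptional_edges"
  then show ?thesis
    by (intro *) (auto simp: exceptional_edges_def edges1_def edges2_def)
qed

lemma exceptional_codes:
  "map (\<lambda>es. concat (rows (\<lambda>u v. (u, v) \<in> es \<or> (v, u) \<in> es) [0, 1, 2, 3, 4, 5, 6, 7])) exceptional_edges =
     exceptional_codes"
  by code_simp

text \<open>Two candidate sets suffice because only the diagonal entry at vertex 7 has to be
  distinguished. In the first graph, \<open>{0, 2}\<close> works if this entry is 0, as row 7 then
  forces 5, and \<open>{0, 3}\<close> works otherwise, as row 7 then forces 7 itself once 5 is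
  known. In the other six, \<open>{0, 1, 3}\<close> works if it is 0, as row 7 forces 2, and
  \<open>{0, 1, 6}\<close> otherwise, after row 6 has forced 4 and row 0 has forced 2; the optional
  edges join vertices among 1, 2, 4 and disturb none of these forces.\<close>

lemma bounded_codes:
  "all_bounded 2 (map binary [''10100000'', ''10010000'']) (take 1 exceptional_codes)"
  "all_bounded 3 (map binary [''11000010'', ''11010000'']) (drop 1 exceptional_codes)"
  by code_simp+

section \<open>The enumeration\<close>

definition vectors_0 :: "bool list list lookup_tree" where
  "vectors_0 = tree_of digits [
 ''0''] (Tip [])"

definition vectors_1 :: "bool list list lookup_tree" where
  "vectors_1 = tree_of digits [
 ''04'', ''13''] (Tip [])"

text \<open>Scaling does not affect orthogonality, so one vector per line is listed, together with
  the zero vector for isolated vertices. Dimension 2 contains all lines spanned by entries of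
  absolute value at most 3, dimension 3 all those with entries up to 2, and dimension 4 all those
  with entries up to 1 and some more.\<close>

definition vectors_2 :: "bool list list lookup_tree" where
  "vectors_2 = tree_of digits [
 ''040'', ''150'', ''241'', ''361'', ''442'', ''552'', ''662'', ''743'', ''834'', ''944'',
 ''A54'', ''B64'', ''C45'', ''D65'', ''E46'', ''F56'', ''G33''] (Tip [])"

definition vectors_3 :: "bool list list lookup_tree" where
  "vectors_3 = tree_of digits [
 ''0411'', ''1421'', ''2521'', ''3431'', ''4341'', ''5441'', ''6541'', ''7451'', ''8412'',
 ''9512'', ''A422'', ''B522'', ''C432'', ''D532'', ''E342'', ''F442'', ''G542'', ''H352'',
 ''I452'', ''J552'', ''K413'', ''L423'', ''M523'', ''N433'', ''O343'', ''P443'', ''Q543'',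
 ''R453'', ''S414'', ''T514'', ''U424'', ''V524'', ''W334'', ''X434'', ''Y534'', ''Z344'',
 ''a444'', ''b544'', ''c354'', ''d454'', ''e554'', ''f415'', ''g425'', ''h525'', ''i435'',
 ''j345'', ''k445'', ''l545'', ''m455'', ''n333''] (Tip [])"

definition vectors_4 :: "bool list list lookup_tree" where
  "vectors_4 = tree_of digits [
 ''04222'', ''14322'', ''23422'', ''34422'', ''44232'', ''54332'', ''63432'', ''74432'',
 ''84242'', ''93342'', ''A4342'', ''B3442'', ''C4442'', ''D4223'', ''E4323'', ''F3423'',
 ''G4423'', ''H4233'', ''I4333'', ''J3433'', ''K4433'', ''L4243'', ''M3343'', ''N4343'',
 ''O3443'', ''P4443'', ''Q4224'', ''R4324'', ''S3424'', ''T4424'', ''U4234'', ''V3334'',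
 ''W4334'', ''X3434'', ''Y4434'', ''Z4244'', ''a3344'', ''b4344'', ''c3444'', ''d4444'',
 ''e3333'', ''f4413'', ''g4143'', ''h5312'', ''i3512'', ''j4453'', ''k3543'', ''l5523'',
 ''m5431'', ''n4131'', ''o5213'', ''p4113'', ''q5314'', ''r4345'', ''s3545'', ''t5342'',
 ''u5132'', ''v4513'', ''w5322'', ''x4523''] (Tip [])"

definition vectors_5 :: "bool list list lookup_tree" where
  "vectors_5 = tree_of digits [
 ''043322'', ''134322'', ''233422'', ''343232'', ''434232'', ''542332'', ''643332'', ''734332'',
 ''844332'', ''933432'', ''A43432'', ''B34432'', ''C33342'', ''D43342'', ''E34342'', ''F33442'',
 ''G43223'', ''H34223'', ''I42323'', ''J43323'', ''K34323'', ''L44323'', ''M33423'', ''N43423'',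
 ''O34423'', ''P42233'', ''Q43233'', ''R34233'', ''S44233'', ''T42333'', ''U43333'', ''V34333'',
 ''W44333'', ''X42433'', ''Y33433'', ''Z43433'', ''a34433'', ''b44433'', ''c43243'', ''d34243'',
 ''e42343'', ''f33343'', ''g43343'', ''h34343'', ''i44343'', ''j33443'', ''k43443'', ''l34443'',
 ''m43324'', ''n34324'', ''o33424'', ''p43234'', ''q34234'', ''r42334'', ''s33334'', ''t43334'',
 ''u34334'', ''v44334'', ''w33434'', ''x43434'', ''y34434'', ''z33344'', ''!43344'', ''#34344'',
 ''$33444'', ''%33333'', ''&43242'', ''+44423'', '',34422'', ''-42322'', ''.44322'', ''/42224'',
 '':42424'', '';42432'', ''=44442''] (Tip [])"

definition vectors_6 :: "bool list list lookup_tree" where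
  "vectors_6 = tree_of digits [
 ''0433333'', ''1343333'', ''2334333'', ''3333433'', ''4333343'', ''5333334'', ''6333333'',
 ''7333342'', ''8423433'', ''9433343'', ''A344233'', ''B334334'', ''C423323'', ''D433433'',
 ''E433324'', ''F424333'', ''G344333'', ''H342332'', ''I343443'', ''J444334'', ''K334444'',
 ''L334424'', ''M334323'', ''N422333'', ''O334344'', ''P344343'', ''Q432323'', ''R434334'',
 ''S423224'', ''T433323'', ''U344334'', ''V433223'', ''W343323'', ''X443333'', ''Y342334'',
 ''Z423333'', ''a334432'', ''b433423'', ''c423334'', ''d343232'', ''e344332'', ''f343322'',
 ''g343343'', ''h434433'', ''i342333'', ''j433234'', ''k433434'', ''l434323'', ''m342323'',
 ''n334443'', ''o432333'', ''p334232'', ''q334332'', ''r423233'', ''s343344'', ''t433332'',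
 ''u434333'', ''v343234'', ''w423343'', ''x343332'', ''y334243'', ''z433233'', ''!333424'',
 ''#334423'', ''$334342'', ''%334233'', ''&334324'', ''+433342'', '',333443'', ''-333432'',
 ''.334343'', ''/433344'', '':432433'', '';333344'', ''=443332''] (Tip [])"

text \<open>These are e1, e1 + e2, ..., e6 + e7, e7: exactly consecutive vectors are non-orthogonal
  for the standard form, so they represent the path on 8 vertices, with nullity 1 in dimension
  7.\<close>

definition vectors_7 :: "bool list list lookup_tree" where
  "vectors_7 = tree_of digits [
 ''04333333'', ''14433333'', ''23443333'', ''33344333'', ''43334433'', ''53333443'', ''63333344'',
 ''73333334''] (Tip [])"

text \<open>Over the reals a form matters only through its signature, so the entries are 1 and -1.
  The table for paths stands first; the indefinite forms begin in dimension 2, and several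
  signatures are provided for dimensions 4, 5 and 6.\<close>

definition tables :: "vector_table list" where
  "tables = [
    Vector_Table (digits ''4444444'') vectors_7
      ''01234567'',
    Vector_Table (digits '''') vectors_0
      ''0'',
    Vector_Table (digits ''4'') vectors_1
      ''01'',
    Vector_Table (digits ''42'') vectors_2
      ''0123456789ABCDEFG'',
    Vector_Table (digits ''442'') vectors_3
      ''0123456789ABCDEFGHIJKLMNOPQRSTUVWXYZabcdefghijklmn'',
    Vector_Table (digits ''4422'') vectors_4
      ''0123456789ABCDEFGHIJKLMNOPQRSTUVWXYZabcdefghijklmnopqrstuvwx'',
    Vector_Table (digits ''4442'') vectors_4
      ''0123456789ABCDEFGHIJKLMNOPQRSTUVWXYZabcdefghijklmnopqrstuvwx'',
    Vector_Table (digits ''44422'') vectors_5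
      ''0123456789ABCDEFGHIJKLMNOPQRSTUVWXYZabcdefghijklmnopqrstuvwxyz!#$%&+,-./:;='',
    Vector_Table (digits ''44442'') vectors_5
      ''0123456789ABCDEFGHIJKLMNOPQRSTUVWXYZabcdefghijklmnopqrstuvwxyz!#$%&+,-./:;='',
    Vector_Table (digits ''444442'') vectors_6
      ''0123456789ABCDEFGHIJKLMNOPQRSTUVWXYZabcdefghijklmnopqrstuvwxyz!#$%&+,-./:;='',
    Vector_Table (digits ''444422'') vectors_6
      ''0123456789ABCDEFGHIJKLMNOPQRSTUVWXYZabcdefghijklmnopqrstuvwxyz!#$%&+,-./:;='']"

text \<open>A graph on one vertex takes no characters, so both characters are blocks: the new vertex
  is nonadjacent for \<open>0\<close> and adjacent for \<open>H\<close>.\<close>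

definition catalogue_1 :: "string list" where
  "catalogue_1 = [
 ''0H'']"

definition catalogue_2 :: "string list" where
  "catalogue_2 = [
 ''000I11HJH'', ''1HH'']"

definition catalogue_3 :: "string list" where
  "catalogue_3 = [
 ''00000J202H1KI120HK1H3HHKHH'', ''01H00KH1K0H1HHKHH'', ''21HH1JHH'', ''31HHH'']"

definition catalogue_4 :: "string list" where
  "catalogue_4 = [
 ''0000000K3003H20LJ2030H1L2H14HI1LII1300HL20H4H1HLI1H40HHL1HH4HHHLHHH'',
 ''001I1001H00LJ20L1H14HH1LII1L10H4H0HLI1H20HHL1HH4HHHLHHH'', ''0211HH1LHH0LH1HL0HH3HHHLHHH'',
 ''421KHH0KHHH'', ''101JJ20L3H14HJ1LII1L30H4H2HLI1H20HHL3HH4HJHLHHH'',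
 ''411HH21LIH1LH0HK1HH3HHILHHH'', ''0311HHHLHHH'', ''431KHHH'', ''511IJI1II1HI2HI1HIHLHHH'',
 ''631JHHH'', ''731HHHH'']"

definition catalogue_5 :: "string list" where
  "catalogue_5 = [
 ''000000000L40004H300MK30040H20M3H205HJ20MJJ20400H1M30H15H2H1MJ2H150HI1M2HI15HII1MIII14000HM300H5H20HMJ20H50H1HM2H1H5HI1HMII1H500HHM20HH5H1HHMI1HH50HHHM1HHH5HHHHMHHHH'',
 ''0001J20002H100MK30020H00M3H205HJ20MHH00M20H15H1H1MJ2H150HH1M2HI15HII1MHHH1M200H5H10HMJ20H50H0HM2H1H5HI1HMHH0H300HHM20HH5H1HHMI1HH50HHHM1HHH5HHHHMHHHH'',
 ''0021MH000MHH10MH0H020HH1M1HH05HHH0MHHH0MH00HM1H1H5HH1HMHH1HM10HH5H0HHMH0HH40HHHM1HHH5HHHHMHHHH'',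
 ''0421MHI10MH1H0M0HH04HHH0MHHH0MHI1HMH1HHM0HHH4HHHHMHHHH'', ''8421LHHH0LHHHH'',
 ''0101H0000MH300M0H203HJ20MHJ20M01I15H3H1MJ3H150HJ1M2HJ15HII1MIII1M011H5H30HMJ30H50H2HM2H2H5HI1HMII1H300HHM00HH5H3HHMI3HH50HJHM1HJH5HHHHMHHHH'',
 ''1021KK300J4H102HK10MII20J40H02H3H0MI1H120HH1M1HI15HHI1MIII1MJ20HL3H1H4HJ1HMJJ1HL30HH4H2HHMJ2HH40HHHM1HHH5HHHHMJJHH'',
 ''04111HH21MHH00MH1H15HIH1MHHH1M0H0H5HH0HMHI0HM00HH4H1HHMI1HI40HHIM1HHH5HHHHMHHHH'',
 ''4421MJH004HHH0MJHH1MJH0HLJ1HHL2HHH4HHHHMJHHH'', ''0031MHHI1MHH1HMH0HH20HHHM1HHH5HHHHMHHHH'',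
 ''0431MHHI1M0HHH4HHHHMHHHH'', ''8431LHHH0LHHHH'',
 ''4121HH320MIH21MH0I1M2HJ15HII1MHHI1MH11HM1H1H4HH2HMHI2HL10HI5H0HHMJ0HI40HHHM1HHI5HHJHMHHII'',
 ''0511KH2H12HJI1MHIJ1K0H1H2HI1HMHK1H2H2HIMH1HH20HIHM0HHI5HHHHMHHHH'',
 ''8630KHI104HHH1MHHH0LHI1HLI1HHL1HHH4HHHHMHIIH'', ''8231MH0HHL1HHH4HHHIMHHHH'',
 ''06313HHHHMHHHH'', ''8631LHHHH'', ''L630HHI20LHHH1LHH0HMI1HHM1HHH5HHHHMHHHH'', ''L631KHHHH'',
 ''1031HH000MHH20MH0H1K2HI13HII1MHHI1MH00HK2H1H3HI1HMHH1HK20HH3H1HHMH0HH20HHHM1HHH5HHHHMHHHH'',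
 ''4521MH1H1M0HH11HJJ1MHII1MHI1HMH1HHM0HHH4HIIHMHIIH'', ''9431LHHH0LHHHH'',
 ''9111LJK20LJ2H1L4HJ14HJJ1MIKJ1LL30HL3H2H4HJ1HMKK1HL30HH4H3HHML1HH40HHIM1HHH5HHJIMHHHH'',
 ''L511HLH00MJHI1MJJ0HKI1HIK1HHH5HHHHMHHHH'', ''2631L0HJH3HHHHMHHHH'', ''L531LHHHH'',
 ''07311HHHHMHHHH'', ''8731LHHHH'', ''L730LHII1LHI1HMH3HHM0HJH3HJJHMHJJH'', ''L731KHHHH'',
 ''M531HHHI1LHHHH'', ''N731JHHHH'', ''O731HHHHH'']"

definition catalogue_6 :: "string list" where
  "catalogue_6 = [
 ''@0000000000M500005H4000NL400050H300N4H3006HK300NKK300500H20N40H206H3H20NK3H2060HJ20N3HJ206HJJ20NJJJ205000H1N400H16H30H1NK30H160H2H1N3H2H16HJ2H1NJJ2H1600HI1N30HI16H2HI1NJ2HI160HII1N2HII16HIII1NIIII150000HN4000H6H300HNK300H60H20HN3H20H6HJ20HNJJ20H600H1HN30H1H6H2H1HNJ2H1H60HI1HN2HI1H6HII1HNIII1H6000HHN300HH6H20HHNJ20HH60H1HHN2H1HH6HI1HHNII1HH600HHHN20HHH6H1HHHNI1HHH60HHHHN1HHHH6HHHHHIHHHHH'',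
 ''@0001K300003H2000NL400030H100N4H3006HK300NII100300H00N40H206H3H20NI1H0060HJ20N1HH006HHH00JIII20N300H16H20H1NK30H160H1H1N3H2H16HJ2H1NII1H1600HH1N30HI16H2HI1NI1HH160HII1N1HHH16HHHH1LHHHI0N3000H6H200HNK300H60H10HN3H20H6HJ20HNII10H600H0HN30H1H6H2H1HNI1H0H60HI1HN1HH0H6HHH0HLHHH1I4000HHN300HH6H20HHNJ20HH60H1HHN2H1HH6HI1HHNII1HH600HHHN20HHH6H1HHHNI1HHH60HHHHN1HHHH6HHHHHKHHHIH'',
 ''@0021NI1000N1H0006HH000HII100NI1H10N1HH106HHH10NIII10NI10H0N1H0H06HH0H0NII1H0300HH1N20HH06H1HH0NI1HH060HHH0N1HHH06HHHH0MHHJH0NI100HN1H00H6HH00HNJJ20HN20H1H6H1H1HNI1H1H60HH1HN1HH1H6HHH1HKHIK2HN200HH6H10HHNI10HH60H0HHN1H0HH6HH0HHKHI3HI500HHHN20HHH6H1HHHNI1HHH60HHHHN1HHHH6HHHHHNIIIII'',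
 ''@0421MHK200MH3H10N1HI106HHI10NIII10MH30H0N1H1H06HH1H0NII1H0N10HH06H0HH0NI1HH050HHH0N1HHH06HHHH0HKKHH1IHI20HIH1H1HN1HI1H6HHI1HNIII1HIH10HHN1H1HH6HH1HHNII1HHN10HHH6H0HHHNI1HHH50HHHHN1HHHH6HHHHHIIIIII'',
 ''@8421JHII20JHI1H1JH1HH1J0HHH15HHHH0MIHII1HIHH0HHIH0IHHI0JHHH1KHHH5HHHHHILHIII'',
 ''08421MHHHH0MHHHHH'',
 ''@0101I100001H0000NL4000N1H3006HH300NII300N10H206H0H20NI1H2040HJ20N1HJ206HHJ20HJLH20N101I16H01I1NI11I160H3H1N3H3H16HJ3H1NJJ3H1600HJ1N30HJ16H2HJ1NJ2HJ160HII1N2HII16HIII1NKKHI0N1011H6H011HNI111H60H30HN3H30H6HJ30HNJJ30H600H2HN30H2H6H2H2HNJ2H2H60HI1HN2HI1H6HII1HNKKH1I4000HHN100HH6H00HHHJ41IH60H3HHN2H3HH6HI3HHNKK1JH600HJHN20HJH6H1HJHNK3KIH60HHHHN1HHHH6HHHHHMHJHIH'',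
 ''@1021KH4001K0H3014HK300IHH2113H4H10LI1J2130HK10L1KI216HII20NIJJ103H40H0LI12I130H3H0L1K1I16HI1H1NIJ2H0300HH1L51KH06H1HI1NI2HI160HHI1N1HII16HIII1LHHJH0HJ200HH2H10H6HJ20HMHJ30HI12K2I5H3H1HNI1I0I50HJ1HN1JI0I6HJJ1HNIJJ1HI123II5H30HHNI11JH50H2HHN1J1JH6HJ2HHNIJ2HH500HHHI00KII6H1HHHNI3HHH60HHHHN1HJHH6HJJHHKHHHHI'',
 ''08410MJJ200MJ2I10M2II105III10NIII10MJ21H0M2I1H05II1H0NII1H0L30HH14H2HH1NK3HH040HIH1N3HJH06HJJH0NJJJH0MJJ20HIK3I0HI3IJ0H1IJJ0HNIII1HIK31IHI3I2IH1IJ2IHNII1HHM51KHI5I4KHINK3HHH51KKHIN3HJHH6HJJHHNJJJHH'',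
 ''@0411NII300NI1H2120HH21N1HH006HHH00KJLK00N1H1H16HH1H1NII2H1LI1KI160HIH1N1HHH16HHHH1IIJII1LII12HN10H0H6H0H0HNI1H1H60HH0HN1HI0H6HHI0HIIJJ1HN100HH6H00HHMH40II50H1HHN2H1HI6HI1HINJL1JI500HHIN20HHH6H1HHHNJ4KIH60HHHHN1HHHH6HHHHHJHHHII'',
 ''@4421MJH121MJ0K116HJH00JKJH11NIJ1H1NI2HH150HHH0M3JHI16HJHH1NJIHI0JKH22HJK0K2H6HJH0HKKLI2HLM20IHN1H1HH5HJ1HHNII1HHN10HHH5H2HHHNI1HHH50HHHHJ0JIIH6HJHHHLJJHJI'',
 ''08411NHHH00MII1H0NJ2HH0N2HIH06HIIH0NHHHH0NJJJ0HMII1HHNH3KHIN0LKHI6MHKHINIIIHH'',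
 ''@0031KIJ200KJJJ20KJJ2H1NI1HI1N1HHI16HHHI1KHJJI1KJJ20HNI1H1HN1HH1H6HHH1HKHJJ1HNI10HHN1H0HH6HH0HHKHJ2HH300HHHN20HHH6H1HHHNI1HHH60HHHHN1HHHH6HHHHHNIIKHH'',
 ''@0431LIJI00LIJ1I0NI1HI1N1HHI16HHHI1MKKII1NJKH1HNJK0HHN10HHH6H0HHHLI2JHI50HHHHN1HHHH6HHHHHIILIHH'',
 ''@8431JI1JH1J1KIH15HHHH0IJHHI1HJ0JIIH2KHII5HHHHHKLIKHH'', ''08431MHHHH0MHHHHH'',
 ''08210KK4000N5I2106IL210NJJ200N51I106I4I10NJ2H1030HI21N4HI116HKI11NJJJ20NJ20H1N2I1H16II1H1NJJ1H1N21HH16I1HH1NJ2HH150HHH1N1HHH16HHHH1NKKII1MJ200HN3H10H6HJ10HNJJ10HN30H0H6H2H0HNJ2H0H60HH0HN1HH0H6HHH0HNIII1HL400II4H30IINJ20HI41J2HHN2H1HH6HI1HHNJJ1HI412HIHN20HHH6H1HHHNJ2HHI60HHHHN1HHHH6HHHHHNHHHHH'',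
 ''@41211HH320KKJ310NI4K116HIH21LMHH11N1K3J16HH0I1LMI0J1L00HI16H2HJ1NI1HJ160HII1N1HHI16HHHI1IIIIJ16HH11HHMI12I6H1H1HNI2H1H50HH2HN1HH2H6HHI2HJKIK0I5H10HINI10HI60H0HHN1H1HH6HJ0HIJKL1JH500HHHL50JII6H1HHIJJ1KIH60HHJHJ2LIHH6HHHIIILKKII'',
 ''08230NHH000NJJH10LJ20H0L3H2J04HJ2J0NHH1H1NI1HJ0N1HHH16HHHH1NHHHI0NKK11HMI1H1HN3HH1H6HJH1HNIII1HMI10HHN1H0HH6HH0HHNII1HHN20HHH6H1HHHNI1HHH42LKIHN1HHIH6HHHIHNHHHIH'',
 ''@0511KJJK20L1H2H14HH2H1IHK1H1KJ2HI130HJI1N1HIJ16HHIJ1MJLHJ1KJJ20HL10H1H4H0H1HIH3H0H30HI1HN1HK1H6HHK1HMJLK0HKJ20HI30H2HIN1H1HH6HH1HHMJL0HH300HIHN10HHI6H0HHIMJ4IHI60HHHHN1HHHH6HHHHHNKLHIH'',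
 ''@86304HHI10JHHH21NIH3I1NI0IJ150HHH1N1HII06HHHH0MMIHJ1M0JJ2I5HHI1HMKJH2HLL10JHN1H2HH5HI1HHKIK2IHN10HIH5H1HHHKI3IIH50HHHHN1HIIH6HHIIHLIHJJH'',
 ''08630MIII10NII2H0NI1HI0N1HHH06HHHH0NHHII0MIII1HMHH1HHMH0HHHN1LHJH6MIHJHNHHHHH'',
 ''08211NHHH00KHL0J1KH4KH1NJJHH1K1KH2H3LIH2HNHHH0HMH30HHN2H1HH6HI1HHNJJ1HHN20HHH6H1HHHNJ2HHH51IHIIN1HHHI6HHHHINHHHHH'',
 ''@8231HMJK10MJLJI0MJJK1I6HH0HHKKK3JIJ02KHH5H1HHHIM3HJH50HHHII5HJJI6HHHHHLHJKHI'',
 ''08231NIIHH1NHH0HHMI1HHHN1HHHH6HHHHHNHHHHH'',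
 ''@0631JIKI20NIIII0NIII1INIK1HHNI3HHH40HHHHN1HHHH6HHHHHHIIIJH'',
 ''@8631LHKHI1K0JHII5HHHHHMLKHJH'', ''08631MHHHH0MHHHHH'',
 ''04630NHHJ20NHI1H1NH1HH1H3III05HHHH1NHHII1NJH10HNJ0H0HM1HH0H0IJI1INIHI1HLH00HHN2H1HI6HI1HHNHH1HHN20HHI6H1HHHNH0HHH41LIJHN1HHHI6HHHHHNHHHHH'',
 ''@L6301HHI20KJII205HHHH1ILHHH15HHH0HILHH0HLH20HHL0H1HH6HI1HHJJI3IHL00HHH6H1HHHJJ1IJH60HHHHJ2JIJH6HHHHHIHHHHH'',
 ''0L630MHHH00NHI1H1NH1HH1N0HHH15HHHH1NHHHH1MHII1HMHI1HHMH1HHHM0HHHH6HHHHHNHHHHH'',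
 ''04631NHH1HHNH0HHHM1HHHH5HHHHINHHHHH'', ''@L6314HHHHHHKIIIH'', ''0L631MHHHHH'',
 ''8L630LHHH00MHHHH1MHHH0HLII1HHLI1HHHL1HHHH4HHHHHNHHHHH'', ''8L631LHHHHH'',
 ''A0101LL4000N5H3006HL300NKK300N50H206H4H20NK3H2040HJ20N5HJ206HLJ20NJJJ20N501I16H41I1NK31I162J3H1N5H3H16HL3H1NLL3H1622HJ1N50HJ16H4HJ1NL4HJ161III1N3HJJ16HJJJ1NIIII1N5011H6H411HNK311H62J30HN5H30H6HL30HNLL30H622H2HN50H2H6H4H2HNL4H2H61II1HN3HJ2H6HJJ2HNIII1H4000HHN500HH6H40HHNJ20HH61I3HHN3H1HH6HJ1HHNII3HH611HJHN30HHH6H2HHHNI1HJH60HHHHN5HHHH6HLHHHNHHHHH'',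
 ''04101JJ4001K5I0003IL001NLL300K51I003I4I01NL4H2040HJ20N5HH016HLH00NJJH00NK20H1N2H2H16HK1H1NII1H1N20HI16H3HH1NI1HH160HII1N3HHH16HJHH1NLKII1NJ200HN4H10H6HI20HNJI10HN40H0H6H1H1HNJ1H0H61HI1HN3HH0H6HJH0HNKKI1HM300HH5H20HINJ20HH41I1HHN3I1HH6IJ1HINJJ1HH411HHHN31HHH6I2HHINJ2HHH60HHHHN3HHHH6HJHHINJJHHH'',
 ''@10311HH000JIJ2006HHH20HHHK106HH0H1HHH3H04H2HI1NI2HI140HII1N1HII16HHHI1MHIIH06HH00HHHH30I4H2H1HNI2H1H40HI1HN1HI1H6HHH1HMHII0I4H20HHNI20HH40H1HHN1H1HH6HH0HHMHI1JH300HHHN20HHH6H1HHHLJ4JHH60HHHHL2JKHH6HHHHHIJIKHH'',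
 ''01031NLH000NHHH20NHH0H1NJ1HH0N2HHH06HHHH0NJHHI1NLH00HNI2H1HN1HI1H5JJK2HNJHH1HNI20HHN1H1HH5JJ3HINJH0HHM20HHH0H3KIINJ1HHH00LKIIN2HHHH6HHHHHNHHHHH'',
 ''H2421NHI210H0KK11NJIH200LH3J1NII0H1J20IH12H1IJ0NI1HI132JHH1N1HHJ16HHHI1NIIHI1NHI21HNK2H1HN1HI1H5HIH1HNJHI1HNJ20HHM2H0HH6HH1HHNHI1HHJ41JJI2I3JIINI1HHH50HHHHN1HHIH6HHHHHNHHHHH'',
 ''@4521JHIJ216HH1H1NKI1H16H0HH1NK1HH120HJJ1H0LHJ06HHII1JJKHI06HHI1HNLJH2I6HH1HHLII0JI6H0HHHLI1KHI50HIIHN1HHHH6HHIIHLLKJJI'',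
 ''H8521NHII10NHI1H0NH1HH0N1HII05HHII0NHHII0NHII1HNIH1HHNI0HHHN4JIIH5HHIIHNIHHHH'',
 ''@94315HHHH0LKIII15HHHHHKKHJII'', ''09431MHHHH0MHHHHH'',
 ''B1031KK4300MHH300MJ2J20N3HK206HJK20NJJK20MJ22H1N3H3H16HJ3H1NJJ3H1L20II14H1II1NJ2HI160HII1N1HII16HHII1NHHII1MJ220HN3H30H6HJ30HNJJ30HL20I1H4H1I1HNJ2H1H60HI1HN1HI1H6HHI1HNHHI1HL201HH4H11HHNJ20HH60H1HHN1H1HH6HH1HHNHH1HH300HHHN20HHH6H1HHHNH0HHH60HKHHN1HHHH6HHHHHNHHHHH'',
 ''04510HH4111NHI311NJ0I20M2HJ205HIK21NHHJ20NI01H1M1H3J04HH2I1NII3I1H21JJ05H0HI1NJ2II140HII1N2HII16HHJJ1NJHJI1NH000HM1H20H0II32INKJ21HL10I1H5H0J2INJ1I2H41HJ1HN1HK2H6HIJ1HNHII1HN200HH6H11HINJ20HH51H3HHN2H3HI6HH3HINJI3HH500HJIN10HJH6H1HJHNI1HJI60HJJHN1HHIH6HHJHINHHHHH'',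
 ''D9411MI4I20M1IK202HKK10NHJJ10LI30H0L1H2H02HJ2H1NIK3H16H1HI1NH4HH060HHI1N0HKH06HKKJ1NHIII0NIJ20HMH2I1HM0II1H5HJJ1HNIJJ1HMI21HHM1I1HH5HI1HHNHJ2HHM00HIH5H2HHHNH3HHH50HIHHN0HJHH6HJJHHNHJJHH'',
 ''A0511HH0000NHH301NH0H20N1HJ206HHJ20NHHJ20NH02H1L3H2H14HJ2H1NHH2H1N10HJ16H0HJ1NH0HJ130HJI1N1HIJ16HHIJ1NIIIJ1NH001HN1H30H6HH30HNHH30HL30H1H4H2H1HNH0H1H30HI1HN1HK1H6HHK1HNIIK1HN100HH6H00HHNH00HH30H2HIN1H1HH6HH1HHNII1HH300HIHN10HHI6H0HHINI1HHI60HHHHN1HHHH6HHHHHNHHHHH'',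
 ''A8321NJL200MH4H202HKJ20NHIK10MH40H12HK2H1NHI3H0N11HH05H3HH0NI1HH040HJH0N1HKI16HLII1NHIII1NHJ20HNJ2H1HM1HJ1H5HJI1HNIKI1HNJ20HHM1H2HH5HJ1HHNIK1HHN00HHH5H1HHHNI1HHH50HHHHN0HHHH6HKHHHNHIHHH'',
 ''L9421NIJJ10NIJ2H0MJ1HH0M2HHH05HHHH0NJHHH0MLII1HMLI1HHML1HHHM4HHHH5HHHHHNLJJHH'',
 ''H4521NHHH00NII1H1NI1HH1N1HHH16HHHH1NHHHH1NHHI1HMJ20HIM2H1HH5HI1HHNII1HIM20HHH5H1HHHNI1HHI30KHJHN1HHHH6HHHHHNHHHHH'',
 ''D8611NHHI21NIHHH1MI0H1HL4JJ0H6HHI1HNHHI0HMJ00HHI3I1JI5HH1HHNII1HHN10HHI5H0HHHNH1HHH03HIIHN1HIHH6HHHHINHHHHH'',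
 ''HL521M0HHH14MKHI0NHJHH0MII1HHMI1HHHN0HHHH5HHHHHNHHHHH'',
 ''A0631NHHH00NHHHH1NHHH0HLH00HHL2H1HH4HI1HHNHH1HHL20HHH4H1HHHNH0HHH40HHHHN1HHHH6HHHHHNHHHHH'',
 ''A8631NHHHH1NHJ1HHNH2HHHN0HHHH5HJHHHNHHHHH'', ''8L521MJJHH0MHHHHH'',
 ''@9111KL2K005HJK20MKIH00KL00I0K4I0J05HJ2H1LJJ2I05H4HJ1LJ0HI050HJJ1M3KJH06HIKJ1LJJKI1K4L00I5HL30HMKH11IK41J1I5H3H2HLJ3I0I50HJ1HL2IJ1I6HKK1HLJIK1H5H30HHMK22JI50H3HHL2I0JH6HL1HHLJL2HI500HHIM33KIH6H1HHHLJ2HIH60HHJIL2HIJH6HHHHHKKHIIH'',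
 ''0L510KHK300NI4H106HJI10NIKK20N1H3H06HI1H0NIL3H1N00HI15H1HI1NI4HI150HHJ1N1HKJ16HJJH0NHIII1MJJ20HMI2I1HN2IJ1H1JHK2HNHKI1HNJ31HHM1I1HH1JL0HINHI2HHM20HHH6H2HIHNH2HHH60HIHHN0HIIH6HJJHHNHHHHH'',
 ''04511NHHH00NIH1H1N1HIH15HHHH1NIHIH1NH0H0HM1HI0H6HHH0HNHHH0HNH00HHM2H1HH1IK2HINHI1HII41HIH5H1HHINJ0HHH60HHHHN1HIHH6HHHHINHHHHH'',
 ''@L5111HLH00KLLI206HJHI1JIIKI16HJJ0HJIII2H4HI1HIKIL3II4H1HHHKI4IJH60HHHHH1KHIH6HHHHHLIKHIH'',
 ''0J611NHKJ00NHHIH0NHKJ0HMIJ1HHMI1HHHN0HIHH6HJHHHNHHIHH'',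
 ''04131NHHHI1NIHH1HNII0HHJ41KJH2I3KJINI1HHH21LKIIN1HHIH6HHHIINHHHHH'',
 ''@2631JHJKH1JHJK0HLJL3JH5H0HJHLH4KHH40HHHHN1HHHH6HHHHHLIIKIH'',
 ''H8531NHHHJ1NH1HHHN1HHHH5HHHHHNIHHHH'', ''@L531JIIJJ05HHHHHIKHIHI'', ''0L531MHHHH0MHHHHH'',
 ''8L510IIJ301II2H20L3HH004HJH00NJJJ20MKK2H1MK3HI1N1HJH16HHJH1NHHIH1MKK20HMK3H1HN1HH1H6HHH1HNHHH0HNJ20HHN3I1HI6IJ1HINJJ1HIN31HHH6I2HHHNJ2HHH40HHHHN3HHHH6HJHHHNJJHHH'',
 ''H6521NHH0I1NH2HI1N1HHI13JJKJ1NHJHI1NI2H2H4HHI1HNHHI2HLI10HH6HI0HHNHI1HIN10HHH6H1HJINH1HJI25JHJHN1HHHH6HIHIINHHHJI'',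
 ''DL630NHHI20MH2HI1M0HII15HIII1NHHHI1MH2H1HM0HI1H5HII1HNHHH1HNH10HHN0H0HH4HI1HHNHH0HHM00HJH2I4HJHNI1HHH21HKJHN1HHHH6HHHHHNHHHJH'',
 ''4J611NHHH20LI1HI1NIIHH0MJJH1HMJJ1HHMI1HIHM1HHIH5HHHIHNHHHHH'',
 ''8L511LJJ1HILJ2HHHN1HHHH6HHHHHNHHHHH'', ''08331NHHHH0NHHH1HNHH0HHMI1HHHN0JKHI6KHKHINHHHHH'',
 ''0L331MI1HHHN0HHHI5HIHHINHHHHI'', ''DL631LH1HHHL0HHHH4HHHHHNHHHHH'', ''8L531MHHHHH'',
 ''@0731LHKHH1LHKH0HLHK0IHLH3JHH20HHHHN1HHHH6HHHHHLHKHHH'', ''@8731MKIHH1N1JHII5HHHHHNKJHII'',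
 ''08731MHHHH0MHHHHH'', ''D1631NHHJ20NHHII1NHHI1HNHH1HHNI0HHH40HHHHN1HKJH6HHJJHNHHHHH'',
 ''@L7305HHII1KHHIJ05HHI1HKHHI2I6HH3HHKKH1HH6H0HJHKK0HHH40HJJHH1KHJH6HHJJHLJJHJH'',
 ''09331NHHHH0MHHJ1HMHH2HHMH0HHHN0HHHH6HHHHHNHHHHH'', ''04731L0HHHH4IHHHINHHHHH'',
 ''@L7314HHHHHKIIIJH'', ''0L731MHHHHH'', ''8L730MHHII1MHHI1HNHH1HHNH0HHHN1HHHH6HHHHHNHHHHH'',
 ''8L731LHHHHH'',
 ''11111KLK301LL3J20L5JJ213HLJ20NJLK20LK31H1N4H3H14IK2I1NLJ3H1L50HJ14H4II1NJ2HJ132HKI1N3HKI16HJJJ1NILJJ1KK401HL3J30H4JJ21HNML30HL41H2H6H4H1HNJ4H1H40HJ1HN5HJ1H6HLI2HNLKK1HK501HI4J40HINL30HH41H3HHN5H2HI6HJ1HHNKL1HH301HIHN30HHI6H2HIHNM1HHI60HHJIN1HHIH6HHKIINHHHHH'',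
 ''8J301KKK300IK1H21I3HH203HHH00NMHH00NJI2H1NL1HI1N3HJH16HJJH1NJHJI1NJK10HNK3H0HN4HH1H6HKJ0HNJKH1HMJ21HHM2I1HI6II1HHNKI1HHN20HHH4H1HHHNK1HHI40HHHIN3HHHH6HIIHHNHIIHH'',
 ''8J321MI1HH0L1HHI04HHHH0NIIHH0MKHI1HMHJ1HHMI1HHHM2HHIH5HIHHHNHHHHH'',
 ''14511IKI301II2H20I5HJ011HLH10NJJJ20MIJ1H1MK2HI1M2HHH15HKJI1JMIJJ0MJJ20HMK1H0HM4HI1H5HII0HJILK2INJ20HHL3H1HI4HJ1HHNKJ1HHL30HHI4H2HHHNJ2HHI60HHHHN1HIHH6HHHHINHHHHH'',
 ''D9231NHHH20LH1HI15HJHI1NHJIJ1L0HH1H5HHI1HNHII2H4HI1HHNHH0HHM00HJH5H1HHHNH1HII50HHHIN0HHIH6HHHHHNHHHJH'',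
 ''BL1316HIHJ1NHIHI16HIH2HNHIH1HN0H1HH6HJ1HHNHI1HHL10HHH3H1HJHNI1HJH30HHHHN0HHHH6HHHHHNHHHHH'',
 ''12631NJIHH1MHJH1HNKI0HHNJ1HHHM2HHIH6HHHIHNHHHIH'', ''BL531NHHJJ1N0HJHH5HHIHHNHHIHH'',
 ''8J721MHHHH0MHHJHH'', ''03631NHHJJ0NHHI1HNHH2HHNH0HIHM0HHHH6HHHHHNHHHHH'',
 ''@M5311HHHI1IKHHH05HHHHHHMHHHI'', ''0M531MHHHH0MHHHHH'',
 ''45511NHHJ20LKH2H1NH0HJ1K1HJI16HIIJ1NJIJI1NHH21HLH2H1HN2HK1H3HHI1HNIII1HNH00HHK1H2HI6HI1HHNJI2HIN20HHI3H0HIHNI1HIH20HHHHN1HHIH6HHJHINHHHHH'',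
 ''49311NHHJ20MJH3H1MH1HJ1M1HIJ15HHKI1NHHII1LJH21HLH1I1HK2HJ1H3HII1HNHHJ2HLJ20HIN1H1HI4HI1HHNHH1HIL20HHH6H0HHINI0HHI20HJJHN1HHHI6HHIHINHHHHH'',
 ''DN701MHJJ200MIJH1NHIIJ10MIJ0HNHII2H2HK3HHNHI1HHN00HHH5H4HJHNH1HHH50HKJHN0HHHH6HJJJHNHIIHH'',
 ''8N720LII1H06HJJJ0NHKKJ0MIII1HMHI1HHMI1HIHM1HHIH5HIIHHNHJJIH'',
 ''83631LII1HHLI1HHHL1HHHH4HHHHHNIHHHH'', ''4L711MHHH1HMHH1HHNI0HHIN1HHHH5HHHHINIHHHI'',
 ''0N711NHJJ0H5HHHHINHIIHH'', ''8K631MHHHHH'', ''8J331KI1HIIK1HHIH3HHHHHNHHHHH'',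
 ''DL731M0HHJH3LIIHHNHHHJH'', ''8J731MHHHHH'', ''@N7313HHHHHJIHJHH'', ''0N731MHHHHH'',
 ''LN721NHHHI1LH1HIIL0HHII5HHHHHNHHHII'', ''8N731LHHHHH'',
 ''55511JJJJ20MJL2H1JJ2HJ1M2HIJ12HJIJ1MIHHH0JKJ30HMM2H1HJ3HK1H5HIK1HMHHI0IJJ20HHM2H1HH2HJ1HHMIH0JIJ30HHI5H1HHIMH0KHH20HHHHM1LIHI5MIHHHNHHHHH'',
 ''|N701IHIK00NJJJH1NJJJ0HLII1HHNH4IHHN0IKHH6JHKHHNIIIHH'', ''|N721KHHHH1MHHHHH'',
 ''|N731KHHHHH'',
 ''C1031KKK300KK3H20K3HJ203HJJ20NJJJ20KK30H1K3H2H13HJ2H1NJJ2H1K51II13I4II1NL4HI131IKI1N4HKI16HKKI1NIIII1KK300HK3H20H3HJ20HNJJ20HK51I1H3I4I1HNL4H1H31IK1HN4HK1H6HKK1HNIII1HK511HH3I41HHNL40HH31I3HHN4H3HH6HK3HHNII1HH300HHHN50HHH6H4HHHNL4HHH60HKHHN4HKHH6HKKHHNHHHHH'',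
 ''18311IJJ301IJ2H21I5HI101HLI10NJJJ20MII2H1MI1HI1N1HII16HHII1IKLHH1NKK10HNK3H0HM4HH0H5HKH0HIHHI2HLJ20HIL3H1HI4HJ1HINII1HIL30HHI4H2HHINI1HHI40HHHHN3HHHH6HJHHHNHHHHH'',
 ''18331KI1HI1NIIHI1NJJH1HNJJ0HHMI1HHHM2HHHH5HIHHHNIIHHH'',
 ''A0731NHHII1NHHI1HNHH1HHNH0HHH20HHHHN1HHHH6HHHHHNHHHHH'', ''A8731NHHHH0N0HHHH5HHHHHNHHHHH'',
 ''18731MHHHH0MHHHHH'',
 ''E1631LHHJ20LKH3I1LH2IJ1M1HKI15HHIJ1NHKII0LKH31HLH2I2HM1HK1H5HHI2HNHKI1INH00HHL2H1HH5HH3HHNJI3HHM10HJH4H1HHHNI1HJH20HJJHN1HKHH6HHHJHNHHJJH'',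
 ''83511NIHJ20LHH2H1NH0HJ1L2HKJ14HIII1NIIII1NHH30HLH0H1HL2HJ2H4HIJ1HNIIJ1HNH00HHL2H3HH4HI1HINJI3HHL20HJI4H1HHHNJ1HJI20HHHHN1HHHH6HHJJHNHHHHH'',
 ''87521MHK1H0MH3HH0J0HII11HHHH1NHLHH0NIII1HNHI2HHNH1HIHM1HIIH5HIIIHNHHHHH'',
 ''14731LII1HHLI1HHHM1HHHH5HHHHINHHHHH'', ''45631NIH1HINH0HHHL1HIHI4HHHHHNHHHHH'',
 ''AL7314HJHHHNHJHHH'', ''1L731MHJHHH'',
 ''9L730HHHI10MHHHH1MHHH0HKHK2HHKH3HIHK3IHIH3IJHIHNHHHHH'', ''9L731LHHHHH'',
 ''CL531KHLK20KHK3H13HHHI1NHKKI1NHKJ1HNHJ2HHNH2HHHN0HIIH5HJJHHNHHHHH'', ''99531MHHHH0MHHHHH'',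
 ''35131JKKJ20JKJ2H1LJ4HI1L2HKJ12HKKI1LIHJJ1JJJ20HLM2H1HJ4HK1H4HIK2HLHHJ2HJL40HHL5H1HH4HL1HILHK0HIJ50HII2H4HIHLM3JIH20HKHHL5JJHH4JLJHINHHHHH'',
 ''55631HHLK01NHKJI1NLHI1HLHL3JHLM0JJIM2HIHH5HIHHINJJHHH'', ''2N331MH1HHHK1HHHH3HIHHHNHIHII'',
 ''LM531NHHHI1LH1HJIL0HHII5HHHHHNHHHII'', ''|M531MHHHHH'', ''83731J1HJJH2HHHHHNHHHHH'',
 ''BN7310MLHHHNHHHHH'', ''2N731MHHJHH'', ''67631LHIJJ1LJHJ2HKII1HHKI1HHHM1HIIH5HHIIINHHJJH'',
 ''|M731LHHHHH'', ''@O7311HHHHHKMHHHH'', ''0O731MHHHHH'', ''CN7313HHHHHNHHHHH'', ''8O731LHHHHH'',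
 ''93731NHHII1NHHI1HNIH3HHNI0HJHL1HHHH4HHJJHNHHHHH'', ''3N731MHJJHH'', ''|O731KHHHHH'',
 '';K331IJJII1IJII1HIII1HHIJ2HIII2HIIH1HIIHHNHHHHH'', ''=M731LHHHHH'', ''>O731JHHHHH'',
 ''?O731HHHHHH'']"

text \<open>Each string describes a graph on 7 vertices: six characters for the graph, two for each candidate
  zero forcing set (the first one belongs to the graph itself), and then words. A word consists of
  the name of a table, seven vectors of the table, and vectors for a new vertex; all vectors of the
  table are tried if there are none. A word that starts with an exclamation mark maps an extension
  to an exceptional graph.\<close>

definition certificates_1 :: "string list" where
  "certificates_1 = [
 ''@@0000O7O3O5O6G7K7M7 A00000000 B11111100 B10111110 B11111010 B11011110 B11110110 B11101110 B01111110 C9G999G90 CG99GG990 C7GG8GGG0 CGGG9G990 C4G44G4G0 C999G9GG0 C444GGGG0 CG4GG4440 CGG99G990 CG44G4GG0 CG9999G90 CGGFGGGD0 CG5GGG2G0 CGG99GG90 CGGGGG310 C44GG4G40 C444G44G0 C99G99G90 CGGGFGDG0 C44444G40 CGGG13GG0 C4GGG4G40 C44GGG440 C9G999990 C44444GG0 C9G9GGG90 C99G999G0 C9999GGG0 C9G99GG90 CG4444440 CGGGG25G0 C9G99GGG0 C44GG4440 C4G44G440 CGG9G9990 C9GG9G9G0 C999GGG90 C999GG990 CG4GG44G0 CGGGG9990 C4GGG4440 CGG444440 CG99G9G90 CDGFGGGG0 CGG9999G0 CGGGBGGE0 CG9999GG0 C9G9G9990 C44G4GGG0 CFGGGDGG0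 CG99GGGG0 C4444G440 C99G9G990 C444444G0 C9G9GG9G0 CG9G999G0 CG444G4G0 CGDGFGGG0 C999G9G90 C9GG9G990 CG4G44G40 CGG9G99G0 C99GG99G0 C44G44GG0 CGGG444G0 C4G4GG440 C99G99990 C9G9G9G90 C4G4G4GG0 CG9G99GG0 C3GGGGG10 C9GG99G90 C444GG4G0 C99GG9GG0 CG4G4GG40 CG999G990 CGG99G9G0 C4GG44GG0 CG4GG4G40 CG99GGG90 CG44444G0 CG4G44440 CG4G4G4G0 C9999GG90 CGG999G90 CGG4GG4G0 C9GG9GG90 C9G9999G0 CGG60GGG1 C78GGGGG0 C9GG999G0 CGG2G5GG0 CGG4G4G40 CG1GG3GG0 CG9GGGG90 CG999GG90 CG44G4440 C9999G9G0 C99G9GG90 CG4GGG440 CGG999GG0 CGGG44G40 C4GG44440 C4GGGG440 C9G9G99G0 C4GGG44G0 CG999GGG0 C9G999GG0 C99GGG9G0 C9GGGG9G0 C999G9990 CG9G9G990 CG99GG9G0 C44G4G4G0 CGG4GG440 CG44G44G0 CGGG99990 C44GGGG40 CGGGGEGB0 C44444440'',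
 ''@@0001O3O1O2G3K3M3 B11111000 CGGDGGFF0D CGGGGCAA0C C0GGGG6601 CGDGGGFF0D CGGG8G7708 DnXnXXSl04K DXnXXXhd0AH DCnCCnI2014 DnEEnEGV03R DnXXXnlO03K DXXnXXSl04K DZZnnZmN149 DnZnnZNA124 DnCnCnA6017 DCCnCnA2013 DnnZZZN0124 DEnEnn7F056 DnnZnZA0123 DEnEnE7F056 DCCCnnFA015 DZZZnZm0129 DCnnCn2I014 DnEEEENG034 DnnEEnf706J DZnnZZAb12K DnnnXXhU0EH DCCCCCI2014 DnEEnnG7036 DXXXXnSh04H DXnnnXla08K DEEnnnV706R DnnnnOWXKS DnnnBnF359 DZnnnnba8K DnLnnnFWBK DnnFnnBE37 DCCCCCAA1 DZnnZnbbK DEnEEEVVR DnZZZZbbK DncnjnNN4 DnCCnC88Q DninnYOO3 DCnCnCAA1 DnnXXXllK DEEnnE776 DCnnCC88Q DEEnEEffJ DnEEEn776 DMnWnnRR2 DCCCnn88Q D1AnnnPP9 DnnFLn55D DnOWnnNN4 DCCCnC667 DCnnnC88Q DnXnXXllK DnnnLkaa8 DZnZZnBB3 DXXnXnhhH DnnCnCOO3 DXXXXnSS4'',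
 ''@@0021O1G1K1M1 CGGGG44909 DnnnkLac0158 Dnn3nDOJ026C DLnnnF5a08BD DnUnnPgX01HO EWeWWRYF023DEHL E555541k29GIKjo Fe6667230145AOP EEEeeVxX248FILZ FXXXeIMd1256FHZ Ee55eA4826GKNPd EOeeODV5123EFGR Fee99K8S0145LOP FXXeXTNY129DHLQ Eeded9HN03467CJ E5e5eMJ8269IKNd EEEeERJTW Feaae1J35 E666eEEZT EXXXXTTYH FFeOe55VJ FeXXXT8S9 Ee5e533OQ EeefGVHUK EXXees4dj E0e00TTOW ENeeNrgXT'',
 ''@@0421O1K1O0G1M1 CGGG999404 DnnUXXXE07 D0nnZZZQ18 DnbnZZZU1E EeQQOdWK01458FMN E88eNXdF01269ILW ECCCO05H1239BEGP EFeF538T016BEKXr EeeWdOQF035689 EKeea9HL127ABG EeYeLbSR1279GJ E555OOC1BI ETTTWWWgJb E3338F8gKN E333QEEf0G EWWeZFFM25 ETTeEE0Z16 Ee00EET916 E6e6EQEN0J Ee338F8EKX EOOedWdP8H EeTTEXXg4N EdedXXNQ0E E5e5OCCk6j'',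
 ''@@8421O1M1O0N1 CGG9999C0A DUnXXXXb0K DnlXXXXK06 EddWQOQN0136ACFJ ENN6C6ZX0259ET E66CCZZQ09KO EeZCC6NK28AM Ee38F55E2GKX ECe0O5O6139E ECC0OO0Z9BEW EdeWOWQH036C'',
 ''@08421O1N1O0 CG44444205 DaZZZZZL15 EdXXX8NW36FJ E35F8FF904KN FNXTXXXJ9H'',
 ''A?0000M3 C414444403'',
 ''@@0101O2O0G2K2M2G5G1 CGGGDDFF0DF DnnWPPLL015W DannkkLL05Ya DnKnWWQQ01KL DnnnjjeN04 DnnnbXUUKO E555m7MA269BINgiu FeXXIYMS12569ADHL ENeNLgAV0234DFGSm FWWeMRJY01459BDHL EeeNVAPL245BDFHS EeNeAVJg1235DEGm F9eeCK8H034567MO EeeeBSbwLPnp E4GeSS117Iw EeFFLIVVDJK EPebUUBB126 EEEEDDRR27Y EeEEJJ1V5AI EeMeX5441S F9e9SSIA4O EeHeff3G4w Faaa112J57 ELeeNFVVGJ FeeWddTF0H EfeeHH3T9a Feec1YLL7R F9998QKK0Z ETTefaHH39 EEEeVVGxFL EFeFVSIIJX Ee6622UUG'',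
 ''@@1021G1C1E1K2G0K0 DnnLLF5k0BDJLYa Dnn88CCj2 Ee4GG1Sf0237EFHIw EJeMMIVW0246DFHQU Eee6GU2E1347BCFf EeeqqosJ1I EGeRREE20 FeBUU66G3 G..4NoOJ GJ%sm+RV1236HKMOUZtvx, G%,Ae8DS01256BFHIOagk&- GMMUUsOu19HKYny H%%Dy5nR6CUf H#%U;uuOGMcj HzzY$U#-HKO G%f6sVYa0J HUjssMVOG GttYx!vhI G%-GqFlbp'',
 ''@08410G1G0C1E2K2 DnCCCAA101DP EeG14SSI2579AEHMf ErTTTggN0136AX FeaaaZ267DEW Ee6762293 EeXXYssqE EehEEoosX G-uJuyNo G.KK6HAF0159LMQZajlp G%K,9AL01268DFJNQTXY G6M&&V8Y1247UWZbgi+, Go30NVVU2ACDQf'',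
 ''PAK000K1K0J1B3J6 DFECEEFE025C EVOHOOdO89EG EBIUOOBO29 EYWHWbYW9B F890C98936 FOWSWWOF0D GUY,fVUs0358ADGILNPS G36$6.HK14BGNUZw G/7WJ.Y.019IRZfj'',
 ''@@0411O0K0M0 Dnnn0DeO124CLi Fee7BA650349IKNRS E9eeIa2K45678BCLO EeaeI9SK023456DFG G&&&zVX60237BCDEFGHRWal G--%yJSq01259BHORTUax G%&&g4yb0379CEHJRScru GJ%J+s4V123568HKOUZvx Huuu-yk53'',
 ''@@4421K1I1G0 DnnaZZBL1358Fk Ee9w00K34678BCf EHeaTTfK148ADEw EeejHd9U78 G&&4wgi1 HX%slc.W01247FHKo$ G%N,pmV71BFGKRZabx G..YKKA79LQZcp G--Y6h=Wj'',
 ''@08411O0N0 DnEEENfH045HJh Fcaaa1bL567BDE FeWWOFTc2G EeHCCajB37 Fe6N63EO1G H.h66AYB19LMQRZp Gyuu#U5$CDFGINim G.K6KHOG059MZaj;'',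
 ''HD2510G2 DEEEfLEF05BJPQ FU66BJ6MPb F99986KQ4M ENNJrYNb1M EEDEhWER7O'',
 ''@@0031O3G3K3M3 B11110000 CGG6G0001 CGFGGDDD0 C2GGG5550 CGGG52220 DnCCC2FI0145 DCCnC68F057Q DCnnCFO20135 DnCnCIA60147 DEnEEG7V036R DCnCn8IF045Q DZZZZbma189K DCCCnIFO0345 DnCCn2O60137 DnnZZbaA128K DEEnnN7f046J DEEEE7N76 DCCCC66I7 DnXXXaaa8 DZZnZ0aa8 DZnZZ0002 DCnCC22A0 DEEEnfNN4 DCCCnIOI4 DEEnEFFU5 DXnXXSaS4 DnXXXSSU4 DXXXXdUUE DZZZnbbbK DXnXXUOO3 DEEEnffUJ DXXnXdddA DnXXXdSS4 DEEEEfffJ DCCnC6867 DnZZZmBm9'',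
 ''@@0431O1K1M1 CGGGDFF40 DnAnP11Z029 DnnWRMML025 D5nnFLLD02B EOOOIBV012369EFGTw E66eBIU30159GJfw E5e5MmJ3269KNQgi EeXXsYId129DHQjo F555FCCA69 F6667BMEA E666M7IEJ'',
 ''@@8431G1E1 Dnn5FLL607 EeBUbPP70259GL EbeLYSSP02ADHO G,,mNLp:345BIQWahwx HzzYW--QC'',
 ''@08431G1C1E1 DnEEEF7X0O EaTTTHHJ12 GYEir!!u29MQS;'', ''DB1720G1 DZZZFbZA25'',
 ''@08210K0C0I0E1E0 FeVJENI6 FeZdWWEbFMOU Fe99ASKD8BCI GAV2Dc9, H%$OU#-201GTWjk; G%VNMsm+GIRartv, GRttam/zHKhp: HfqA995WIJK= GUEB2d7MA Gkuuggjsq JB,K01J3 I-j42vi9ABDJk/ I6H0dL3Q19MR IB1R,L3XM+'',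
 ''N00001N0D3L0D1 EIM555JF ETWdddWXFJ G3DYi#5h HA-zYz.07PQSbh, GrMUoOM16TWtu,. GsV99Afh0GIJLT; GX3KKK.sGJVf HthA66KVHMRd I25A#m0S79DHXehx$-: IUz512b0f'',
 ''@@4121G0E0 FeeSOA5I H%5Yf0Au Gi%Ys!kT JKKkPVI. Itt4i=,ABDFYr'',
 ''@08230G0F0 Ee55MJCH GIJJsNwh H%RsPfg.06CDGHKQTct= JE123;kJ J132+90KIJPYv'',
 ''P08430N0 E9000KXI G;66faA247BMPTUWju G-hYh6IN157CQVZmuv G-YuuJfA018CDIMTch'',
 ''@@0511O1K1M1 CGGGBFED0BDEF DnnPU1gA0CDEH DnLna5kF08BDY DWnnMORN02347 DnnNZEZE07 DnAnZCZC02 DAnnCZCZ02 EFFeI3S5016BDEJXYw EeTTagHr13789AJLNPb ETeTgHra13789AJLNPb ETTTgarH13789AJLNPb E666MZIZ9K E333FwF92S EEEeo6q62 EOOOQ0Q0E'',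
 ''@@8630O0M0 DnnD3O5L0259CFHP E1eBD7w90268AIKOPRZfp EeP4cAjV01259CDEGJXks F0e8XXKaS EegrTTNb0 G&&VZzM5 Hzz$W-Ua46:'',
 ''@08630K0 Eew19JBU G41oOU+J H2V0zzAB3JXbg Hguuq-GVF'',
 ''PHL610G0E1 ENNLbNHC012379Ba HpV99FlN06EXbn'',
 ''@08211K0G0 FecIXXaN EeXXcINO2BDR G299WTqC Grf477xj59JOVZloy$ G%f63VRk49KM !IH0K0JI !I0LH0JI !IH03KHI !I0L0KHI'',
 ''PH8421M0E1 EYMWWWFX H66VA02O1BCPQSUegipqs#, HhU99K/n3E GeDgcgu12b Gdyo--W&cx'',
 ''@@8231O0M0 DnnAP1ZT29CD FIeVFOMc01347ADE EeS41GXw0235678A Gggk!e7R H99TfW=B7.'',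
 ''@08231K0 EePA4cNl0129Bo GOU1o4KN GAGFV0.QU'', ''DD1710G0K0 EFIFM8SF014679 HcIb9-sH04BEFp'',
 ''@@0631O2K2M2 CGGG447A0 DnnMWRIm0 DnanXX880 DLnn5FaP0 E888Kax501279ABDELR Ee667BNE0458JO EFFe35ST67BXYr E6e67BEZ0459OT F5554100KN'',
 ''@@8631O0M0 DnnPA1TY0 FeIVFOJX47H EKea889M6AE GuunQZYj2346ADFH/='',
 ''@08631K0 EeEE3QhC2C GlishhX4015HJr'', ''808421F1 FOWWWUb701'',
 ''P08610G0C1F0K0 E6QQE6WU Hf77BUNV GMUsdMYv Gy--3ol#J I324x0km9ACEFINRaopw!%, Iq0p4YnbP'',
 ''@04630K0 Ee4cPAK9 G$UHynVG HKhsQZ9iHJLNb+, G#YUuuilJM'',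
 ''P08630N0K0C1 E6ZZNC9I EOCC55NV1F G!iYErTF G#YmvI1F0Eqy+'',
 ''@@L630O2M2G2K2G3 CGG44478078 CGG444999 DAnCCC1P09D DnUEEEgP01H DnnFL5dABDJ DnOCCCXXS DOnCCCXXS E66E3QUB0145GKOPdfjpw Ee9aKH1w8ACLMP EJeMVIrR46BFHf E005OCTTFHW EWWQOQbY3 FJMWWW55Q EEETXXQ64 ECC00Otj9'',
 ''@0L630M2G0K0E3 Dn0ZZZDO1234CD EBU666PO048GVWj EeRcYDrg14AHVb EAJ555NPV Gi!rYEc;1468CJQSp$ GfUsaRu5L,'',
 '';B1400F1 EgO5T00C Eb55B71529EL'', ''AZ8021M0E1 E3O535F619BDGKN GsEUVYfk5ALOXmoq&+,-'',
 ''@04631K0 EeYcRDst019GH G3oVN0yk19BEHcev,'', ''P08631N0 EXddN89M7ABEF GrEB77dm09'',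
 ''@@L631O2M2 CGG9995A0 DnaXXXLL0 DInCCCMM0 ETTWZFfX1246Jcu'', ''@0L631O0 DnAZZZP52 EK9000Hu16m'',
 ''9?0000D3 FaG035559B'',
 ''BHK211I1M0E1J2 ECOV05N0 EWTHFZMZ235NV E36NQQ8E0JOXx E9K400c0H GpkSV!,F23Hiqv'',
 ''@8L630O2N2G2G3 CG999952025 CG4444999 DOCCCC3D049 DnCC2CgH0 DFEEEECC2 DnCACCm91 DnVEEElKR DnEEEF4J5 E0OC559K67B EE336QRx57K E3QEEQ55DK EWdOdObU08'',
 ''RHK211M1K2 DXdAXX1X01ADMP E8365FU5GKLX EXd98X2N56CF'',
 ''o00421N0 EZ8533F012Ba Ep505COK6 E5XETX0hH'', ''@8L631O2 CG44447C0 DmZZZZYl1'',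
 ''C?K000K1 DXWIXXUX0'',
 ''08L630O2G3 C99999DF0DF C99999444 DCCCCOVa3 DEUEEElcI DXXUXXj9E DEEENER24 DbZZZZhfK'',
 ''08L631O2 C444442A0'',
 ''@A0101K2K0E2I2E5E1C2 DnjjccNN0148Ncj EKVVMMHH1357EGIK FeLLRRBY679DSc EeAFLL2234GNSt FeCCQ5FF0136KW GMUNs2Vd H%#xv$!y GuffqYv503679APTX& GMOV2sUU19BFGHKYn GuUvYYf#167CDITe G%VVcY!D26Co H%q!#p++5Fr$ H%#3$$+04Vz! HsJfVVYY6D G.GGFFHA0j GFkk!jVVgs GJYG0sLVZ'',
 ''A@1021E1J2A1B2E0F0 FJJVVNEI EAAggNNm6JV GUUM9V2, GMJssVN+ GddIINs#UYZmou H,J==77R48 GssQHKKb6A JQIPV5CK IH;fGzD024FPVdhi%, J007IAK215VXdr; Ij344Ji107BD: JI1n2V5tA%+'',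
 ''@04101K0C0E1I0E0 EeJIVVEO EeDOccRpB EeExVVDL1 GINdssJb G%Af96K; H%Ysii5GDM G%DgVRz!2 GEU7BBd8j HftxvvpPK I7LA+01i I7L10+A2BKMPVWabd,- I61&yD5S2Xhm J;8X7&z3BO'',
 ''P08101N0F0C1C0J1 ERWWJJME GYfsWWP- Hf99;VFQ3CJLMOZajklnu# GYttvvjn5HK GN.3oo4M7 H$WwTTo.3 JPg-0SaO JQxTS3eO05BDFmu'',
 ''@@1031G3E3C3G1K2K5 CGG11333013 Dnn33DJB02F DnONNWWW04K DNnccjjj018 Dnn3AGGG19 DnnYYOggH DnnbbiKiO Dnn00DDe1 E55AM7mJ269BGIKNPgiu EOeIDcBV12469EFGRUh EeWRMJYU12456BDEHLo Eee3d8QH56NOfj EEEVVoxDFKLk F663QZZNKOd F663QNZZKOd FaaIbcJc4FG E667I2229AG EeKMMVVUE EebPPNBB1 EetAAa2aB FBeIIF6F0 EVeggGGN1 EXe4Yscc9'',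
 ''@01031E3D3A3K1E1 DnL55FFH04BDJ EKHVVMML12357EFG FeZEE6dV023FIKW EeVojkks14CEHq EeCjjHHUG G-o3dyNb G-FlAqGh2BEIQXp G%1YOUet2ESW HLc;;llDN. GCYzzTUZ7'',
 ''5H2000N0H3M0 EVBPUPBb E4wf3fH30157K H&aCD6aR35EFKOPQZbjl Gb6303NV2ILQRaj& GTOsK.HK4BFMRabo'',
 ''@H2421K0C0E0C2E1 FeMIXYcV GEUdhYi2 G%zTYEiF257LPVm. IE231jRw I&103RHnc='',
 ''PD8421M0G0 EIM66BUV GfY6V3DT29CFGHJNQco= GUsYhEIM1LTmruv! GdthhilMr! H,i99=TX8S'',
 ''@@4521K1I1G0 DnnLWWR5025DF E4ejssXP02BCHN EeAgmm5N0689GV Eee9305a6QTX G&&8e4wM HV%2Gjo05Xer H%4l&oE.5GT= GUlE$$jh3DQ'',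
 ''@H8521K0C0 Ee26IUML HUasddjC035DIJNQST&/ Grpt!fY,3Aco J0d2!IsH8VXb'',
 ''b88420I1 EDVpOOcn H-$-z.YfBQl,'',
 ''@@9431O1M1 CGGCCAA601 DnAPP11C02 DMnRRWW706 E339fwH6247ABNPSUb'',
 ''@09431G1 Dn3DDOOd2A EUG22RRM0145'', ''PLL211G0 EXIsXnuc1G'',
 ''D02410E0B2A0B0 GNLOK,sM GYf6;u6- GB7U4.1H28EJgjl G74f3.8B1JUg HfRsOtUYP I1/kJ3KM I=d.04MZKLnp!#%, I5zmk4g0BJNRo P74061253 P47051263 P47251063 P74261053'',
 ''@B1031C3B3C1E5A3E1 DnF5aLLL08BDJLk DnCCJ2226 FeSAKD9412578BCIMPVY EPHV4jjj013CDGkst EeaIbJJB5AMN FeKMGVUVDEIN EeS1fGww039n Ee55tCA8034 EeEonhhhXs Ea88Cttt3 G9K,VUpA HCEUToYY01247ei G%s+7QMJ14GUZr G&1468O807BEIU G9fq,AAp056Db-'',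
 ''AI4500D3E4D2 FHIK9MKV F37C56C62IN GfFSTB8A GMpO2tdt6KRabhr GQUkusZV1CDHKe Hs,OXIOk38LWpv HNRV!gVs06Ut GYwsTVCUIJK Iw9X5ag-Fmy:'',
 ''PD1021E0J0A0B0 HA,88f70 GVscc2OgNYiq! G&giiXswVy IeSax4:9 I415RN,: IA#S07$m13GXh IL1++ATV5H JL%1ZM5;o P37016452 P73014652 P37106452 P73104652'',
 ''@04510C0 H%+qg5sf G%UhE97=24Id JSTQx-HP Iv40-Uus57FGNPRgiw,: JIo,uRdK47k.:'',
 ''dD6020B2F0D2 HV6AhUY. G+KsU41Y79CEVdfu$ G3-NufyJGY I12DWR3s If0eaC%45HWimp$'',
 ''@D9411M0C0 FeIOOZV6 GBA22E98 G%&MiTdz JgS2Ps-: Jh4%z;xr$'',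
 ''P0L520J0B1 G2McOdtp G86ADDaXBOik G!gcie9F1l I.3Mc=HLCE+/'',
 ''@A0511K1I1E3J1K0M0 DnWWPMLR DnNNEZEZ07 EHVVjKPM0145ADEINks EeIK9MaV02468BDFi Ee0FT5T523CEW FJbbaWaW02FU EeGGSR127DIY EeffG3U36E FeRR9U9WKQ GKOYn.U6 G%Z-u3GhANQVYbfs GJGNuV-m2MUZbvx; HhKK9Y96J; HFUUn9d9IL'',
 ''LH3020K0A6I0 EjHPKaHV ENbNWUbJ68AM EBPbjHPUN HowT:&CW Hh,97G,U12BJOQZg G.J.sRPNABCIadf: GUVfJ0RsGMO+ H7:7Ca:QUf If0I4-odARh%'',
 ''@A8321I1C0 EeV4MPjJ Fe23a66bBE FeBOGFIA9 H8,6jA07 H0;Y#662MQTUhjln= G%M1U8&uEfwy HYitKrmsR I;/Z3%KG9HUW'',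
 ''D06421A1 GVJ9ImGU G.BHU77P2ACOQRXZ G$jGFWTmLX'',
 ''@L9421M1C1 DnkYYOia038LTVXa EHMVVjPY05ADERWbst EeWdF88k29Ij FMH7766VEQ G-b3dh6C028BEMUXZakw'',
 ''HLJ510F2 EVjPHWjk G7=ggbkQ36FT'']"

definition certificates_2 :: "string list" where
  "certificates_2 = [
 ''lD8001L0D2B1 H6-.zTYb GXz&VM&U Gbfqu#5ZF- Jr243i5EPQRUWx,-'',
 ''@H4521O0G0N0K1K0 DnEE77MV06FIRa EM5577H4029EGS EeDRcc4E27JV Ee88N3gx9CEL G.7JN4PG0129MRZabcdjkx& Gwg&yVUe1258DHS G%U4f1Q$9FP& GM6&Vd250b HsYJiiXg7'',
 ''PD2611N0C1 FHaaKMcK Gw34fW.$ G9UV2;sFHk GN..oVXJId'',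
 ''UI0020D3H6A3D2H2 E2bIJ9a9 G+,sUROK HL$sUdad049CDHJMNTXYw! HV:xKthQH JN:31R/7Gck%'',
 ''@D8611M0C0 FeVJIaEK GL0;nOGN HV9AFc2JH H%p,9/X+A J=4Z3.%d79Ll!&'',
 ''h09030C0 G2UE9hBJ GOKLe9184No GYnK0+LNA'',
 ''@HL521K1G0K0K2 DnWLPPUR025KM E9IaJJ1c4678LOP FeZQ6KUO07F GhQZE#iA04FGm'',
 ''P0L521I1 EBPUbbND0124DEKc GiYErhtk3ASb'',
 ''@A0631K2I2C2M2C4 DnUUgPXI014EHO DnmmZZYY0O E1wwJ9BS268AFf EewGS1ff029EFn EPccOOAA02 G&4egwOb79EHIJLRSWrv. G-GqJubF4BHp GjHVFU6tO'',
 ''AN8300E1A5 ESA4X1G4 EMNJIWWJ6Q G2,9VTWM57BIKOhiuv'',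
 ''@A8631K0 EeKfVHuQ0167Fw Gqp5bf+F17CDEGNjko.;'', ''H0L621E0 G47UEBgb'',
 ''@8L521K1 DnNcjjeU3I FI66MMJc0G'', ''DC1711C1 F4AAQ5S526'',
 ''A@L630M2L2F3D3 DFFCCC5L025BDJL DUUEEEXXOX E44PcASG2579BHILNORbjt FMFWWWIV046BDH EIIJa9XX08BE E10555EEDT EIIM66a93C EYYWRWSXFT FCC55FE67A G,YmLrD8 GV,pmNAc0GJLZk'',
 ''D08111F0 Gf66lY;U GMttf:V76RU I-41R2oS J84JiBjV2CEGHhmq-/ J024Xd5LAU:'',
 ''H0L610F0 GfsVZGW; G03+o46a G:7.JYQh4atw#+ GJ/99W7YK I548XBugaj'',
 ''H8L620F2J2 EIOOOWM6 HcAVFDLl Gm$GVjr+24MNQT GU7Y7gaHK'',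
 ''bB8300G1G0A5C1C6 DOXOWXXO03KNOS FVMVNKHV03456789C ExZTEZZ601238H EZTaKTTa8A F75FD55726 EBOB1OO56w EVgVMNNV6 EVFVOFLV5 EHTH3aTHE H6-zRY.g GHLHBGsJ1FNUen$ HHU1I2B1048Yr! GNsKpLON02IVmo GM8ju77fGNQ H=9/C9,UFTW Gg9Usq9JIKe'',
 ''PHJ320G0C0E4 F55O3JIO GVfZ3Y#Z H66;O5u- I5DmMiJr7BCINSUXbhqs$: IH3&R=8OES'',
 ''P18630N0 EMKKVH8X E1JJ55qoks G&4iwgPZ13579JOTach#+.; G/Wh99Y.36CEP'',
 ''a0L630M4F5 D88CCCjN049c EttAJaju17BKMm E98dddaS015F'',
 ''A@L631M2L2F3D3 DffEEEJQ012J DffEEEYYO EHHK9ajl018ADI EZHCCCKK3F G6B8fAHH2EMhp;'',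
 ''0D2310J0 Gn;0L$FG HgsVJ.Zc3CHe'', ''E|8021D1 GUTo.O4H GI60RJJbH'',
 ''H8L621F2C1 EJ555Caw26Ef G71QZK.gSbm'',
 ''a01700G1D3G2 D88CaCCF05LQV E5X08009137FINSd EccO9DOV157EK E22F7FIV3BJMX Eoo1pEED047Bm G3lhX-6=0EFNZ Gyegvw&V1'',
 ''TAN201K0 E9H29KVa Ew0fw0C9Z H6-azYu.18OPbl&,'', ''P18631N0 EUGG2RiP07BDKN GG7X..,x1W'',
 ''a0L631O0 D22CCCJW1K'',
 ''@@9111O0M0 DnnNPHWg DnnefihYO FeUbB2G6013479ADEJNOc FAe97SBD01268FHIKNOUY FbeUaW2J16MOZ EeLNFAV258GJt E4eAMc5X7It FebJcWaY1LM G&&Vb6zd GVx$twmfRT'',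
 ''@0L510G0 Ee9Ha3IF FeKHaMZW0MUYb G3f48b6- GG;F0lLsNORUWanqr+ HfrBpSbT2 G$xVwGyHg HY-6.KgId'',
 ''ED1610E0 GiF;VDl# H4d$tO1U03KRYnqx! HVRs,kgJ2'',
 ''@04511G0 Ee1wSBGp Ee4jsPXVk G30+5o64 Gn2qO+;5FSTfp G8De,1A&k'',
 ''P08321C0 GUoOM4.u G$HUyjsx17LPh&'',
 ''@@L511K1I1 DnnFEBfR02357Jh EeUBb6W2013AFST EAe2t7c50BEGOXj G--3hoAW HCC:a&Db5'',
 ''@0J611G0 EerNJRPD024567BQ Gprtm,!9 GTWYsjC=J'', ''d?0001L0 HA.qpF9+'',
 ''@04131G0 Eea9KJQZ GLn;0OYG HjWMT52vFn'', ''PA6111C0 GA5PqS#f G7ZJ/cz7W'',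
 ''@@2631G2E2 DnnS4JXQ1FH EeVJNLIE04578B EIeXcOMs178ACj G&&d#Zb6 G77BJ/1gF'',
 ''@H8531G0 FeaKHZM118ACN GGsHjbFJ234689KMNnwy!/'', ''e08501F0 G7+rm41w'',
 ''@@L531K1I1 Dnn39DPa2 Ee1S4w5x2R EVeOpPof23 G--ySoAb1247HIQXZp'',
 ''@0L531G0 FedTXW0A17 GcDe,gAx3Et$'', ''BAO121I0 HBfnr87pCO'',
 ''X64200E0 G-b3NVzo HU,jsNpV GXfsGjtl5QRZp/ GF0;#iElD'',
 ''@8L510G2I1J1K1 DnXXUaPL DnZZNBEFE DnZZANGEE FeJMW5Z31469EFHKNRUXa EVFFILMK013456789ABm EPNNVAOcDt FT99HQdWF G8f3X6,M9NQUahklopqty.; GyXfv3#o48PY.;'',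
 ''C87400C2M0 FWVKFOWZ E3JMw93HKV GeZu&18Y GGWYjFH.01Keu'',
 ''B06430K0B3C2J0 EHdOd9jV HYsdUfh. GqJRJ-9g2AOb, IW5T3PgaRh'',
 ''H04630C0 GVFAG-zD GlUsRfFG HYfsVZvIJXb'', ''@H6521G0 EePj4B1V HoV3wjTk GUnKOyoY56-'',
 ''H0J611E0 GcD2A8;X GYVg!Fs#EIw'',
 ''@DL630M2C2E2G2 DnNZZ0cj01348Dcj DnFEE7CC2 EeWUM6TF457BGHJPQRf E7A551L209EIKNPQSt EVDEEJOO5BC GDci;#A,0ELOPWZdlrsu& H-y3$.uuTw'',
 ''Q48211C1G0 E8HKa8Mt Gf-63V=Z24BFMPRTWacgjk GhbIdhGtv'',
 ''@4J611G1F1C1 DnEEF5GD0235ABD E933wJHb467ABLNPn EeRJaHrl12 G#iD;QYZ02389PRTw'',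
 ''028630A3 E0K9w0Z6 G6O&5M4$HThv'', ''CB7600A1 GU&Z2dy# GY=RIh-6H'',
 ''@8L511G2I1 DnZZ0mDM249 ESFFGL1b039ADHP FebaJcR40D H81Y0IA&dm'',
 ''bC5700F2 EVEcMDER258BF Htxn:mVo0P'',
 ''@08331G1F1 DnZZBbN31349K EUWWMbR603479DEFN EeM67IUD34 H43fwb8J09AKNQSWk-'',
 ''PM2230K0 E6U7631B G#Dli&G;9CEPQUwy'', ''H04631C0 GK1Oe&Qt'',
 ''@0L331G0 EeCjtHOJ246F HRUasC,+138Lpv&;'', ''P0J631F0 GcV!gDtX04EILX'',
 ''@DL631M2C2 DnOXXdiC03 E9w33H104AMOn Fe6MUWNC4P FC8553EEL GWTf9;jC3J'',
 ''B5M401L2 EH94djdV4567 GG02ImJ$S/'', ''@8L531K1 DnZZmNMh1 ESFFLvYa09'', ''I|2330K0 EOaBIGPO3E'',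
 ''08L510G2K1 DEEEUNPW DXXXaUVEE DXXXOaC8C E8a8tKcD3BCHIRS EOOVDIqs0FGHKjo EMXXYIDB057HJKU ECCCOjBUV'',
 ''H8L630N2G2 DFEEENL5045BDJL DNZZZaEE7E EHCaCt7M089BIQ Ew900KnS235HIc E9ddHjwJ78CKMf EJEEEXa9M'',
 ''8DJ101K0F1 EH393SwF G34o+B1J25DEMPQabnqx&'',
 ''P4L630M0E2I2 FJMWWR7A GFzUV9b-01DEKg/ !INM2KH0 !IN5LJH0 !INM2K0H !IN5LJ0H !INM2KHH !IN5LJHH'',
 ''08L530G2 DCCCAIGE01347EGU ESXXnIho1L EOOPcBnMHN F6Q6NC1aKW'',
 ''aHL631L3 DA0ZZZdD24C EYJRWWstG EIDOOBMEb FdOWFWXGC'',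
 ''H8L631N2 DFCCCIE505 EUbWWY6G9 FJWRWYa5B EVOOPBkMA'',
 ''D19700E3 DZANCZZ012346CDO FOZT6WWT25 E8KtL8atBS F9TCNH9C7G'',
 ''0J8621E1 Ex1EhE07248Fn Ga;6RDVn1h'', ''b2O420G0 F5OTC5Fc2BK !IJLI0II !1LLIHHI'',
 ''h8L631G1 DVEEEFaT0'',
 ''@@0731O3K3M3 B11100000 CCGGAAAA0 CGG877770 CG6G00001 DEEE7GVN0346R DXXnhSdl04AHK DnZZaNbA1248K DZnZNbaB1348K DCCC2I2I04 DZZZa00a28 DXXXddllAK'',
 ''@@8731O1M1 CGG2555A0 DgnUPPPH04E Dn5FLLLH04B EEERoJxX24578ILYks'',
 ''@08731K1 DnYOiiiU0E EBUPbbbI024FGV'', ''l08521O0 D2CC6FCa1V'',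
 ''@D1631C2 EeH9Ybda03478ADOU HqpFvn9+'', ''D08331F1 EHTTrfaP FYWWObbLa Gmprb,tz12479EFhijkq'',
 ''@@L730K3I3G2 CGG522AC02AC DnP1AAWL05DK DNnH44cj0158 DnnmYlLWTf E66UMBE301458AGJKOPfjw EePbNUcO28 FXX0dd4SAH F1e7L2JNKU'']"

definition certificates_3 :: "string list" where
  "certificates_3 = [
 ''@09331I3G0 DnaLVkkR0258E E1S4wGG906AIKLXZnp EeAg2Nm98M GXslfiGv0DEFHdm!'',
 ''cHL211M0 ETISFF0V E9tAaJZABETW'', ''@04731O0G0 DnWMRRKd07K EVMKHHJL01246AB HVksMQoc15'',
 ''jDN120G0 Ew9IJm1w48HNg'', ''@@L731O2M2 CGG0662F1 DNnH44OZ1 DnMRWWII0 EddHj9NQ04567AE'',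
 ''@0L731O0 DnRMWWh90 ELbYSSNi09m'', ''Y?0210M0 FM0JVM9I03'',
 ''jA9130C4N0F2 EKH1aG9K H;OmGtis026IJZ !JHMHHH0 !2MMIIII'',
 ''@8L730K2C2E2 DnCC287M017DQ DnH4NNmM5J EatAJJTH012346fn EGEEhqfHns G4UE7l&&FIQ,'',
 ''I;2031C2 EbmLYMSS F5K5C93FNP'', ''oAN020C1 F9V3NEJE23FW'', ''@8L731K2 Dn5LFFhb0 E9ddHH116'',
 ''NF3720K0 EcOc1FIO1'', ''08L730K2M2 DXXXUO5F035FIL EbBUPPqs129'', ''08L731K2 DXXXdORP0'',
 ''BA0511I1B3H1@3 EMVaKJHI FJbdWaWa E33d898H56fw ECCJa5t50Hj GYL+Tms128FGHIQRUZaov$ GN3YV-0-57DIKhmu G1+xKrK43LOptw,. G1+x4KrK3LOptw,. GtpsKVKfHMNRX+ G,,BrUS9CLMe Gbf+qQpsAP IhS07yAx1245Ha%&'',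
 ''FD0411B0 I4JmL0k3 IJkz1&4m Ix41pTh3 ISaqYD9WAGVz-'',
 ''ADL620D2 GOJRsU4. GfK99;6Y Hf.YTsX3067UV Ix-S9H0M157BUWimy#$%& Iy9aSX5Vhw#'',
 ''XC8421E1F1 EIM9aKHX EOW55JMd389H Ef3GVEEw0SXp Gpb,,CRq2BV+ HPs.zTYHQacl'',
 ''PHJ501G0C0E1 FaaJ135H EXXddMHI069OQTaj HTYsL.dz HsIWYbzc1JUZl G&&65X3zLWal HVowwGiD4f IJkLm4Ur1GZj'',
 ''PDJ601I0H2 H8E4&6OY HRUsa!V,19HMOkr I1O/R:f#024BDEHIchk, I72SDi9+BH%'',
 ''P8J501F4G0E1 EVMKHIaO ErgTTNXL2AHS GlGXs;Q67AEH$-. Gnq+5vM!jm HsIYgk.QX'',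
 ''HDL601E2J2 Ew19JIBS F0355JNN468ACDEX E557MHC30148k EI9JaAc21B FaaJIMHH3 H!,rpbGI1279KMSWXZvx Gtfpr,RR789KM: GCzaXsVV36 GJJ--bs4So'',
 ''H4L601D2A1 Go-dNPWx GM:,,Rt69AWh Iv-9Qd0rA#%&'', ''L8L421K0 E3H9KaQF'',
 ''PHJ521G0 EQQKad96 ECCNN58HLP GpVZfkP206BGKMUXc+, G#yUo&Vvq'',
 ''PDL521L4G0K0 FMVIJXEH H1!rYBJ$0MTmvx# GVf3ZkPY0o'', ''P8J521G0 EAc4Ptj7'',
 ''08J521E1 F17552OK9E'',
 ''@11111G0 EeV3JHE9 EePJHAVa EeXbcNYPLS H10U82YB GYg8s7ef4GPQRScq&, GUsyhfdw3IPQST&- GY5J#0uIGq'',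
 ''R81500E0 HbfVrsjc HUOIFsWY GO.G6Xls6AIMYhj- GlF0U;a64E#'',
 ''F0J201E0 H6fQX8A& HUV!NsYl HQsIYVkz2DOW!, HD3-kV6JO'',
 ''@8J301E1 EeBPUaAK EeZN69d3HQ Hq#vu+pg H4frx3+oDKSTp H87Yf,IAQ'',
 ''XF5120J0 G,DA7F18 GFV!Bafp3EHSdlm'', ''P0J321C0 HA80,D39 H6305.kjls+'',
 ''@8J321E1 FeK9QaJ6 Gody-cxW5789BCHIKelr&'', ''0?0220J0 GmIVtxcM'',
 ''PD1421C0B1A2L0 GVsUNoOY HYTW.-2s I104;DGp IkV1G4DL+'',
 ''PD9221I0 GfsUb4OQ Geb&sO4H G#YDu;6v0l HB.72UYA8 I1QM&.v+n'',
 ''@14511G0 EeSTFaLH EeOHdCWa0BT GekYs!Sn G8YADf1PCZmqx'', ''gL2200E0 G7V0FB8A G2h-6VCYIOmnqw'',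
 ''D04131C0 G3fVpwXk GJmRt+V/47HKh'', ''@D9231M0 EeGSRaFE GFlj-Wkq GO1K&6L47r'',
 ''H05431C0 G2ON;Lcp GYmVvp#gci'', ''@BL131C2C0 FeM5F4WV GEU7Q4zh GTWM82ffQmp IW5:auC0JK'',
 ''D0L131C0 GoN-S3Ox GUf7ZBVhXa'', ''@12631G0 EeEZxh6W02489On H4Ux$1oP59ADIMNRSZkv-'',
 ''fIK200F0 G,7V48D1'', ''PM3030C0 GOXRc2gs'', ''@BL531C1 EeF8t52TBEKS HnyvIu&d013469BGNPT$'',
 ''SA7030C0 GeV#ks$D057Boqu#'', ''@8J721E1 FeXcY0FZ26 HM6j5=7FIm'', ''G?8100B1 H4C-cg.75C'',
 ''08J300C2E1 E33H96MI EXXIM8F535FOW Faad0JENJX GfQbsu-J G&14OZPs7CHLQVdoz+ H5q+#AhK39Yp'',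
 ''D8L130F2C2 EHCC5a7M F3667N5504AJO EHdd8jaKCT H&6VfjXy GzUadC&&2DEPSY$'',
 ''BJ6421J0 HsS,GZVI G:Mo.7JW GoV&ON.w2Xgx'',
 ''aDL630L2 EKFZZ9LS EN0XX8CO6Oa HbZsfT&E679ABJKMNOdhqu+ HE3KZQD5u'',
 ''P8J510L1G0 E9w33JFI EH933aETIJT F8C995SO3 GsSTfk9g HFVUCca;2MOZjlz#'',
 ''B|9110I0 GfY0sAaS GM7YcWVo HsH-aWSf2CZ;'',
 ''h46601C1 EZZWFVKO EZZK93680a GVfQsd6# G5bqfw&JRY'', ''DD9231E0 G0NVSC3I HnYI6&vhCTUdemy!'',
 ''D4J611F1 FI99HaS2 GyXfQn3H4679CGOPRYc&. GfxrmR46o'',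
 ''DB6431C1K0 ETTaJWrH FWWMHTTJ8N GVsJ:MQY G..YzFXJ018L HhZ3$11KOc'',
 ''H4L701C0 GU,CR.K4 H1784AQ29CT'', ''089530C2 EFFT3WgN GsPdWi-34KOv'',
 ''C04631H3 FOMUWW5G GuCWY-Qj0378ADEISgloq='',
 ''D8L131F2 EjddWHkU023458CFU FB99QRFF0 HVwfWxFjIJKLRSXZ'',
 ''Q01701D3 EEKQVQa6 EbXNSN8J9F GfzUPVFw0167DEJKNOcd'', ''P12631F0 GfU;a4FQ'',
 ''L8L431F2 F155FOcN69BNS GZ&18e3/Fd'', ''H8L511F2 FNXXE461 Gxrt!jo$17BKORSi/:'',
 ''P8J321C0 GtrpmjFa'', ''X8L521F2 EWTTZgNR1239MU GGVmxNP;16Ua'', ''PDL721E0 GGIsbjv0'',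
 ''H8L721F2 ET00EOWH27H GA86DjG94O'', ''YF1510F4 FbTW2MOW GyBH&a1UGLYhqt'',
 ''P89531C0 GVmtNxdD159AHT+'', ''089531M0 EZZTCFHu1m'',
 ''AZ9120M0L1 EFXS5IF3 E9WZHZKa1348IUVb F2C6a6Ia0H G6sV-fA-2BMPRc&;'',
 ''@03631O0M0 DnODiY300249CTf EHVMPjKY015AEINRWbkst HJg7994k03+'', ''YB4311G0 EAIat9XJ'',
 ''@@M531O1M1 CGG9592708 DPnUAg1L05 DnODX3XC24 EOOPQVd51234689FGU'',
 ''@0M531O0 DnOWYNiF05 E9KZ0Z03478f'', ''j58421M0 E4sNX8XQ2O'',
 ''TN8401K0I1M0J1 E5mAP4c1 E51JNAN46GLVa GVmYishN G+mJ-q-p9Vav'',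
 ''@45511K1M0C1M1 DnOWDP3L DnUIXCXC2S EPj4VcHA0123579CDEJRXks FCQF6565012KN Ee93J8bF2EKg G;F0#Lln1CEz'',
 ''BE9321L2K0 EaJFtSIA EPUsB4jb6AINY FHd8a9Ta1C G-3syGbohz&'']"

definition certificates_4 :: "string list" where
  "certificates_4 = [
 ''@49311I3M0C1M2C3 DnWPNgLH DnUPXLgak EVjHkMPI0235679ABCmst Eed9XbHS03MPWj EJ91IEwV2Fi GLm1GOr;4BMRZbpx+'',
 ''b05131H3C1 ES19Gw4H EjH9PdVb3CW GfS,arsDHgjk!'',
 ''@DN701E6G0 DnjNcP99023489ANc DnVEEhRR7 E1SG49ww26AFIKLRXZp Ee6QQ5CMINVj Fc4XXbGG0 G148&K+U059JVahjp:'',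
 ''P0K630N0L1 EVHKPj9J EaHKCCMJO EaISJ9X8V G=6R-hfT0JMj+/'',
 ''@8N720M1 DnFL5CIU024BDEIJX E1BD7wSG0268AFKOPRUXfgp'', ''VI2311G0 E19WbwOJ'',
 ''P>J011C1 EH9KVjLP FJaIVNFEA'', ''@83631K2 DnkYLami058cf EJA5ta1M06DLQZj EUbWBPMM5'',
 ''Y06231K0 EUERGh320457BCY'', ''FFJ510E4 E3HaJF93 G.o1r6435ACGJTZky$'',
 ''P05531J1 FHVKGMO9 EAtJcan5P GF;GWlfHin'', ''@4L711G1 DnWLPeQh1258Mh EbYLSNWP0126DOQj'',
 ''NB8721G0 E2AaBJtL04BDEGj'', ''@0N711O0 DnKQW6bC1GU EPVjHONc0136EJRXs'',
 ''P0K631K0 EVDOEEBN28FLY'', ''@8K631M1 DnKbQWZX1 FTdWXXO91A'', ''LDN730C2 FVJNRdMI8Z'',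
 ''L8L630J2 E54APc3F EHTTrgMK3479ENP'',
 ''08J510E1L1 EWWRJFa8 EH9dd3O5 E88atFJW9RT FdZaaE1N6X GBURfF6-4CJSXgu,'',
 ''6M2100F1M0E2 EFZaK3H9 ETW2RfGUJM GZ#6DSA5FORde.'', ''T8L530K0 EcA45P39 E266E7Vv1ACHR'',
 ''lAM120K0I1 E6QMOKQd EwBfDw17456EIOUm EB6PZB6Z9 Gj6u&YV&CFHK'',
 ''P8N720L1 E9HKa3gb EVoEEl4P0N GvfPqthIHO'', ''08K630I2 E2LFA7TE'', ''L8L631J2 FUMKHV2B0235ES'',
 ''08J511E1 EFF2LTAH0146CPb EfHTTGrh7w'', '']L4221G0 FKJVIFCM12378CGTZ'',
 ''08J711E1 EtaAJ8mF04BEXj'', ''|08630K0 EKVHjPfw01278AEsw'', ''f2J720K0 EOpwnOB747m'',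
 ''08N721E2 FMIXX6ZD1'', ''0B1631C2F2 FaJ1Ka5N6BCKNPUW FbWWEJFF12 H0ga,R44BCV;'',
 ''PDL531E0 G3$4w+WD'', ''H4L631L2 E9w00O1Z268f H8471Q&TGd'', ''08J531E1 EBDOO1dZ2F'',
 ''@8J331G1 DnMRW7VQ127L E2A7Lt6F014EKTj'', ''W30700M0 EWE2LRGU459BNa'', ''BK5610K0 EHKIjVYM'',
 ''@DL731G2 DnN4HTZj1EI Ew91JS03267ACLP'', ''B?5300K0 EYbOXDRc13AHg'',
 ''@8J731G1 DnYOikCE0 EtaAJC2n3X'', ''HM7131G0 FNVXJU1EBU'', ''hLL630E1 EIJ9aHsq EHfTT0PU39w'',
 ''H8L730C2 E9HKaV1w EVOOp5LNMmo'', ''PLJ721L1C2 EaHK9RDC G3w4fklK19a'',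
 ''04J711C1 EtaJAjIu0167GQUn'', ''08J331E1 E2UGR6Sr09DHK'', ''H8L731C2 E7DB1O2H28bh'',
 ''T0M621K0 EHjVUPU9057ADs'', ''P8J731G0 EJ9Iabi56DEZ'', ''08J731E1 FVMHKJ322'',
 ''@@N731G3E3 CGGDF8C00 DnGEE3K30 DcnjNk1l0 ENNCZLPd0124QT'', ''@0N731G1 DnLkaWeH1 EUPbBjjl0Ao'',
 ''?|0011F1 FIdWWRQY12'', ''zB3310M0I2 EEJtTIAa HyRzx+,!Tj'',
 ''@LN721G1 DnjcNVR80148C EaH9KtAT156DEGfn'', ''H5M530G0 EVHxPhjk0135AFns'',
 ''D3O601G0 EnXwDcXt5Dw'', ''@8N731G2 Dn3ODGcm4 EatCCJSQ7'', ''S9M211G0 ERXHcY5D6'',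
 ''08N730E2 EUG2Rf5m09BDNSTp'', ''08N731E2 FOVIFLUU4'',
 ''XJ3421J4A5 EH9KG14a FHMV36NK E8XNFSLd23AIVY EVHPLYbjKS GufqNsO536gjp+; H3w$8I1VMZ !H54LIH1 !0L4LHH1 !04MLHJ0'',
 ''HCL630F2N0 E9JKHM1w Fc4aaKXX28HLSYb EVMPjuIJ5AEFOk EF5GS433Ew GYU-WonK0Mdfhjl.'',
 ''d16321F1 EVHLYjPS E91cDJwO7AOPSW E35E1F8D7K'', ''hLL701C1 E9aKH41A E53F8WMQTXa'',
 '']K0421M0 EaFHjVPT E9M2L7AIt'', ''H8N701F2 EVKMH8Nx FMYWWS441D G5i&#rSW9k'',
 ''b83631M0 EJAmat1u'', ''046721C1 E8F53XIA'', ''P4N721M0 EAm55cpL26KLiu'',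
 ''04N721F1 EMUWWufc09'',
 ''@55511O1N1F6G6 CG9494940 Dna3kDLO DFECECEC027 Dn3LOkDaJWY Dn41NPHAT E7DL12BA'',
 ''iJ1511C3K4G1 DXCOSCXC034S EGP4FASc ETJaXATt48CIMSn EA14NGPSfj'',
 ''@|N701G6F6C3K3 CG444255025 DnLakmM93578c DNZZZWOO13K E0OC59Kw67LPS'',
 ''i;J500G4K1 DZcZZ1AP239CD EJitamAgBEGj'', ''kIM011K0 EZXRTEZ012457DHa'',
 ''@|N721O1 CG99913E0B DNZZZEEO13'', ''A?L630M2 DNKEEEH40Q'',
 ''0|N700F3J3N1 DOXXXNjc01348NWcj D7EEE6CC2C E4AcPSwv EANgNa9H7Gm'',
 ''hLN701E1 EHaK9gGA EbUBPTgfa'', ''H|N701F6J3 DNZZZlcc134Kc EcA4PoRp EVGfHcDpMow'',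
 ''h|N701F3J3 DNEEEI4C02IJMOW EL27AWbO14DGIc'', ''0GL631N2F3 DF5EEEHD2BD EUMRG25n9Dg'',
 ''04N711F1 EbLYSUrj0179DQ'', ''P|N721O0 D8CCCaVQ01Q'', ''0|N721N1 D8CCCjNB0'']"

definition certificates_5 :: "string list" where
  "certificates_5 = [
 ''046731C1 E8F35Nif029BK'', ''H8N731E2 EcPOOjnY19N'', ''04N731F1 FC355EaBB'',
 ''@|N731G3 CG4448DE0 D0ZZZ2eD4'', ''?;8401O0 DfUZZbZK1'', ''0|N730F3J3 DUEEEXC80PS FVFION4A8Ca'',
 ''0|N731G2 D8CCCjgB0'',
 ''8|N700G3C3K5E3 C999944404 DEEUEiYO3IOTXYbgik DaZZZOiY8VXk DCCCFN4H5BES DZaZZOYi8VXk EMVIJZZZ5EHOXa'',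
 ''8|N701G6K3 C4444255025 DCCFC0QD1BK DZbZZ2RRK DXXXScj24 DACCCJff1'', ''8|N721O1 C9999BEF0D'',
 ''8|N731G3 C4444F950'',
 ''A@1031E3A3D5J5H3A5 DAAPP111019ACDP FQQCC69F02358AKNW EOUBBPPP026DVj EIIMaJJJ4568AB FZZOO33W056 EAAcc4tt28n FKKMMH4H379 HpEFr+mB Gf!VvpYY056CEITe GeVcYs!sGHIJKMOX HYADfVV529CFNUZg Hffr84YB36ASWb HlIsscKSHLNOUY Gxl4G$$$EVjw'',
 ''PA0521J1H1M0 FSAA4459 F577AABM4 Gydd&-bU HK9Q==;h Gd##IIYo0 If3d=0.u7BCFIKLNOZgpr!& JVE,iKJ25NTet'',
 ''A@9431E5M0L1J6N0 DNNccjjW0148KO EbbYYSW914HOZ EHHdVjjY8DEWs FJPEEVV1259S HE3+8D4Z01ABCLNOQRVbgh GfFqVpAT8DYajl+. HiiswKJmRx'',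
 ''DA8431A1 GO1nHeL4 GYeUO1nW5FIfjr$ GTwMVooig'', ''P18521N0J1 EZ99KKHF567AFG GA580DYQ4NXbkoy$'',
 ''a09431G1 DjjNNccI0C'',
 ''A@9111M0J1L0H1 EVVHFMGI FVVOMLIK2469EHJM EbbUJPWNAM FSSXPY4RM EBB7O6DI2 HY&5E6L8 G&fX6y85ABMOSWaiqv# G-sJlYGh6LUXu H--H$2cW0IMUj G5;nf0u6Qq+ GffW6PYA-. Gbbdf-s36N GAAc8V,0M I5Sm2AD90347GHei- Jim-3jNJW'',
 ''DI2421F0 GcDo1eOV HVfG;92s G9,J7UBL248CHNVc G+K0LsJ35IV I50X-PF%7L!&'',
 ''DA1031A3B5@3@5 EVJKWMMM FXY4RSSSM EHCVtjjja GfY;-6Wu Gqpnmv+vIJKPXYefjtu!# Gli$!kkE3DFPSVegjsu GGLFn0HH1BKPUbejst$ GNJ3Y-.07Iu GJGNA.0-7Iu Gzmb+RRRQp I#S5a:AX019WZy'',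
 ''H18301F0 HhOO64U3 HHbbsq-U5Msy J4%eaf=: I0diek!m357EHIJLNbcoz= J:F1;Q5S02APT'',
 ''a0L510G0 EHHVMP7A EBBOPIb9J GTAF9.2N Hf=9;T6jJU&'',
 ''A@L511E2J1 E2267UAG FUU2PbRG1BDE EMMJ5WmU1R E44jsPXAN FVVOILJK9 H&Yn5IL8 Gf.P4A3B9HORabqy GQQn+;s#U'',
 ''DA8231A1I0 H43lX.of H0zAS,Va G9AT8fF,6DU; JqC12bpIQr'', ''D4L411C0 G+536KMQ HVmtR!g2ABj:'',
 ''BH4521J1H5H1M0 EIXYMMJS Gp9Af,rh Hsf8XXOY7AMRUVZep GcMNO,eV69ADm& G#un;qlyJ- J45n:ZJA2Vpux.'',
 ''P18511G0J1 EIaaJSRX FQZZ6W3F0 GGJj7u/; GsMbdT&YCv'',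
 ''H18611G0J2 FVMMJWHF H=T6Mj., Hniu;GYo1l'', ''X18621N0 EVggNrTK GM7+:Q160Gjp'',
 ''HA0631J2E2 EVKKM4DL EGffH34415A H,9RUB=/06DILOTVWhtz G.PPCWNH01 GQ7+:J110G'',
 ''A@L531I1J1 F114P52N HnHyU&hi2DFNcmv-'', ''BD8631C0 GG06Vj;I'', ''A0L531E0 HiuYnJ;H'',
 ''PD9431M0 EJIMMW69 H=J97,B&KLMNWYZe'', ''H18631G0 Fa11J5cd69EHKT HZPSfAznHIOd'',
 ''a0L531G0 FUURPB2X03'',
 ''@C1031G3F3G1C3K2K5 CG333111013 DnlQbKKK0TU DMRRRWWW02K DnBBBZFR025 Dn711DDDA Dn444SISF DnLLLeaa8 Dn66677CD DnmgmYYY9 DnJJeLLL2 EFSV2GLI167BDEJKRXYhnrt EeT8IFaX0239HKMNW E54J41A19BGKP ECjaaHHt389BP EWUUJRbb269BL FeBJSIAI6MO Ee8VZKKx9Da FWZFFOdd05E FeHHIM9a37C Fec00FXa358 EeWHXTMM47J F622BUIUGOP E62BBUIUGOP FXdNdTTEHQZ EeHWHMTd79a E5JJmMMAINu E5A1AmJJ9Ng'',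
 ''dA6410I3K0A3I1C5C1 DODNO33O0249CO F98J5CCE01346BHIKLNX FMJKMW5M0139QRT E09CHKKH37j EVJF5MMVDEG FHVdHPPF3GT Ef34fHHf9K EG4FGf1G5 ES1FS4wS5 GFU!aHqn HshNs+Z3GHPRg HWYomerW9MTjw GL1wUHYU4EVay G+mM,Rpt2NV GOs.HLUYGJN GPf.6RRBCJO'',
 ''@18311O0G0N0K1 Dn2200CD146DJO Fe885X9M17AIJNSY FFVVIIDB167EKRXY FebAEEGL2457BUYc G&e48Og6 H%Q6;VK2CMOn G6A30D-aCSb'',
 ''k@8310L2H3 EcCjtHta EI4jsPsjACc G7wVf&Jy08AIPSTbr+-.: G!uQnNkQ3Yp HRcA0-0$Fx'',
 ''D06431C1M0F1J1 EDOBIcV1 EVNJALgMH GYVU9Jg#6AGMTc'',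
 ''@18331G1F1 DnGGK3EW0679LQ Fc44GX1b0237BDEKU EeV4GKPi5J H4w+3gg8FWej'', ''P|5230G0 EXYsS4JI'',
 ''@A0731K3J3L5M5 CG55222202 Dnjjcd9813AC Dn4ONNNN3I DNjjcccc08 ENAVgLPJ12345BDEFGHSm ECajHHtt23B ElVVoHoH13 F6NCEQQEAK'',
 ''A@8731I3N1 DNNjcccH058E EGGVgHF1578ACDIKNm EINVJJJ628CFLS'',
 ''@A8731K1H3 DnCK666802Ga FVFEPPPI03689B GhIZE#s9245FHL'', ''YL2430G0 FQQFCHQW01378JMP'',
 ''@18731O1 CGDDFFF601 DPUUgggT04'', ''Y?8010G1 DOUD3OOD2E'',
 ''a05230G0C0M0 FVVIIOE6 H--KWYq9 GXUCC,sZ JK27,Xdo8ABDHJSUfstx%= I2.xrd1h7SV#, J-:uSgF,n'',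
 ''B44630B1 G;uYfWcD GsQzbThU GB7,rpJRb. Ha!$z0J42 Jx21byf%C'',
 ''PE2621G0F1F0C2 FVJJIO5E GOosc;WN HVJJ!2qwAFGNUfvx# GUud#l-M5Ej&; IkRz1VHgEMPbc,'',
 ''h18311G0 EaHHCPKO EIBBa7OA5J Hy$fUTxj'',
 ''A@L730I3N2H3 DWWLPPQK01256KMPQ DFFL55EE7 ERRWYUoE26BHMQXckls EIKVMMa902468BDFi E44Gf1AcEH EactAAI9D H6sdajhYNS&;'',
 ''B01331A1 GNLX0O,3 GDg9RVi,0Tqw H20aAz;q1'', ''A0L730H3 FEOVLL8X GVucgMGm45689ORXeqr'',
 ''P18730N0 EVDDOKRJ FFBBIIRWM G&bO4eq#236CGHKLpz.;'',
 ''a09331A7G1 DkkacLLN0148Zj EoIVskkY12RS ESS1a4wC03Mj'',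
 ''a05231O0C1E3 DiiOOYVW03EKRTf EssXj4od018CHMP E4OccP5Y01BGHQj EVVookF15 GQaC:z;,1Jh!'',
 ''D86431C0 GfQ;nZva'', ''IM0611J4 E7GMHY6H HV:sg+MQ014ABEIX'',
 ''a0L331G0 Eww19Bvd468AK HDq+5Fa&2G'',
 ''A@L731I3N2 D11PAAcD0249D DPPgUU11D EK5M44087DHk EGG1ESi20Y'', ''^A3101I1 EHaNttJC G9K&YH6e7G'',
 ''A0L731M0 ERODccWo0237l'', ''P18731O0 DLaakkZ515DF EKVaHHJ0BF'', ''018731O0 DNOOWWia08'',
 ''aH9230C1L1 EVAPJNHa EM2UI6WF5FGLORWb EI4McXVPHOj EbVLJNSIF HfiPYsA0 G2J9NVT.CFGIYfoq GIBd8EsfPS'',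
 ''HJL121I0 GfW;aFUX Hf34a+q6 H#QzYXvK1Ip-'',
 ''eDK200B5C1G0K0 EMGH1JVE F5IMBAJ9146UX FAI9c4SXB HX9iVz,U H-&H43685AMOZaw'',
 ''h89111C2M0L1 EWMYJHR9 EX4cMAI7126Dt HfaRXmBi3479Hbdl;'',
 ''AI9411L0 H4-8b3&$ GfeQSsAY0BNOXaglr H!SV,zpaBI'',
 ''D8J321F4E1C2 E5J1EM43 F5C8930JN Gcdih2DxOTXabeory!&'',
 ''P49321M0I2L2 EM75HmAV FO85T30W9Za FKHa903QT HZ7f/P4KBNSYapq&'', ''d8J321K0 ECta8jHX'',
 ''aH9231C1L1 EMA4J5KN EcSY4XR1W G6Z&fVOP09Gbgh'', ''PJJ431C0 GYWC1eQ5'',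
 ''H14631N0F2 F7A154B2 GsUeY1jb9EJZm!'', ''hI8631G0 FO8F50WE1269BHa'', ''n0M200B1 HRDAY5+#'',
 ''P49631M0 E6I2BU9C45ACES'', ''HBL631E2F2 EJA51maN026DHUWai F305CFNNG H$#0c;yy1Y'',
 ''H2L631K0 EU26M7GP039OP'', ''h2L631K0 E4sXcnj62F'',
 ''@E1631I6G0 DnMDWO77 EctXA4nn0123578CNhj Ee4bMWPS1ABFHILOar FSXPYR44U H=J67.R&05EIPUXmsw'',
 ''B|M101B6 EIF8VXMM H1lR4!$r3ESTVcdijmpy'', ''@83511M0 EeIVa6HN H.2BkldX HsbQRH+N/'']"

definition certificates_6 :: "string list" where
  "certificates_6 = [
 ''J8J411E0 HEmpFc+H HgYz08R43K'', ''W@6510E2 E9VGgKGH H6U9,MzV1BIJLPQS-;'',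
 ''@87521M1L1 Dnej00Qc139KLNj ELFSVVxY0348RWXch FeIOa9HL01AR G0VN6CRL1HWZhj'',
 ''j97020E1 ESF6GS1E GdaFsXcV8E#.'',
 ''@14731I3G0 Dncakk2V138 FQN9TT6K1245AM Fe9UKBSW07 GhwQx:I=MP'',
 ''1Z9021C2 Ep1wOBpd2368C H-B.q2laLy'', ''@45631M0 EeFW3QIU0HIUr G36.f4hN12CIWcij'',
 ''lD6710F0 GBpFka2q458GIKM'', ''@AL731K2C2 DnEaVVNN07 F0XK88dN12ILW FIOa22SS4 GoOTM.115A'',
 ''H0M631G0 E4jPPus1017C'', ''@1L731O0 DnijeeTH1 FGbBUUcN05'', ''kFJ130N0 E6J92uI94P'',
 ''aHL730L2C2 EMA5mJYL F5KM44FQ78GHI EscXIYjtV G&Id#bg9o-'',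
 ''hJL630N0J2L2 EtjCaHc4 ESGFviaR1 HDnYJi+Q06GUey'',
 ''P1L730I1 E6IUMBF3 ELNSbb679FVX G3-56bFk48'', ''B8L730J2E2 EM5A7mIX ENPOVVZZABEd G:amzJhh0C'',
 ''b8L730M0 EjCaHtsX'', ''aHL731K0 Fb1a2cW569EHNX'', ''045631M0 E67BMILw48CLPc'',
 ''8Z4621N0 EPjVjkWL05D'', ''B8L731I2 EK8taa4V036'', ''04M631F1 EpwBBOng2'',
 ''@9L730O2G2N2K3 CG3311AC0AC CGFFDD444 DL55FFWP01BDK DnOO3NQ849 DnCQ883G02 DFLL55CC2 ENgLVAXd235DFGim'',
 ''3E2131G2K1 DVkkaELL078ERV E8VrN3JL12DT'', ''@9L731O2 CGCCAA090 DNHH44Oj0'',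
 ''U;9700O0 DkFaGLka0'', ''09L730N2J3 DWRRMMUE0EFKX F5471MR9DGVa'', ''09L731K2 D4NNHH070'',
 ''CA0511K1I1B3E3C1 DOOOWiNY DUUUEXEX7O FXO9ITS802345ABCHMNW ECdPNONO0468ABQa EIHIaV9M236BFi EMM9IKJH4567m EHIIV9Ma26BFi Eccc4OXD015E Eggg3N3r6Q EKXK80809a FbZZWaWa3O EaaOQCQCHK FZZZ6WEWJM GG3C.VX$46AHQTWYflsy Gj;-F6W605AHYf GQ96KfK;3LOUZn GyGGJH-$FLVl Haa-SHz60Ufs H.f.P64Ydglz'',
 ''083101M2F3L2D5I1J1 DWQKKK6l0167KLT DXXdddMM7O EAtc2JRI14567DEGMOnpv FC3H5HMM049GKa FENVVXMM04DFHL E4GfSSww3FIXn FHVGGGbB7DFY FWWbFbcD2GO FaaKKc4LIMV FWWMOOV53GU Fa2IIIFF0D EFF222t638 G-SlyC#$35FGITWYZdkx GG-buAff36VYZs'',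
 ''a06301G0E1C0 FOOZ3IV6 FCC995FABDEIKS H4CaUb&s G#4&&UlV578CEFh$ HKK-3ls.24NSXcoq HUJVYRyt2Ho Ix-9S0.AGWy%'',
 ''IDL621G0C1 Ejj4sXdV E9933FI0EQ Gb.HGjT4 GFnUzR!;9W GWWPfq-$6N'',
 ''D83031B2 H$03e#Nw GYW52Cnn9HKQVfy! GVmNRz0s36A Imz&:5JS2BHOeik$'',
 ''FL8431F1E1 EIJtAc2V FGVJEbbH2IMY E3QddHH6X FR9QTWNS6 GRl--=ysXj#; G,92TCCK8D'',
 ''D26431C1J1 EJVI6NE9 FM450KKJ1EN G+Kn!pp513Rx'', ''d26431E1 EHf3gTV5'',
 ''BA0731I3J5 DUgLPPPP05EHP DXXjddddO EGVTgFHE012567ADIKNWar ETTJraEW0FHg F80MXK5KCDE EfGKU44U56 ECtUjjjj26 E55WkkMM6j FbYFcDcW1'',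
 ''AA8731H3 E2gUGGGA G;A=9Q6c13ILMRTXaenz'', ''b10731I3 DNcdjjjX014AOSXl E33KQ98V1INOWX'',
 ''PHK521M1O0M4 DEE777MU0FIPR E55kC4jF36GIKZo EbYSSS4W9DJR'',
 ''B18731N1 DWQ6KKKR012LM E51l44409'', ''b18731M1 D1A9PPPF05'',
 ''aA1111C0 HXU.szlY GYMJrs7+ Gz-VbFCG HszlYXU.1Vc-'',
 ''aHJ301C0 H.,k7h3U GX5i&fs6 GVuUYG$-0ADMQlyz GysfSguec'',
 ''A05131L0 Hs;LGlOg G+OK21Mp GaVzfm6S0'', ''d14131F0 Gw$eDW3, GeD9Ag8F035'',
 ''045101L0 GX.OCsYR GYK.1T+F G35f+VMp29Xrt& G9gqe2cnHY!'', ''Q0J321C0 Ggb&4Rz7 Gg,9e7U!NWipu!'',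
 ''e10111E0 HT&fV8wA GhcE7dZB H!9zT,2Sr-'', ''CD8631C0 Hzuk-SQU GMiYrtTcCSpx'',
 ''PC8531F0 GrB4+EJS H7Ug:Bw,8'', ''B22631J0 GilSrEk5 HSkdy-sB5'', ''0E8721F0 G3k5DfS!'',
 ''QDL521H1 GOz&XeWU GY=6hfQgHWXai:'', ''HL9621C0 G3+4Kx$0 GA.KFp,P38v'',
 ''D46621B1 G8X&iEB6 GsVJwWjaOl;'', ''T2J431J0 G/J9A.qz'', ''DAL531A1 GCRT+b0U'',
 ''D8N521A1 Gn5y#+QO68OWce'', ''04M521B1 H+rj4Tbk0A'',
 ''bI0730H3 FF5HCCVM FaJFIIdW56ETb H38O64kI GV3,DNUK017LORek-'',
 ''LL9411L0 HYD5GbiI G-FAHP6W GA,9CTV8QWXYz'',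
 ''DFM031D6 EHMVSGYY FJbWXMEE5AIU GYvf&V#e Gdic4oE&25XYy'',
 ''bI8730H3 E098KKXI E2A1779cIt GM&j5Vve GJIfYwad5-'',
 ''0E1511F0 Hg9.qY2h G.JKB39+ H5&Yb0IVHWce!'',
 ''A0N710D3 ESB1wIIX EEaQQJJ13BKO GU.Y7oHy GMp,,2tdARTaq'',
 ''E07431D3 EHAP277V GaG;IsmD Gjft;u6/KZ'',
 ''X18710F1C1F0 EVIIMBcP E1GGEHH93CKRT GMdTobir GN0doEEQ8BMs#+ GKxxQGrLAHYp+. HUusYGk2; IJ4QvR5,8kw&'',
 ''HC9231F0 GfyW6-XR GHLyBJn1 H7/Ej+ZM4'', ''bL9511E0 GJNS7yBo Hq#y+ngZ7DHKhl'',
 ''DM9431B3 EVJGAggI G3+yqf-0789CNZdhlx;='', ''h|M620L2 FOWZZK8X G!rxpKeD2GN$'',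
 ''C04731H3 EhwSnnJG G4q5+fl&0279BKWo'', ''X49611L0 GZshG-iC'',
 ''B14731H3 EaHDKKCB H!vHI#xa158L'', ''R18731H3 F75c11F6689EGH GjFPWk.t2D'',
 ''a05131C1 FZZEW6OJ EmmMguAVNf G6gR&=Vb78ABHKhiklqu'', ''IH9631C0 G-UlujSo'',
 ''ADM631L2 ELRxxVrY027FIQUX FX1ccINN3 GTIswLvv3Qo+'', ''aAL731H3 EBJ6II1A03ALp G+apmqsCAx'',
 ''X18711N0 EMKK49LJ GVQmN#+F7EKLRafhtv'', ''B26631J0 GfriPxBT'', ''bL9631E0 Gc2E;iZ+68HJNbkm'',
 ''A1L731M0 F1FLccPN38N'', ''a1L731K0 FCT6QQHR0J'',
 ''a06321M1C1G1E5 DaaXXLkO0358OWYc DFFCCEE67G Ebb9JPUa025AHIKMRSVct EBE661DN0GOPRXaw ELLrNSFJR GPXfs..Scdklpqxy'',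
 ''A03631M0 EH4KjPMa Fa53J10Z2CK'']"

definition certificates_7 :: "string list" where
  "certificates_7 = [
 ''L18631O0K1 DNWWRMOE02347EFIV EA5POO4g38GHb'',
 ''A@M531M4B7 DOO3WDNi0249CKTY EIdXOXO926Hj FFFQDWVB67GR'', ''A0M531M0 EZa9CKCW7AFRYx'',
 ''a0M531O0 DPP1gAUj08'', ''LFL411K0I1 E88KVMN5 EZZxVEK6DMQT ETTgNAZaJ GYsVFATK HsUK3-VOGNSoqy'',
 ''aH9330L1C1 E9XI0cJE FNWQJT6M F5IOJF890BS FFMIWVBUD HSYf-sB.3HIJKOPQRVZcquy GOB.RX4g1Paz'',
 ''PFN620B5J1C2 EVIFGH9J EHVK93gG0DIKMTabw FEVN6CFP3 H4l.3bRU127BCHMOPceh& GJ7:wIEB9r'',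
 ''bLJ701J2M0 ELYXSVNH ENVjPXdMACIJKLU Gbs+T&4XCLPSa$'',
 ''L14630I2N0 FIV9HKOS EMWHTTJV FO5SA4FI179BXc EMIWFF6UBT EVkJWWoE1 GC.0FGPR16NTUWXZb$ HY-scHzTJh'',
 ''L1L630I2N0 EIJB1wVF FIXOT8ca0235EHMN ErgQ33NJAF Ew10EEBpO HUzCQX$47BKPl'',
 ''C03631H3 E5cI4AOF FJFd55Wa349IVbc EUVNGfP6F Gp3DZKk27H'',
 ''PNK421L1 EVLFfH3N EJERAt2V05NP FNJ1662RBC H#ZzvyXKRT'', ''bM8721E1 EX8PNc43'',
 ''dL6621F1 EX88FIcK GsUV9eSo0467DGRnpq'', ''aHJ711L1 ESB1wbGP FHIMVaY2S GB+RJpgKNb/'',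
 ''D16631G0 EVPGUjOF'', ''R49631M0 E9HCK0jI1278ABEN'', ''aH3631L2 EBSbw1PY FQJ9WWKIY G=fT;Qjw2C'',
 ''BFL631I2 EVG4PjgE'', ''L1L631N0 FFDWYbVC0137TXa'', ''A07631M0 EVYLMHDx'',
 ''aHK631K0 EN76LAC11389DFRc'', ''H3L631N0 FYLXXERH23D'', ''b6L631M0 FTXYWWN227'',
 ''h4M610G4C1M2 DCC66HON EEE6TZJ927CFHIMafr E9J11xa803AHKMNVZt GVUzw:s+34DEmnxy'',
 ''013511N0 EKH89M3X EWMZUJ6929FYd Ew9BJ0aOp HpXZ,vzn378Ci'',
 ''Q1L730J5O0 DN1jccPW DOeYiihXX ED5BO18K9CEGIJQUWcdwx EmV5MMGiAOp'',
 ''a0N710E3G0G1 DYYiOkkL DUUEEbbi7V EffTHUwB01269JKW E5WMJkkj017CQRYd G7K,,Z.P46BEHfns'',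
 ''a87630L1 EV4KPjJa FNP1VE3a4CM FOJW55GU0 GOaqR6e95P'',
 ''L9L630N2K2 D5DDO3LF D022CCZZ6BZ E6NUPbE328ACGKLWXdfj EL22GUNNKS EK0ZTTQQ6O'',
 ''18K630K2 DOOCYiAP FKNQDVC514RU'', ''b14731O0G2 DEEBFFVZ013ai F55LO1AYIN EFLmiiVu37'',
 ''h2N611K0 EJI9bBMp048ADFLmo'', ''h9L711G2 DcjjNdkA024A FbcWYFEB1T'',
 ''a0N711O0 DAA1PZCB02349DF Ej5CCk4W3u'', ''a8N711G0 FLIVOc7b03479N'',
 ''L9L631N2 DH55FL4604BP FAEB66SS8F'', ''8|M621G1 DWNOOYg50'',
 ''L8L511F2 EIXXdTOF GSxrm4IO7BKMPQVWhipy'', ''P8K511L1 EJ9bbIgM G63h.5/M4BEHTUlw'',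
 ''08K511G2M1 DZZmmaYX18OSXf FE6NNZDO8BIP EXX8Inah23'',
 ''IDL631M2C2G2 DAAZZNCP02349G ErrRJWgg12MU ESTXXNaa1W Go2cOXTT1Anx'', ''H26631E0 GGHL;6bX'',
 ''L8L531F2 F155F8c226BH G3N0LIKk2C'',
 ''B67520K2M1 DCAZO2CA234BJ DXUEddXUA EJrgaWRr12 E5ko0351BI'', ''H4M631G0 EVxLLSEg58Hm'',
 ''h4M631G1 DZZbbiAJ25'', ''S86220K0G0 EMLFVK9I EkHMVjsI679Co G75LYfRJCE='',
 ''EHL531D3K0 EV9JbIgH E3J9awQ5R Gf:Qh7pW1Cj'', ''0L9511C2B3 EVHMjJU9 EVIkOj5s0 H.2lTXMp47AHKh'',
 ''Y28530N0 ENKVJDMX E7PBDbO5IN GXmGlJ$CFZ'', ''H87621J2 EVHGjCOE EB1DwSbOE GUK9n+4FZx'',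
 ''b8J711G0 EFVgGvTw'', ''045131C1 EJVNIAO6 FFVOP5HSL H1UYBIFJl'',
 ''WN0221N0 ETxRJWYE HdS5uj+yY'', ''B82731C2 ESw91nab'', ''I0L731G0 F9E8CXAR13ORUV'',
 ''D8J331F1 Ew1S4Jvf H+jT2rF#8'', ''dLL531K0 E3w91HEn248Ans'', ''60M410G0 EEJraRI204578OPWY'',
 ''P1J731G0 Ea9BIKwR5AEd'', ''D4N631C1 FOFVPSW3367B'', ''d8N531K0 F4c1LGK63T'',
 ''0E6721I2F1 EJMNV1m6 G&#wi1FIEXb'', ''047321F1 EIVJOsjW FB9RRGHWFIQ FbJWEcIdL'',
 ''Z>6300G1E3 DRVRMONW02347KNOa DLPLkZZa0 F6B9Q55C2EHKNRSU FSDS9WWRBKN'',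
 ''h9L730G2 D3OODNGA01249AGP FIFXc067PT'', ''a06731G1 DOONWDCj49BK F9EAJ88G6Q'',
 ''dLN631K0 EpBw1mVa0246V'', ''hLM631M2 DOiYYmDe2CT E4PAjtSO7k'', ''H|M631G2 DWKQQ8PO2M'',
 ''h|M631G1 DjcNNE9R0'', ''A@N731E3F3 D44NHTJI0257CEI E9TZZ0HH1g'', ''A0N731E1 F5EAJ88323HL'',
 ''a0N731G1 D66CCHHJ03'', ''QDN721D3C1 EMaKHmAI EJ6EEA7I0 Gbicd4w56A'',
 ''A8N730D3C2 E9MHKIw1 Eg833NTT9 GQ8E7XVxi.'', ''a4N711G0 EUuPjRKx0136ACJm'',
 ''aHN731G0 EjokVsUh015CF'', ''D|N631C2 EDOO0K1112'', ''a8N731G0 EGMHVuhA0'',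
 ''18N730G2 DLLWPkE70167KY FHXdTY55GI'', ''8|M631M2 DLWPPU3j0'',
 ''iH2710M0G0C2 ERVJEFaI EjMVHXkI7CFUY EVBPO6jUEk HKMsluIkGJNg'',
 ''@CL531A7G0 DnUKlbXE067EIOTZ ELV2AFNK01349CDERc Fe4JIAXK0D GoT1O+.W5P'', ''T|2530K0 EWbJ9FaR'',
 ''@99531O0 DndCjA8J03 EYXRMcWL1i'']"

definition certificates_8 :: "string list" where
  "certificates_8 = [
 ''fZ5700M0 EjHlcVko0A'',
 ''L45411B3L4K0M0 EJI9F3Vw F71LJR5B EVHMdXjIEOYk EctnJMAX5Ya E4sjIVXPHk FRBLGcUYb GMOUXf&u1Ndntz#,; H&CX/,Z8P'',
 ''L16621F2 EVJxRaIL EJ1VGSwN5ABHNPXgp EIcM4POJWj HY.W2A6sXd'',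
 ''dJ3031@7K0M0N0 EMJV35HE FMVIdHXF E9HK63ZM27NU EKHaNV8CLP FVKM1LJ4Nc GBH.zUXP478AGKLOdy GfQ7Ib8NAV'',
 ''F14531H3M0 EJM365Iw EIBKDaOM06AHXY EVI39FJgN GpKSx,tBHRU'',
 ''P59630F4 EVMFHGWO F1c2L7bJ45AB H2HkBpPz0IQa#'', ''aCL531G0 EK69HZME'',
 ''IBL631L2 FWPFOVRR EG72U61HAJT H;U9i,uleg'', ''L8J611M0 EH9aI2C7 ETaHK8fXCGt'',
 ''K|4121G0 EXOVIjsM FNI9JCERb'', ''0FM431N0 E92IbJU7047DEHOY'', ''h2L311K0 E9aJ1RHo FYbDS2WPXa'',
 ''PLK621L4 EJRaEVHW HSsTk,9N3$'', ''0IJ721G0 E90JwKVX'', ''P59631M0 FJNb1aD989MO'',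
 ''0|M521J1 F7D2A6ER0W'', ''04M510C1 E1wSBGpV EJ9bwW3Q'', ''045511M0 EKMV4LXF FP124U56RSc'',
 ''P4M511M0 EHVjGdF9 EH93afIG4CE'', ''04M511C1 ES1GwF98'', ''HFL631C2 EwS1B7vn'',
 ''h>1501C1 ESG1nBw7'', ''hJL531N0 FZdE6X3F12ADFK'', ''PDM531G0 EjHCdt9V'',
 ''H8K631M0 FZO3WTaE4AEG'', ''04M531C1 F4GAc5bd6T'',
 ''@35131O0 DnWA3POG DnELRFVWMP E1ESBGDw E1w47SB58IOnp'',
 ''jG8700G0 E4cLK2At EGEKULVx8JMNPf EYXOWPc4j'', ''@55631O0 DnSPXU4L0145EHJO E4s1XSj5239CHLNq'',
 ''4AO230K0 EuMG5m6709DEGNRWp'', ''@2N331K1 DnXUbShK0EKO EtaAcC8n0137BDM'',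
 ''|B6720E1 EE1DKSwB258KPf'', ''@LM531G1 DnZmNYEb0149K EDOcVRKB23568AF'',
 ''o40701C1 EwOVDopl235Fms'', ''@|M531M1 DnHNgEPk0 EAtJc5PL6K'', ''lDO131K0 FYcb46X139'',
 ''055630N0 EVFDLK51 EAtN2LnXCFIPVn'', ''dLN321F1 ETaH9rgI FSI9BP46O'',
 ''X8K321C1 EJaRAHGN E2AtL4jF8JN'', ''RLJ721G0 EHMWY3QV E2ANL9dtF'',
 ''1G0711M0 E7l1B5o4 F132P7O6B'', ''09J730F1 E1ESGonc0258ALMkp'', ''055631N0 E1E5G4Qk289LPT'',
 ''L8N631F2 F6N30XBB12HKP'', ''d8J331K0 FENVDXL22345BCHU'', ''BON601I1 EaAGSIBJ08DGWfkm'',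
 ''h8M331C1 ECtaj80k1246B'', '']N2430K0 E591GuEJ68BLNPUZ'', ''0IJ731G0 E2UFG6Tb15ADK'',
 ''P|K631M0 EKMUVDba03'', ''09J731F1 E26FIU5nD'', ''O@7320N0 EKJb1ta9'',
 ''D8J731E1 EJ9I2bMq08DOh'', ''049731M0 EPjVuNkw02'', ''@83731K2 DnGKAA6l036 EtaAC82c013BDGg'',
 ''H77320E2 EALmm6Ng048BG'', ''@BN731C3 Dnkc2aaY3Y EREDcGoJ0578FPk'', ''D0N731C1 FJbWYEE1014G'',
 ''@2N731K1 DnZBFa0f1 EVFLKGvj6C'', ''|D3331G0 Ev2F7JGL0a'', ''L45631K0 EaI9XdBK'',
 ''HJN721K0 EIM62YsJ'', ''LHO630K0 EPVOFv4j'', ''h2M331K0 F530AaO96DLMPQXb'',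
 ''hJL731N0 FWURJBT202ST'', ''P4M731M0 EGE1RS6i08H'', ''H8M731C2 FPVEFL2223G'',
 ''04M731C1 FAJ594bZL'', ''@67631K1 DndXBFMh0357AHO FSRPOIY4036EKNb'',
 ''nAM131K0 EfGARgUE058ABFYw'', ''@|M731M2 Dn6KCbf30 FTdXH8QQ1'', ''1?M201N0 F9XRABF73'',
 ''0|M730C2 E9IJc1lu0678NUYf'', ''0|M731C2 FKaZHQRAA'',
 ''055510N1G2G4 DUXEXEON0347INOSW EGgUV2N6 E5FAF4VP1237IJKMNOScgjk EVIjFPS45BJKMOXcks F7D525bJFOa FTHO9WCFG'',
 ''056700F1 E9c2I14G EVNHPFZT E4P5AGVF2HJLScfgj FJ9NR5C306H E71M529I4 GRC6aB18Sd.'',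
 ''VG8431M4F5N1 DPLZZAaW EgA9H3aN ESaPj4HI9BXYbcdks EFTtA2aZCK'',
 ''bG4631H7M2N2 DNcaZZjk EJtHMVAC2469DEGLOUWYn FSObDYIG49BL'',
 ''CFL631H7K2 DOLFCCWW0235BJKNW EVWTHfOJ01479BCDKNUYgrw EKOWUM0D4JXb'',
 ''TZN121K0 EHa9cTXP ENgVIAa6CFHam'', ''8|M501C6K1 DZZ0AD15234CFc ENbJPtjn6MSXYs'',
 ''Q4N721L3 DA0ZZ1DC246CGQ EMRWYuGILOQs'',
 ''08K330G2M1 DXXladmZ0189AKMOj FOFIW59R023DGZcd EXXI8063KOa'', ''X9J721F1 EaIRJOD8'',
 ''14N721G1 DhSXXfQb1Z'', ''0|K301F1 E9Ha31B5 EM5J4HafRTWXY'', ''056721F1 EHPMV9c6'']"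

definition certificates_9 :: "string list" where
  "certificates_9 = [
 ''TFN421D5M0 EIVOdXNF EbWJVLFU12DRfivx F5O8KMV3C HK#ZGi;U1Hfl'',
 ''bN6621E1 EGHaS1EK FECFdXN53DJNP'', ''X13631N0 EJV1MHow EB1OwS5PQU'', ''TFN431K0 E415OcBG'',
 ''BM8731C1 EVl1oDJH'', ''b92731G0 EYRFWDLv013AHQaw'', ''dL7431F1 EWUMjdk6 EJIaXENBr HOGXd6$,Dx'',
 ''0JK131K0 E9H3bKgP'', ''HZK231M0 E9K02LwI'', ''0GL531N0 EN8bgJ3K012BCGKf'',
 ''hJN721N0 E62IBLNG034GRc'', ''Z76210E1 FWFHMXDY'', ''L4M631K0 EEJ1IBhT348AH'',
 ''P6N721M0 FSDA9XNPLOU'', ''h|M721C1 EGFi2muN0C'',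
 ''055511N1G2 DAZCZCb601237KU EKaM8UtW E4fAGcVt1EKRXj'',
 ''HGL631L6G2 DAPCCI1101249DG E1GwBpE4579AIQmnx'', ''hZM131N2 DNEEOfWi034JKT EAtag8mr9j'',
 ''d|N321F3 DACCFP1E0579DEGZ EtA2LCCV49GP'',
 ''0F3631N2N1 DOCCWN6I0237ELNUW DUXXEEOO3 EaI9CC221BKM E3FFEEIv9w'', ''X2N721E1 ENLrP27X03CKQS'',
 ''D|N721G1 DAZZaCCP139G'', ''06K631K1 DNEEZZG81C'',
 ''8|K301C3M1 DXXUdWPM DXXhOEfNEW EJM5WjCd1679EFKRXYau E7AL5Ex06'',
 ''8ZM130N2C3 DAZZPNgU DICCU6EE7G E1wBEpXT34679IOPafmnv F4Gc5b30KU'',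
 ''dN7431F3K1 DACCMddO01237Md EX4MgNT5 EokVw11Ifs'', ''0|K710L1 EURWGjZC E9Ic2dYWAL'',
 ''8ZM530N2 DhXXHlNW05EKLRTe EfUGwRpm6F'', ''14N711L3 DNAZZW1Q124DL E7UB6HR9NO'',
 ''N|L631M2 DSFEEUQQ145I F12U6BJJ3K'', ''d|N711F3 D0ZZmeDi124 E1wSvmxA0I'',
 ''08K730K2 DZZNmBOi149CFT ENrgLPGq6Q'', ''h|M711C1 EJERq2N7048Yw'', ''4ZN531K1 DXXa8hCB0'',
 ''aLN731L3 DF2CCLSR01E E5X4MFOEHf'', ''08K331G2 DCCAO6GN017D FIOSV2AH8c'',
 ''X|M531C1 FHVKP0SC017BJ'', ''8|M531M1 DEEfNhji0'', ''L8L731N2 DUEEfFIb0I EkoVEl5WKs'',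
 ''H7K430G2 DCIA8aCF0145QV F088NGX8FI'', ''b=K031K0 EVLuFvGT36D'', ''08K731M1 DZZ0aADF4'',
 ''h27631K0 Ew1Spo9F678HORXf'', ''49M700F2 ERWDFYsX0136HQaj'', ''0|K711L1 ESLFYaZt01367BD'',
 ''L8N731F2 FXYSRH0E01HO'', ''hLM731C1 EHfTGrMw8CZw'', ''HZN731E2 F6QCET2202'',
 ''h|M731C1 FJVNM3922'', ''D|N731C3 DOXXSDiC9D'', ''d|N731K1 DGEEUK3Y0'',
 ''8|7721C3 DEEFVZZ515DR FJ9RId0LCb'', ''8|M731M2 DZZNaOlU1'',
 ''@@O731O3M3 B11000000 CG7888880 C2G555550 DEEN7GfF03456J'', ''@0O731O1 CG13333B0 DPWLLLLU0EK'',
 ''H7K530O0 DWLLL0PL02'', ''DAN731A3 EIF9ZSiV0457BCDSm'',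
 ''@CN731G3D7 CG70688818 DPAWL11105CK Fac0d1Ib67D'', ''zLN221E5 DF5FLWQF01DJM EsXcIB7SGRj'',
 ''z0O031G1 DYiVOYY303T'', ''@8O731O2 CG8777C61 DNcjjjEH0'', ''9=8431G1 DigOYiiF0'',
 ''08O730M2 DEENFfD1024ABJ DFL555dMBJ'', ''08O731M2 DKQWWWCg1'', ''d16331F1 EM7JAH6t'',
 ''DEL731F2 EUGbSBRf'', ''B83731I2 EVO5pPFM'', ''b26731E1 FF5MVC0U129LSUac'',
 ''P4O721M0 EaHTCIVA1348'', ''d1N731F1 FLBVI7R003'',
 ''@93731I7H7 CGFEDDBB0BD DnNfHWJY25Ki DWNROOMM024 EVPkHNoI1238'',
 ''DKK531L5 DPW1CLAL029DGK E395Xw8HBG'', ''o60630K1 DBDOCC3D49NR'',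
 ''@3N731O1 CG7FD88A0 DWPONLLM07'', ''962331O0 DHON42WH01'',
 ''0GL730J3N1 DNO4HHYi E41XMsBwEHKPfjmoq'', ''hLO701L3 DWKQQ9P601237GMQ EiFLIgmT67'',
 ''HGM631L6 D4NJJLHH0EFHIJ EMmYIs5u0267DGHK'', ''09K730L3 DRWVMMEG023FLa F6MCIU80GS'',
 ''093731L3 DYifOOQQ1ETg EHjldPoo8A'', ''0IK731O0 DLWePPjQ25MS'', ''P9K731O0 DN4ZHHmj18E'',
 ''09K731N1 DPgTUU4G0'', ''hHO731G1 DDO33N7N02C'', ''04O731G1 DFL55BkG0'',
 ''@|O731G3 CG3112D20 DNjccWE40'', ''>B5731G1 DejcSNeN3'']"

definition certificates_10 :: "string list" where
  "certificates_10 = [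
 ''X|O721G1 DUgPPC2b3EHK'', ''0|O731G2 D3DOOGdm2'',
 ''NGL631M2O0 DZZLF5AN DgPjcNUU19AHIWY DOi1APYYCD DXXcjNSa4 EHaEqD9CIdjt'',
 ''293731M2 DXX3UdJB029AEF DWM9RRj37K'', ''8|O721E3 DiOYYlc50F'', ''8|O731E3 D4NHH8e71'',
 ''EAL531@7 EHXa8TdM EJcWORItBPUX GYyidg-f3479ARWb='',
 ''TE9431F4F1 ELSAXN4F E9KIDcVZ0146BNPk FF5I4cM0Ka GFqTJ.+U1OVf'', ''C8J721C1 E69aI3QN'',
 ''119531G0 EWVbFJL004'',
 ''059310N0J1 EALP24VG EVHEKx38 E3Ff5wVJ19GHIMS EJNEAR62GPrt Gb3s5cNuDXi+'',
 ''067101J1 EJMI114B FHVKTTN80EGLa G-uYoAc. G1Q+DU#28AEFdhk'',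
 ''j38311G0 EbYTgHWV EIMpcmVA FF5EdJCa3Z'', ''I2M231L2 EHbYaSPC EG6U4MES7FYb H+O$g-F/M'',
 ''T36431K0 E2AGH7PR EaTSYHWI3BJQ'', ''C45631K0 EMgTVHmW FVT9NJOK5LZd'',
 ''R65431B5 E9cPKHDb EPBaVHpAcmo H,h1SzeiHPw.'', ''eIL531G0 EKsMY4Lq'', ''EDN631C2 EHLVNd7Y'',
 ''FLL531E1 EIMm5ik6'', ''C8J731C1 F1OF52cN9ABENS'', ''R58731G0 EcX54O8R2679Tf'',
 ''X3L531N0 EOCdWHZI128BDRt'', ''83L531N0 E5CA7t699K'', ''UE9431M0 EIf6wB3V E1V4ISMo EoOE510pBw'',
 ''059311N0 EJWEb1QS EU2PGBA15HIag'', ''8ZK230N0 ENAP62H3 ECaHN8Yb35r'',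
 ''L|M630L2 EnwSfGtc EXISJwTT4Nc'', ''067511J1 EHa9jGt1 FXSYTE9LQW'', ''l|M630L2 EwBpIc05'',
 ''W1N510G0 EPCTZj6U'', ''0NK431N0 EPcAujmR0179BCEK'', ''dNN431I1 EHKM6C3L1ABDGJOg'',
 ''836631N0 EwfpBUTc257Jcu'', ''L|M631L2 ED71AmYK36GK'', ''hNM631C1 ESw1LxI03DHI'',
 ''8ZK631J2 EbNg9dT5D'', ''QDM531L1 EaYHSCLR GSKxAy6eG'', ''dIJ331F1 EPVBINUk'',
 ''I8K631L1 FN7D6BVT0458CS'', ''14M531C1 EjAPtV2w0Q'', ''A8K331L1 EVRxoGLp'',
 ''d9J331F1 EA471c2x08FHKNOo'', ''0E1731F2 EYRbDSJU'', ''hI9731N0 EosVqIln01KYt'',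
 ''D9J731F1 E15x8mES29I'', ''059731N0 F9QRKBN22O'',
 ''XC9431E1F1 EHM3C65V EIskkooX145 EG12H97SYb Gftssldv4Bqy G#yZISSU3Jnw'',
 ''hK5431N0 EaJJTWH5 G5#njvWZ02CDHKOdhlmoz!'', ''T1J331F0 GnQ$k;Ce'',
 ''a4M331G0 EGo1h4Rn07AFWknt'', ''A07731I1 EJTEWrah'', ''Q0K731K0 E2a9AAH608DEF'',
 ''bL9731E1 E7MY5DDu29GIS'', ''B|9731I1 FOVEG8ZS12R'', ''b|9731E1 E6NJZMEiOv'',
 ''lML630F1 EYDHK9sq EN6VIkdQ2LWa'', ''033331N0 EcX9R4dJ ENCPXZO4b'', ''QFK631K0 EI5MaSmO'',
 ''aJK331K0 ERPcGrYu'', ''83J711N0 EpwoV01C2346FRTc'', ''49J331F1 EOCct5Y212BENY'',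
 ''X3L731N0 EKQLVr3Z012d'', ''JZL731E2 F1LO2V44034B'', ''Q4M731C1 E40X5S9l69NP'',
 ''14M731C1 FDXNYV4BB'', ''0FO511N0 E154oxk8'', ''[55310L1 EIDtBAKa'',
 ''h37631N0 EZF9x8Tw46BGRbgt'', ''hJO631N0 FM6UHCXZ1JZ'', ''D|O631E2 EC6ZQOjj1j'',
 ''d|O631M0 EHfGw9j65'', ''8ZO630J2 EREo26Pu0459CKWk'', ''49N731F2 E0EOQTUt4'',
 ''L55631I6F6K1 DWMO7DRN ERoUpBEWMQYachlx'', ''hJO511M1N1 DWNOQHK40135EGILO EVHMxdEd7I'',
 ''d|O321K1 DP1ADgU70269CHIc'', ''067631K1 DWNOKQjD246CLS'', ''055731O0 DWLQPKeS12568M'',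
 ''0CN731G2 DFLCC5Jk0BJ'', ''P3N731O0 DUgEEPYX0I'', ''03N731O0 DOiWNYVF0'',
 ''@;K331O1 CG6170380123678 DWMNLROP0123457'', ''3O9601O0 DkSWaLPF0148BFJKY'',
 ''@=M731O2 CG4341820 DNZWZOHc7'', ''?M3310O0 DjE5ESLF0'', ''0=M730G2 DWRKMQAZ123678AL'']"

definition certificates_11 :: "string list" where
  "certificates_11 = [
 ''0=M731G2 DaZkZLU41'', ''455131A7F3M2 DOWDL3P5 DH5NL4FWO E2U9jIPd4AFJKMNOWXt EdXQIWca4H'',
 ''Z|9721L3 DjNOciYd01348ATXf EDOCBjtYb'', ''F|N721F3 DWLkaONM057KR FOL71IS8E'',
 ''45M531M1 DFB5ZLZK16'', ''467031A7N1K1M1 DLPWH5gN DDO3P1W9AL EKVHrQNT03689CDFGOWX'',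
 ''F92731B7E3 D4NQWHSS015EHILSW EIBo16sV29FHUXY'', ''j34731O0 D4NlTcHX0157EIKU'',
 ''467431K4 DLWPEFNA Ew19Fv5cDn'', ''e16331D7F3G1 DOgWPYYL EKEU60VB EbKN8U9X6'',
 ''j65631O0 D1PLD5Aa'', ''J6M631O0 DNc24JjO15DE'', ''49K531M1 DRW2OMCj19'',
 ''0G3631N2N1 Dj88NcQa01349CLNc DfYYEEgg7H EEX6GhNI03478BCUYcn EK4400AjHL EgbGTrSSR'',
 ''0GN721N0 E8xdXaRZ'', ''A8O730L3 DNejjj4H0145EHIj EIQOa6Xs2579AV'',
 ''aCN731L3 DNhcjHHf018JOR EHBTTP7I45'', ''dNO431F3 D1AP0DDG249CEc E4XsF5Gd7R'',
 ''P7K631O0 DF55CCHE07BE'', ''a3N731G1 D8SCCQQT17'',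
 ''iJO511L3 DPOWU3gD DN1c4AHPTg D7mMEZEZ0F DOUX3PDg19 Ep4cwsBj9DYt'',
 ''f|N710F3M1 DAPLWGGE Dj8CCcc16 EGEQ64F58AIKLPTUWXfi EPAtaObWIj'',
 ''fKJ331J3N2 DWL3BPOF DPgDOU1Y3Xi EaJZxICE5BMOQX'', ''C67631L3 DWkcRMLN D7WPEEMTF E2JMLFt6C'',
 ''c|7721G1 DPXOUA1i'', ''G8N731G2 DZPLWAbB0259CM'', ''83N711O0 DRBWMFZ5012357K'',
 ''lZO231O0 D5FLXSDU024BDJU'', ''h;N711G1 DMIRWC7F07D'', ''16O631K1 Df8QEEai1'',
 ''2|3731G2 DWKbQRZU168LU'', ''F|N731E3 DCFEEA8I025'', ''0GN731G2 DWNRMPjZ34K'',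
 ''f|N731M1 D3BZZJGQ1'', ''8ZO511M1 DUgPEYVm017HIMOR'', ''867631K1 DjNcdXE10148M'',
 ''XZO531G1 DUgPIHCX0EH'', ''L|O631K2 DiOYWMbb03T'', ''86O631K1 DNcjEF1X0'',
 ''077631N1 DPg1LWHD0249DFHK'', ''H>O631G2 DNWO4JEZ1c'', ''07N731N1 DYgOikPl0'',
 ''8>O321N1 DWKQMHgd0147AGHL'', ''8;N731N2 DNWH4K900'', ''067731K1 DUPgbE9Y01HI'',
 ''8ZK731M1 DMRW7VNl0'', ''0FO731K2 DWKQLO6616L'', ''>6K520K1 Dc1ATgPW09'',
 ''06O731K1 DPUgT1ER0'', ''8ZO730K2 DOD3i0IM069N'', ''8ZO731K2 DNcjH1XG0'',
 ''@>O731K3 CG87C54E0 DGEEAKAA0'', ''nAO731K1 DWRaB2MB1'', ''L>O631K2 DSXX2R4Q14'',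
 ''0>O731K2 DiYOTeZH1'', ''[ZM330G1 DPiY1OZA'', ''m93731O0 D1FPB5Ag059GYc'',
 ''8>O721C3 DAP1GH4f0'', ''8>O731C3 DPUgTKCj0'', ''55M531O1 C949494006'',
 ''[39331O1C7O0 C4114334013 DNl7WTTO36DEHKLMNOWXcm DQAAWCZK0268BNOb E5NW5bZ46LTU'',
 ''nOL631M1 DjdWKQeX169APUfhi'', ''G|N731G3K3 C244455505 D24NH0005EI'', ''g|N731O1 CB999EEC0'',
 ''|>O511K3M3 C444D3F1013DF DOD3Ic4259W'', ''|>O631O2 C444CAE90'', ''|>O731K3 C4449D7D0'',
 ''CA0731K3I3J5K1M5 C5552222025 DAAACZd102DM DZ9Mmmmm037 DVVVRiiR2O DhhhHHRR24 DKKKbWbWLU DiliTTTTO DC44IIIIH DPPPWWWgK DIIXUUUU4 D111ccDc2 DYYYgkkkL DdddMjMM7 ETV3EgHF0569DIKNWar EHRSYGYG12DLMV F6JXEEMM4578AC F2L5O11O34IPVc EJJQaWrE19MNO ERLLrYx27NSV E4I4McSs15Aj'',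
 ''QHK521M1L1O0 DRR222CM167BIW FPPS2FIH067ABCXYb EWcYYYSO49FJPQ E77HH53LGK FVVMFF5LBQ Eaa9t9cQ03 H-sWKg/O236GJPQUXqu$'',
 ''X39431N1 DI444NSC02CEFMOQ FPEFHdCS7ABDJY'', ''c18731O1 C888777C0A'',
 ''YC9431L5N0E3 DW1NNccP D0B22RRZZ F0SKFDDX4589BHIMOacd F70DDNK5134689EHJMXa GRKm!xpU2FGNcko$'',
 ''C14731H3 ERATaa2E Go;Ac0W.78CEIJLXZdei+,'',
 ''S=4720G1G2 D3Z3BOiO01FTZb EwbH9fuf7BYn FH2HPMJ98X'',
 ''a07331G1C1M1 DHH44ghI05CIPR D00eeQQjK FJGNNbAQHI F33H5NZM89 GnSzO55R2NQT'',
 ''T5J631F1 FTOOZQSH07EH GQ;scxW10J'', ''18K531M1 Dee00hQE17'',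
 ''iLM630M2G1 DHYggUNO DZXaaLNOW EdTXWM9a4EFNORSUbcks EGaHH7F81AR'',
 ''a27331L1 EVBDHIpY EK2L8UUNB G5Hni6b!OQ'', ''839331N1 DIMMUdmE049AFPU F1a5L00VAZ'',
 ''iLM631M2 D0LeeiDa24FT EQ8a3HONRw'', ''L9L731N2 D966H73303 E8KX0MxtDS'',
 ''a07731K1 DYYOkmgC0239HL EBVDpppq6F'', ''bNL731M0 EHYbPPCs13DJ'', ''l9L731K1 DmYYgkZ11'',
 ''A@O731M3N5 C660000001 DeeLjh0i258HO DLZaaaaa05'', ''A0O731M1 DXFSSSSa058O'']"

definition certificates_12 :: "string list" where
  "certificates_12 = [
 ''a0O731O1 C887777A0C'', ''aHO730L3 DYXOOOgU0EHOSf FVBFLGJ904Y'',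
 ''a8O730L3 D2VRRRc1013AE E9CZ0a2v8EW'', ''aHO731O0 DjieeecT38O'', ''A8O731M2 DSH444XF0F'',
 ''a8O731O0 DOMWWWX40'', ''18O730M3O2 CDDFFF13013 DffhQEc107H Dh4HHHiVIX'',
 ''18O731O2 CEEBBBC61'', ''l95131M0 EIVBjDsU E5089X1aBHScx'', ''l;N620E1 ELFrQWYc'',
 ''C83731H7 DGWPKKAA039AKLM EMiGImUH357AJOWb'', ''N98731I3 DiOKWWbV036ETU E54uKPmJBD'',
 ''Q1K731O0 DOHCNN6D0BDg'', ''14O721G1 DFRBBC2Q1K'', ''835131N0 Ejt4VcJG ETarFJ8LEPXb'',
 ''U8K531K0 EPaBQH6c'', ''F|M531E1 EG1x7RHi0FIgmw'', ''83M531N0 F4KSG9Ud3E'',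
 ''14O710L3 DU4IIPNW E3B6wFOW01279CEJMNSn'', ''45N710F1 ESGI2buP E1BGUoIs9Ml'',
 ''07K311N1 DeLL00W20125CKLh E4fX5PTO1378GNSUYbjw'', ''l=N701F3 De00ZTiP134BLOTh EXd4jw0JAGQW'',
 ''S8K731L3 DRdjMMeB1238A FCPRHFJ60G'', ''4MK631F1 FH396MA0012AFPW'',
 ''N9L731I3 DR2Q00hB18BC FGOdTZbb69'', ''a97731O0 DV8EaaiF0OR'', ''87M631N1 DXOUUP3K0'',
 ''456731F1 ENLXYC7I347PR'', ''I8O731G2 D3KGG6BJ06B'', ''14O731G1 DkVaaciW0'',
 ''dMN731F1 EDqRxK7s37s'', ''45N731F1 EcDpBnqF0'', ''D=N731C3 DlTT7XKc0K'',
 ''d=N731K1 DMRRVII00'', ''657721M2 DQSD4fQ724HY F53XZ7Hc9J'', ''4=N731K2 DGKKbEPe2'',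
 ''9|O701G6M3 C7788066016 D0KQQ1Pc69NZ DffYEZbB7O'', ''9|O721O1 CAACC52006'',
 ''9|O731G3 C00669A21'', ''1FO511L3K1 DWSQNL4F DCWOA6PKLNQ ELMKAb5W09OPQa'',
 ''8OM521K1 DaLXVhRF'', ''lMM631G1 DmMYWOl70379Lf'', ''eIN731O0 DPcTl19k0249DK'',
 ''L=M631K2 DaXLheVZ18'', ''c|M731O0 DRe0h2VU1'', ''99M730G2 DAaCZ8RW0136KMWXj'',
 ''99M731G2 DOVNiE8P0'', '']M9531C3 DE3NB4ZG E9GcEpDHBw'', ''359731O0 DCU7I6EW0L'',
 ''333331O0 DeNQhjWf D1lMPcmWALNR DPYc9gkjU'', ''kKL731O0 DTFeiL4E014BGHNOW'',
 ''n?7031K1 DC2Q4NIS12EMNQ'', ''N=L731G2 DC639B8I027BP'', ''|=M531M1 DNjE87QB1'',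
 ''1FO731K2 D2e0RCjj1DJL'', ''837731N1 D9PjmLAc038A'', ''aNO731K1 DAMdG1ZW12'',
 ''e|O731K1 DXIUMSlk0'', ''8;K331N1 DWLQMJ8d01257ACN'', ''L=M731K2 DZABPRab04'',
 ''8;K731N1 DXhOaRD64'', ''9ZO730K2 D4ONJXP1012CEIPa'', ''|=M731N2 DbZUmIef1'',
 ''0GO731M2 DL5JWkHH0DJ'', ''83O731N1 DKlbGXm10'', ''_77310M2 DXHFFF4S0F'',
 ''b>O731M1 D4T7NJNV0'', ''N>O631M2 D0ZNK6D228A'', ''8;O731N2 DZmBalG11'',
 ''367731K1 DaD7XL3T024689FS'', ''|=O721F3 DYmiM5LA0'', ''|=O731F3 DM7RTgeQ1'',
 ''@?O731O3 B10000000 C78888880'', ''_O7710O1 CAAA4AAC0'', ''C>O731K3 CFACDDDD0D'',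
 ''0?O731O2 CDFFFFB80'', ''G|O731G3 C0BEE66616E'', ''c>O731O1 CF99DDD70'', ''8?O731G3 C0666B741'',
 ''93O731O1 CEFBBDD50'', ''|?O511N3 C600A8C70178AC DEF7WXQd56'', ''|?O631O2 C311526D4'',
 ''|?O731K3 CEBB928D0'', '';;K731O1 C91E93B404'', ''==O731G3 C71839EA0'', ''>?O731M3 C5263CF33'',
 ''??O731O3 B00000000'']"

definition certificates :: "string list" where
  "certificates = certificates_1 @ certificates_2 @ certificates_3 @ certificates_4 @ certificates_5 @ certificates_6 @ certificates_7 @ certificates_8 @ certificates_9 @ certificates_10 @ certificates_11 @ certificates_12"

lemma certificates_1:
  "all_certified 6 (trie_of exceptional_codes Void) tables certificates_1"
  by code_simp

lemma certificates_2:
  "all_certified 6 (trie_of exceptional_codes Void) tables certificates_2"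
  by code_simp

lemma certificates_3:
  "all_certified 6 (trie_of exceptional_codes Void) tables certificates_3"
  by code_simp

lemma certificates_4:
  "all_certified 6 (trie_of exceptional_codes Void) tables certificates_4"
  by code_simp

lemma certificates_5:
  "all_certified 6 (trie_of exceptional_codes Void) tables certificates_5"
  by code_simp

lemma certificates_6:
  "all_certified 6 (trie_of exceptional_codes Void) tables certificates_6"
  by code_simp

lemma certificates_7:
  "all_certified 6 (trie_of exceptional_codes Void) tables certificates_7"
  by code_simp

lemma certificates_8:
  "all_certified 6 (trie_of exceptional_codes Void) tables certificates_8"
  by code_simp

lemma certificates_9:
  "all_certified 6 (trie_of exceptional_codes Void) tables certificates_9"
  by code_simp

lemma certificates_10:
  "all_certified 6 (trie_of exceptional_codes Void) tables certificates_10"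
  by code_simp

lemma certificates_11:
  "all_certified 6 (trie_of exceptional_codes Void) tables certificates_11"
  by code_simp

lemma certificates_12:
  "all_certified 6 (trie_of exceptional_codes Void) tables certificates_12"
  by code_simp

lemma linked_1:
  "all_linked 0 (trie_of (map (graph_code 1) catalogue_2) Void) catalogue_1"
  by code_simp

lemma linked_2:
  "all_linked 1 (trie_of (map (graph_code 2) catalogue_3) Void) catalogue_2"
  by code_simp

lemma linked_3:
  "all_linked 2 (trie_of (map (graph_code 3) catalogue_4) Void) catalogue_3"
  by code_simp

lemma linked_4:
  "all_linked 3 (trie_of (map (graph_code 4) catalogue_5) Void) catalogue_4"
  by code_simp

lemma linked_5:
  "all_linked 4 (trie_of (map (graph_code 5) catalogue_6) Void) catalogue_5"
  by code_simp

lemma linked_6: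
  "all_linked 5 (trie_of (map (graph_code 6) certificates) Void) catalogue_6"
  by code_simp

text \<open>The certificates double as the catalogue of the graphs on 7 vertices:
  \<open>linked_6\<close> shows that none is missing, and the certificates themselves then settle
  all extensions by a heaviest vertex.\<close>

lemma settled_8:
  assumes "simple_graph_relation R" "finite V" "card V = 8"
  shows "settled R (trie_of exceptional_codes Void) V"
proof -
  interpret simple_graph_relation R by (rule assms(1))
  have "catalogued R (Suc 0) (set (map (graph_code 0) catalogue_1))"
    using catalogued_1 by (simp add: catalogue_1_def)
  from catalogued_Suc[OF this linked_1]
  have "catalogued R 2 (set (map (graph_code 1) catalogue_2))"
    by (simp only: numeral_2_eq_2)
  then have "catalogued R 3 (set (map (graph_code 2) catalogue_3))"
    using catalogued_Suc[OF _ linked_2] by (simp only: Suc_1 Suc_numeral add_num_simps)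
  then have "catalogued R 4 (set (map (graph_code 3) catalogue_4))"
    using catalogued_Suc[OF _ linked_3] by (simp only: Suc_numeral add_num_simps)
  then have "catalogued R 5 (set (map (graph_code 4) catalogue_5))"
    using catalogued_Suc[OF _ linked_4] by (simp only: Suc_numeral add_num_simps)
  then have "catalogued R 6 (set (map (graph_code 5) catalogue_6))"
    using catalogued_Suc[OF _ linked_5] by (simp only: Suc_numeral add_num_simps)
  then have "catalogued R (Suc 6) (set (map (graph_code 6) certificates))"
    using catalogued_Suc[OF _ linked_6] by (simp only: Suc_numeral add_num_simps)
  moreover have "certified 6 (trie_of exceptional_codes Void) tables d"
    if "d \<in> set certificates" for d
    using that certificates_1 certificates_2 certificates_3 certificates_4 certificates_5 certificates_6 certificates_7 certificates_8 certificates_9 certificates_10 certificates_11 certificates_12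
    unfolding certificates_def set_append all_certified_iff by blast
  moreover have "card V = Suc (Suc 6)" using assms(3) by simp
  ultimately show ?thesis
    using assms(2) by (intro all_certified_sound)
qed

lemma bounded_exceptional:
  assumes "bs \<in> set exceptional_codes"
  obtains k zs where "bounded_rows k zs (split_rows 8 bs)"
proof -
  have "set exceptional_codes = set (take 1 exceptional_codes) \<union> set (drop 1 exceptional_codes)"
    by (metis append_take_drop_id set_append)
  moreover have "all_bounded k zs ss \<longleftrightarrow> (\<forall>bs\<in>set ss. bounded_rows k zs (split_rows 8 bs))" for k zs ss
    by (induction ss) auto
  ultimately show ?thesis
    using assms bounded_codes that by blast
qed

theorem mainTheorem1:
  fixes G :: "'v::finite pair_pre_digraph"
  assumes "pair_graph G"
    and "pverts G = UNIV"
    and "CARD('v) = 8"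
    and "Digraph_Component.connected (with_proj G)"
  shows "max_nullity G < zero_forcing_number G \<longleftrightarrow>
    (\<exists>E\<in>{E1, E2, E3, E4, E5, E6, E7}. digraph_iso (with_proj G) (with_proj E))"
proof -
  let ?R = "\<lambda>u v. (u, v) \<in> parcs G" and ?ys = "[0, 1, 2, 3, 4, 5, 6, 7] :: nat list"
  let ?rows = "\<lambda>es. rows (\<lambda>u v. (u, v) \<in> es \<or> (v, u) \<in> es) ?ys"
  interpret simple_graph_relation ?R by (rule pair_graph_relation[OF assms(1)])
  have iso: "digraph_iso (with_proj G) (with_proj (graph_of es)) \<longleftrightarrow>
      (\<exists>xs. distinct xs \<and> set xs = UNIV \<and> rows ?R xs = ?rows es)"
    if "es \<in> set exceptional_edges" for es
  proof -
    have "set ?ys = pverts (graph_of es)" by auto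
    then show ?thesis
      using digraph_iso_iff_rows[OF assms(1) pair_graph_exceptional[OF that], of ?ys]
      by (simp add: assms(2))
  qed
  have code: "concat (?rows es) \<in> set exceptional_codes" if "es \<in> set exceptional_edges" for es
    using that unfolding exceptional_codes[symmetric] by simp
  show ?thesis
  proof
    assume less: "max_nullity G < zero_forcing_number G"
    have "settled ?R (trie_of exceptional_codes Void) UNIV"
      by (rule settled_8) (use assms(3) simple_graph_relation_axioms in auto)
    \<comment> \<open>The first alternative of \<open>settled\<close> would give a zero forcing
      number of at most the maximum nullity, against \<open>less\<close>.\<close>
    then obtain xs where xs: "distinct xs" "set xs = UNIV"
      "trie_member (concat (rows ?R xs)) (trie_of exceptional_codes Void)"
      unfolding settled_def
      using zero_forcing_number_le_max_nullity[OF assms(2)] less by (metis not_less)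
    then have "concat (rows ?R xs) \<in> set exceptional_codes"
      using trie_member_trie_of[of _ exceptional_codes Void] by auto
    then obtain es where es: "es \<in> set exceptional_edges" "concat (rows ?R xs) = concat (?rows es)"
      unfolding exceptional_codes[symmetric] by auto
    \<comment> \<open>Codes are flat, so their equality yields equality of the rows only for equal
      numbers of vertices.\<close>
    have "length xs = length ?ys"
      using distinct_card[OF xs(1)] assms(3) by (simp add: xs(2))
    then have "rows ?R xs = ?rows es"
      using split_rows[of xs ?R] split_rows[of ?ys "\<lambda>u v. (u, v) \<in> es \<or> (v, u) \<in> es"] es(2)
      by metis
    then show "\<exists>E\<in>{E1, E2, E3, E4, E5, E6, E7}. digraph_iso (with_proj G) (with_proj E)"
      unfolding exceptional_graphs using iso[OF es(1)] es(1) xs(1,2) by blast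
  next
    assume "\<exists>E\<in>{E1, E2, E3, E4, E5, E6, E7}. digraph_iso (with_proj G) (with_proj E)"
    then obtain es xs where es: "es \<in> set exceptional_edges"
      and xs: "distinct xs" "set xs = UNIV" "rows ?R xs = ?rows es"
      unfolding exceptional_graphs using iso by auto
    have "length xs = 8"
      using distinct_card[OF xs(1)] assms(3) by (simp add: xs(2))
    obtain k zs where "bounded_rows k zs (split_rows 8 (concat (?rows es)))"
      using code[OF es] by (rule bounded_exceptional)
    \<comment> \<open>The enumeration \<open>xs\<close> gives \<open>G\<close> the same rows as the
      exceptional graph, so the checked bounds apply to \<open>G\<close> directly and no invariance
      of the two parameters under isomorphism has to be proved.\<close>
    then have "bounded_rows k zs (rows ?R xs)"
      using split_rows[of xs ?R] unfolding xs(3) \<open>length xs = 8\<close> by simp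
    then show "max_nullity G < zero_forcing_number G"
      unfolding bounded_rows_def bounded_matrix_def
      by (intro max_nullity_less_zero_forcing_number[OF assms(2) simple_graph_relation_axioms xs(1,2),
            where us = "complete_matrix (rows ?R xs)" and k = k and zs = zs])
        (auto simp: complete_matrix_rows)
  qed
qed

end
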